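(* Let $(X,d,\mu)$ be a metric probability space satisfying Hypotheses $(\mathcal R)$ and $(\mathcal H)$. Then the following assertions are equivalent: (i) There exists a constant $C$ such that the function $t\mapsto \frac{I_\mu(t)}{t\log(1/t)}$ is essentially non-decreasing on $(0,1)$ with constant $C$. (ii) There exists a constant $K\ge1$ such that, on $[0,1]$, $\frac1K I_\mu\le I_{\mu^\infty}\le I_\mu$.
   Context: A metric probability space $(X,d,\mu)$ is a separable metric space $(X,d)$ with a Borel probability measure $\mu$. For a Borel set $A\subseteq X$ and $r>0$, let $A_r=\{x\in X : d(x,A)<r\}$, and define the outer and inner boundary measures $\mu^+(A)=\liminf_{r\to0^+}\frac{\mu(A_r)-\mu(A)}{r}$, $\mu^-(A)=\mu^+(X\setminus A)$. The isoperimetric function is, for $p\in[0,1]$, $I_\mu(p)=I_{(X,d,\mu)}(p)=\inf\{\min(\mu^+(A),\mu^-(A)) : A\subseteq X \text{ Borel},\ \mu(A)=p\}$ (infimum over the empty set being $+\infty$). For $n\ge1$, $X^n$ carries the product measure $\mu^n=\mu^{\otimes n}$ and the supremum distance $d_\infty^{(n)}(x,y)=\max_i d(x_i,y_i)$; write $I_{\mu^n}=I_{(X^n,d_\infty^{(n)},\mu^n)}$. The infinite dimensional isoperimetric profile is $I_{\mu^\infty}(t)=\inf_{n\ge1} I_{\mu^n}(t)$, $t\in[0,1]$. For a locally Lipschitz function $f:Y\to\mathbb R$ on a metric space $(Y,\rho)$, the modulus of gradient is $|\nabla f|(x)=\limsup_{\rho(x,y)\to0^+}\frac{|f(x)-f(y)|}{\rho(x,y)}$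 (equal to $0$ at isolated points). Hypothesis $(\mathcal H)$ for $(X,d,\mu)$: for every $m,n\ge 1$ and every locally Lipschitz $f:X^{m+n}\to\mathbb R$ (products carrying the supremum distances), for $\mu^{m+n}$-almost every $(x,y)\in X^m\times X^n$, $|\nabla f|(x,y)=|\nabla_x f|(x,y)+|\nabla_y f|(x,y)$, where $|\nabla_x f|(x,y)$ is the modulus of gradient of $f(\cdot,y)$ at $x$ and $|\nabla_y f|(x,y)$ that of $f(x,\cdot)$ at $y$. Hypothesis $(\mathcal R)$ for $(X,d,\mu)$: for all $t\in(0,1)$, $I_\mu(t)<+\infty$; and for all $n\ge1$, $t\in(0,1)$ and $\varepsilon>0$ there exists a Borel set $A\subset X^n$ with $\mu^n(A)=t$, $(\mu^n)^+(A)\le I_{\mu^n}(t)+\varepsilon$ and $(\mu^n)^+(A)=\lim_{h\to0^+}\frac{\mu^n(A_h\setminus A)}{h}$ (the limit exists), where $X^n$ is equipped with the supremum distance. For non-negative functions $f,g$ on $S\subset\mathbb R$ and $D\ge1$, $f\approx_D g$ means that there is $a>0$ with $a\,g(x)\le f(x)\le D\,a\,g(x)$ for all $x\in S$. A non-negative $f$ on $S$ is essentially non-decreasing with constant $D$ if there is a non-decreasing $g$ on $S$ with $f\approx_D g$. *)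

theory Defs
  imports "HOL-Probability.Probability"
begin

text \<open>
  A metric measure space is given by a measure \<open>N\<close>, whose \<open>space N\<close> is the underlying set, together
  with a distance \<open>d\<close> on \<open>space N\<close>. The base space is a type, with \<open>dist\<close>; its \<open>n\<close>-th power has as
  points the functions in \<open>{..<n} \<rightarrow>\<^sub>E UNIV\<close>, with the distance \<open>sup_dist n\<close>.
\<close>

section \<open>Isoperimetric profiles\<close>

definition borel_sets :: "'b set \<Rightarrow> ('b \<Rightarrow> 'b \<Rightarrow> real) \<Rightarrow> 'b set set" where
  "borel_sets S d = sigma_sets S {U. openin (Metric_space.mtopology S d) U}"

text \<open>The infimum is taken in \<^typ>\<open>ereal\<close>, so that \<open>d(x, \<emptyset>) = \<infinity>\<close> and the empty set has empty
  enlargements (unlike with \<^const>\<open>infdist\<close>).\<close>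

definition enlargement :: "'b set \<Rightarrow> ('b \<Rightarrow> 'b \<Rightarrow> real) \<Rightarrow> 'b set \<Rightarrow> real \<Rightarrow> 'b set" where
  "enlargement S d A r = {x \<in> S. (INF a\<in>A. ereal (d x a)) < ereal r}"

definition outer_boundary :: "'b measure \<Rightarrow> ('b \<Rightarrow> 'b \<Rightarrow> real) \<Rightarrow> 'b set \<Rightarrow> ereal" where
  "outer_boundary N d A =
     Liminf (at_right 0)
       (\<lambda>r. ereal ((measure N (enlargement (space N) d A r) - measure N A) / r))"

definition inner_boundary :: "'b measure \<Rightarrow> ('b \<Rightarrow> 'b \<Rightarrow> real) \<Rightarrow> 'b set \<Rightarrow> ereal" where
  "inner_boundary N d A = outer_boundary N d (space N - A)"

definition iso_profile :: "'b measure \<Rightarrow> ('b \<Rightarrow> 'b \<Rightarrow> real) \<Rightarrow> real \<Rightarrow> ereal" where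
  "iso_profile N d p =
     (INF A \<in> {A \<in> borel_sets (space N) d. measure N A = p}.
        min (outer_boundary N d A) (inner_boundary N d A))"

section \<open>Powers of the base space\<close>

definition power_measure :: "nat \<Rightarrow> 'a measure \<Rightarrow> (nat \<Rightarrow> 'a) measure" where
  "power_measure n M = PiM {..<n} (\<lambda>_. M)"

definition sup_dist :: "nat \<Rightarrow> (nat \<Rightarrow> 'a::metric_space) \<Rightarrow> (nat \<Rightarrow> 'a) \<Rightarrow> real" where
  "sup_dist n x y = Max ((\<lambda>i. dist (x i) (y i)) ` {..<n})"

definition iso_profile_pow :: "nat \<Rightarrow> 'a::metric_space measure \<Rightarrow> real \<Rightarrow> ereal" where
  "iso_profile_pow n M = iso_profile (power_measure n M) (sup_dist n)"

definition iso_profile_inf :: "'a::metric_space measure \<Rightarrow> real \<Rightarrow> ereal" where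
  "iso_profile_inf M t = (INF n\<in>{1..}. iso_profile_pow n M t)"

text \<open>The identification of \<open>X\<^sup>m \<times> X\<^sup>n\<close> with \<open>X\<^sup>m\<^sup>+\<^sup>n\<close>.\<close>

definition append_pt :: "nat \<Rightarrow> nat \<Rightarrow> (nat \<Rightarrow> 'a) \<Rightarrow> (nat \<Rightarrow> 'a) \<Rightarrow> (nat \<Rightarrow> 'a)" where
  "append_pt m n x y = (\<lambda>i\<in>{..<m + n}. if i < m then x i else y (i - m))"

section \<open>Modulus of gradient\<close>

definition locally_lipschitz :: "'b set \<Rightarrow> ('b \<Rightarrow> 'b \<Rightarrow> real) \<Rightarrow> ('b \<Rightarrow> real) \<Rightarrow> bool" where
  "locally_lipschitz S d f \<longleftrightarrow>
     (\<forall>x\<in>S. \<exists>r>0. \<exists>L. \<forall>y\<in>S. \<forall>z\<in>S. d x y < r \<longrightarrow> d x z < r \<longrightarrow> \<bar>f y - f z\<bar> \<le> L * d y z)"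

text \<open>The filter below is \<open>d(x, y) \<rightarrow> 0+\<close> with \<open>y\<close> ranging over \<open>S\<close>. At an isolated point it is
  trivial, and the upper limit in \<^typ>\<open>ennreal\<close> along the trivial filter is \<open>0\<close>.\<close>

definition grad_mod :: "'b set \<Rightarrow> ('b \<Rightarrow> 'b \<Rightarrow> real) \<Rightarrow> ('b \<Rightarrow> real) \<Rightarrow> 'b \<Rightarrow> ennreal" where
  "grad_mod S d f x =
     Limsup (inf (filtercomap (\<lambda>y. d x y) (at_right 0)) (principal S))
       (\<lambda>y. ennreal (\<bar>f x - f y\<bar> / d x y))"

definition grad_mod_pow :: "nat \<Rightarrow> ((nat \<Rightarrow> 'a::metric_space) \<Rightarrow> real) \<Rightarrow> (nat \<Rightarrow> 'a) \<Rightarrow> ennreal" where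
  "grad_mod_pow n = grad_mod ({..<n} \<rightarrow>\<^sub>E UNIV) (sup_dist n)"

section \<open>The two hypotheses\<close>

definition hypothesis_H :: "'a::metric_space measure \<Rightarrow> bool" where
  "hypothesis_H M \<longleftrightarrow>
     (\<forall>m\<ge>1. \<forall>n\<ge>1. \<forall>f. locally_lipschitz ({..<m + n} \<rightarrow>\<^sub>E UNIV) (sup_dist (m + n)) f \<longrightarrow>
        (AE z in power_measure (m + n) M.
           \<forall>x \<in> {..<m} \<rightarrow>\<^sub>E UNIV. \<forall>y \<in> {..<n} \<rightarrow>\<^sub>E UNIV. z = append_pt m n x y \<longrightarrow>
             grad_mod_pow (m + n) f z =
               grad_mod_pow m (\<lambda>x'. f (append_pt m n x' y)) x +
               grad_mod_pow n (\<lambda>y'. f (append_pt m n x y')) y))"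

definition hypothesis_R :: "'a::metric_space measure \<Rightarrow> bool" where
  "hypothesis_R M \<longleftrightarrow>
     (\<forall>t\<in>{0<..<1}. iso_profile M dist t < \<infinity>) \<and>
     (\<forall>n\<ge>1. \<forall>t\<in>{0<..<1}. \<forall>\<epsilon>>0.
        \<exists>A \<in> borel_sets ({..<n} \<rightarrow>\<^sub>E UNIV) (sup_dist n).
          measure (power_measure n M) A = t \<and>
          outer_boundary (power_measure n M) (sup_dist n) A \<le> iso_profile_pow n M t + ereal \<epsilon> \<and>
          ((\<lambda>h. ereal (measure (power_measure n M)
                  (enlargement ({..<n} \<rightarrow>\<^sub>E UNIV) (sup_dist n) A h - A) / h))
             \<longlongrightarrow> outer_boundary (power_measure n M) (sup_dist n) A) (at_right 0))"

section \<open>Essentially non-decreasing functions\<close>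

definition approx_const :: "real set \<Rightarrow> real \<Rightarrow> (real \<Rightarrow> real) \<Rightarrow> (real \<Rightarrow> real) \<Rightarrow> bool" where
  "approx_const S D f g \<longleftrightarrow>
     1 \<le> D \<and> (\<forall>x\<in>S. 0 \<le> f x) \<and> (\<forall>x\<in>S. 0 \<le> g x) \<and>
     (\<exists>a>0. \<forall>x\<in>S. a * g x \<le> f x \<and> f x \<le> D * a * g x)"

definition ess_nondecreasing_on :: "real set \<Rightarrow> real \<Rightarrow> (real \<Rightarrow> real) \<Rightarrow> bool" where
  "ess_nondecreasing_on S D f \<longleftrightarrow> (\<exists>g. mono_on S g \<and> approx_const S D f g)"

end

theory Submission
  imports Defs "HOL-Complex_Analysis.Great_Picard"
begin

text \<open>
  Write \<open>I\<close> for the profile of the space and \<open>F\<close> for its infinite dimensional profile.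

  From monotonicity to a dimension free bound, the tool is the family of functions
  \<open>J\<^sub>v(x) = x ln((1 + v) / (x + v))\<close> with \<open>0 < v \<le> 1/2\<close>, an entropy \<open>x ln(1/x)\<close> whose logarithm stops
  growing below \<open>v\<close>. Each satisfies
  \<open>J\<^sub>v(E f) \<le> E J\<^sub>v(f) + \<integral> J\<^sub>v(P(f > t)) dt\<close> for every \<open>f\<close> with values in \<open>[0,1]\<close>
  (\<open>capped_entropy_expectation_le\<close>). If \<open>k J\<^sub>v \<le> I\<close>, the coarea inequality turns the last term into the
  mean of a gradient: \<open>k J\<^sub>v(E f) \<le> E (k J\<^sub>v(f)) + E |grad f|\<close>. This functional inequality passes to
  products with unchanged constants, since under the hypothesis on gradients one can apply it to each
  factor in turn (\<open>functional_isoperimetry_append\<close>). Applied to ramps that approximate the indicator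
  of \<open>A\<close>, it says that \<open>k J\<^sub>v(p)\<close> and \<open>k J\<^sub>v(1 - p)\<close> are at most the outer boundary of \<open>A\<close>, where \<open>p\<close> is
  the measure of \<open>A\<close>. Essential monotonicity of \<open>I(t) / (t ln(1/t))\<close> is what makes
  \<open>k J\<^sub>v \<le> I\<close> hold with a \<open>k\<close> for which \<open>k J\<^sub>v(v)\<close> is comparable to \<open>I(v)\<close>
  (\<open>scaled_capped_entropy_le\<close>); choosing \<open>v = min t (1 - t)\<close> gives the lower bound for \<open>F(t)\<close>.

  For the converse it suffices that \<open>F\<close> itself has the monotonicity property, which holds with the
  constant \<open>5\<close> in every space satisfying the regularity hypothesis. Complements and product sets give
  \<open>F(1 - t) = F(t)\<close> and \<open>F(a b) \<le> a F(b) + b F(a)\<close>. These two facts are not enough: the absolute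
  value of a nonzero derivation of the field of real numbers has them and is unbounded on every interval. But \<open>F\<close> is
  bounded. Indeed, the measures of those sets \<open>A\<close> whose enlargements satisfy
  \<open>\<mu>(A\<^sub>h) \<le> \<mu>(A) + n h\<close> for small \<open>h\<close> form a closed set, because pointwise limits of distance functions
  are again Lipschitz; by regularity these closed sets cover \<open>(0,1)\<close>, so by Baire's theorem one of them
  contains an interval (\<open>iso_profile_bounded_on_interval\<close>), and powers spread the bound to \<open>(0,1)\<close>.
  Now fix \<open>t\<close>. Every other \<open>s\<close> is \<open>t x\<close> or \<open>t + (1 - t) x\<close>, so \<open>F(s)\<close> is at most \<open>F(t)\<close> plus a contraction of
  the supremum of \<open>F\<close>; hence that supremum is at most \<open>F(t) / min t (1 - t)\<close>. Powers of \<open>t\<close> refine this to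
  \<open>F(s) / (s ln(1/s)) \<le> 5 F(t) / (t ln(1/t))\<close> for \<open>s \<le> t\<close> (\<open>entropy_ratio_le\<close>).
\<close>

section \<open>Slopes and boundaries in metric probability spaces\<close>

lemma enlargement_iff: "x \<in> enlargement S d A r \<longleftrightarrow> x \<in> S \<and> (\<exists>a\<in>A. d x a < r)"
  by (simp add: enlargement_def INF_less_iff)

definition lipschitz_with :: "real \<Rightarrow> 'b set \<Rightarrow> ('b \<Rightarrow> 'b \<Rightarrow> real) \<Rightarrow> ('b \<Rightarrow> real) \<Rightarrow> bool" where
  "lipschitz_with L S d f \<longleftrightarrow> 0 \<le> L \<and> (\<forall>x\<in>S. \<forall>y\<in>S. \<bar>f x - f y\<bar> \<le> L * d x y)"

text \<open>
  Suprema of difference quotients over punctured balls of radius \<open>1 / (k + 1)\<close>; the modulus of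
  gradient is their decreasing limit. For Lipschitz functions they are lower semicontinuous, whence
  measurable, and the modulus of gradient inherits measurability.
\<close>

definition slope :: "nat \<Rightarrow> 'b set \<Rightarrow> ('b \<Rightarrow> 'b \<Rightarrow> real) \<Rightarrow> ('b \<Rightarrow> real) \<Rightarrow> 'b \<Rightarrow> ennreal" where
  "slope k S d f x =
     (SUP y\<in>{y\<in>S. 0 < d x y \<and> d x y < 1 / Suc k}. ennreal (\<bar>f x - f y\<bar> / d x y))"

lemma decseq_slope: "decseq (\<lambda>k. slope k S d f)"
proof (intro decseq_SucI le_funI)
  fix k x
  have "1 / real (Suc (Suc k)) \<le> 1 / real (Suc k)" by (intro divide_left_mono) auto
  then show "slope (Suc k) S d f x \<le> slope k S d f x"
    unfolding slope_def by (intro SUP_subset_mono) auto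
qed

lemma eventually_punctured:
  "eventually P (inf (filtercomap (\<lambda>y. d x y) (at_right 0)) (principal S)) \<longleftrightarrow>
     (\<exists>b>0. \<forall>y\<in>S. 0 < d x y \<longrightarrow> d x y < (b::real) \<longrightarrow> P y)"
proof
  assume "eventually P (inf (filtercomap (\<lambda>y. d x y) (at_right 0)) (principal S))"
  then obtain Q where Q: "eventually Q (at_right 0)" "\<And>y. Q (d x y) \<Longrightarrow> y \<in> S \<Longrightarrow> P y"
    unfolding eventually_inf_principal eventually_filtercomap by blast
  from Q(1) obtain b where "0 < b" "\<And>r. 0 < r \<Longrightarrow> r < b \<Longrightarrow> Q r"
    unfolding eventually_at_right_field by blast
  with Q(2) show "\<exists>b>0. \<forall>y\<in>S. 0 < d x y \<longrightarrow> d x y < b \<longrightarrow> P y" by blast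
next
  assume "\<exists>b>0. \<forall>y\<in>S. 0 < d x y \<longrightarrow> d x y < b \<longrightarrow> P y"
  then obtain b where b: "0 < b" "\<And>y. y \<in> S \<Longrightarrow> 0 < d x y \<Longrightarrow> d x y < b \<Longrightarrow> P y" by blast
  show "eventually P (inf (filtercomap (\<lambda>y. d x y) (at_right 0)) (principal S))"
    unfolding eventually_inf_principal eventually_filtercomap
  proof (intro exI[of _ "\<lambda>r. 0 < r \<and> r < b"] conjI allI impI)
    show "eventually (\<lambda>r. 0 < r \<and> r < b) (at_right 0)"
      unfolding eventually_at_right_field using b(1) by blast
  qed (use b(2) in blast)
qed

lemma grad_mod_eq_INF_slope: "grad_mod S d f x = (INF k. slope k S d f x)"
proof (rule antisym)
  show "grad_mod S d f x \<le> (INF k. slope k S d f x)"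
  proof (rule INF_greatest)
    fix k
    have "eventually (\<lambda>y. ennreal (\<bar>f x - f y\<bar> / d x y) \<le> slope k S d f x)
        (inf (filtercomap (\<lambda>y. d x y) (at_right 0)) (principal S))"
      unfolding eventually_punctured
      by (intro exI[of _ "1 / Suc k"]) (auto simp: slope_def intro!: SUP_upper)
    then show "grad_mod S d f x \<le> slope k S d f x"
      unfolding grad_mod_def by (rule Limsup_bounded)
  qed
  show "(INF k. slope k S d f x) \<le> grad_mod S d f x"
    unfolding grad_mod_def Limsup_def
  proof (rule INF_greatest)
    fix P assume "P \<in> {P. eventually P (inf (filtercomap (\<lambda>y. d x y) (at_right 0)) (principal S))}"
    then obtain b where b: "0 < b" "\<And>y. y \<in> S \<Longrightarrow> 0 < d x y \<Longrightarrow> d x y < b \<Longrightarrow> P y"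
      by (auto simp: eventually_punctured)
    then obtain k where k: "1 / Suc k < b" using nat_approx_posE by blast
    have "slope k S d f x \<le> (SUP y\<in>Collect P. ennreal (\<bar>f x - f y\<bar> / d x y))"
      unfolding slope_def using b k by (intro SUP_subset_mono) auto
    then show "(INF k. slope k S d f x) \<le> (SUP y\<in>Collect P. ennreal (\<bar>f x - f y\<bar> / d x y))"
      by (rule INF_lower2[OF UNIV_I])
  qed
qed

lemma (in Metric_space) openin_dist_iff:
  "openin mtopology U \<longleftrightarrow> U \<subseteq> M \<and> (\<forall>x\<in>U. \<exists>r>0. \<forall>y\<in>M. d x y < r \<longrightarrow> y \<in> U)"
proof -
  have "mball x r \<subseteq> U \<longleftrightarrow> (\<forall>y\<in>M. d x y < r \<longrightarrow> y \<in> U)" if "x \<in> M" for x r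
    using that by (simp only: subset_iff in_mball) blast
  then show ?thesis unfolding openin_mtopology subset_iff by meson
qed

text \<open>
  Only the measurability of open sets ties the measure to the distance, so that the locale covers
  the base space and all its powers at once.
\<close>

locale metric_prob_space = prob_space N + metric: Metric_space "space N" d
  for N :: "'b measure" and d +
  assumes open_sets: "openin metric.mtopology U \<Longrightarrow> U \<in> sets N"
begin

lemma borel_sets_sets: "A \<in> borel_sets (space N) d \<Longrightarrow> A \<in> sets N"
proof -
  assume "A \<in> borel_sets (space N) d"
  moreover have "{U. openin metric.mtopology U} \<subseteq> sets N" using open_sets by auto
  then have "borel_sets (space N) d \<subseteq> sets N"
    unfolding borel_sets_def by (rule sets.sigma_sets_subset)
  ultimately show "A \<in> sets N" by (rule subsetD[rotated])
qed

lemma open_enlargement: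
  assumes "A \<subseteq> space N" shows "openin metric.mtopology (enlargement (space N) d A r)"
  unfolding metric.openin_dist_iff
proof (intro conjI ballI)
  fix x assume "x \<in> enlargement (space N) d A r"
  then obtain a where a: "x \<in> space N" "a \<in> A" "d x a < r" by (auto simp: enlargement_iff)
  show "\<exists>e>0. \<forall>y\<in>space N. d x y < e \<longrightarrow> y \<in> enlargement (space N) d A r"
  proof (intro exI[of _ "r - d x a"] conjI ballI impI)
    fix y assume y: "y \<in> space N" "d x y < r - d x a"
    have "d y a \<le> d x y + d x a" using metric.triangle''[of y x a] y a assms by auto
    then show "y \<in> enlargement (space N) d A r" using y a by (auto simp: enlargement_iff intro!: bexI[of _ a])
  qed (use a in simp)
qed (auto simp: enlargement_iff)

lemma enlargement_sets [measurable]: "A \<subseteq> space N \<Longrightarrow> enlargement (space N) d A r \<in> sets N"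
  by (intro open_sets open_enlargement)

lemma subset_enlargement: "A \<subseteq> space N \<Longrightarrow> 0 < r \<Longrightarrow> A \<subseteq> enlargement (space N) d A r"
proof
  fix x assume "A \<subseteq> space N" "0 < r" "x \<in> A"
  moreover from this have "d x x = 0" using metric.mdist_zero by blast
  ultimately show "x \<in> enlargement (space N) d A r" by (auto simp: enlargement_iff intro!: bexI[of _ x])
qed

lemma outer_boundary_nonneg: 
  assumes "A \<subseteq> space N" shows "0 \<le> outer_boundary N d A"
  unfolding outer_boundary_def
proof (rule Liminf_bounded)
  have "eventually (\<lambda>r::real. 0 < r) (at_right 0)" by (simp add: eventually_at_right_less)
  then show "\<forall>\<^sub>F r in at_right 0. 0 \<le> ereal ((prob (enlargement (space N) d A r) - prob A) / r)"
  proof eventually_elim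
    case (elim r)
    then have "prob A \<le> prob (enlargement (space N) d A r)"
      using assms by (intro finite_measure_mono subset_enlargement enlargement_sets)
    with elim show ?case by simp
  qed
qed

lemma borel_sets_space: "A \<in> borel_sets (space N) d \<Longrightarrow> A \<subseteq> space N"
  using borel_sets_sets sets.sets_into_space by blast

lemma borel_sets_compl: "A \<in> borel_sets (space N) d \<Longrightarrow> space N - A \<in> borel_sets (space N) d"
  unfolding borel_sets_def by (rule sigma_sets.Compl)

lemma iso_profile_nonneg: "0 \<le> iso_profile N d p"
  unfolding iso_profile_def inner_boundary_def
  by (intro INF_greatest) (auto intro!: outer_boundary_nonneg dest: borel_sets_space)

lemma iso_profile_sym_le: "iso_profile N d (1 - p) \<le> iso_profile N d p"
  unfolding iso_profile_def
proof (rule INF_mono)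
  fix A assume A: "A \<in> {A \<in> borel_sets (space N) d. prob A = p}"
  then have "space N - (space N - A) = A" "prob (space N - A) = 1 - p"
    using borel_sets_sets[of A] borel_sets_space[of A] by (auto simp: prob_compl)
  then show "\<exists>B\<in>{A \<in> borel_sets (space N) d. prob A = 1 - p}.
     min (outer_boundary N d B) (inner_boundary N d B) \<le> min (outer_boundary N d A) (inner_boundary N d A)"
    using A borel_sets_compl by (intro bexI[of _ "space N - A"]) (auto simp: inner_boundary_def min.commute)
qed

lemma iso_profile_sym: "iso_profile N d (1 - p) = iso_profile N d p"
  using iso_profile_sym_le[of p] iso_profile_sym_le[of "1 - p"] by simp

lemma open_borel_sets: "openin metric.mtopology U \<Longrightarrow> U \<in> borel_sets (space N) d"
  unfolding borel_sets_def by (intro sigma_sets.Basic) simp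

lemma iso_profile_le_outer:
  "A \<in> borel_sets (space N) d \<Longrightarrow> iso_profile N d (prob A) \<le> outer_boundary N d A"
  unfolding iso_profile_def by (rule INF_lower2[of A]) auto

text \<open>
  The empty set has empty enlargements, so its outer boundary vanishes.
\<close>

lemma iso_profile_0: "iso_profile N d 0 = 0"
proof -
  have "outer_boundary N d {} = 0" unfolding outer_boundary_def
    by (intro lim_imp_Liminf) (simp_all add: enlargement_def top_ereal_def zero_ereal_def)
  moreover have "{} \<in> borel_sets (space N) d" by (intro open_borel_sets) simp
  ultimately show ?thesis using iso_profile_le_outer[of "{}"] iso_profile_nonneg[of 0] by simp
qed

lemma open_less_lipschitz:
  assumes "lipschitz_with L (space N) d f"
  shows "openin metric.mtopology {x \<in> space N. t < f x}"
  unfolding metric.openin_dist_iff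
proof (intro conjI ballI)
  fix x assume x: "x \<in> {x \<in> space N. t < f x}"
  show "\<exists>r>0. \<forall>y\<in>space N. d x y < r \<longrightarrow> y \<in> {x \<in> space N. t < f x}"
  proof (intro exI[of _ "(f x - t) / (L + 1)"] conjI ballI impI)
    show "0 < (f x - t) / (L + 1)" using x assms by (auto simp: lipschitz_with_def)
    fix y assume y: "y \<in> space N" "d x y < (f x - t) / (L + 1)"
    have L: "0 \<le> L" using assms by (auto simp: lipschitz_with_def)
    have "\<bar>f x - f y\<bar> \<le> L * d x y" using assms x y by (auto simp: lipschitz_with_def)
    also have "\<dots> \<le> (L + 1) * d x y" by (intro mult_right_mono) auto
    also have "\<dots> < f x - t" using y L by (simp add: pos_less_divide_eq mult.commute)
    finally show "y \<in> {x \<in> space N. t < f x}" using y by auto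
  qed
qed auto

lemma lipschitz_measurable:
  "lipschitz_with L (space N) d f \<Longrightarrow> f \<in> borel_measurable N"
  by (intro borel_measurableI_greater open_sets open_less_lipschitz)

lemma lipschitz_dist: "y \<in> space N \<Longrightarrow> lipschitz_with 1 (space N) d (\<lambda>x. d x y)"
  using metric.mdist_reverse_triangle[of _ y] metric.commute[of y]
  by (simp add: lipschitz_with_def)

text \<open>
  For fixed \<open>y\<close> the condition \<open>r < \<bar>f x - f y\<bar> / d x y\<close> reads \<open>0 < \<bar>f x - f y\<bar> - r d x y\<close>, which is open
  in \<open>x\<close>; the supremum over \<open>y\<close> makes an arbitrary, possibly uncountable, union of open sets.
\<close>

lemma slope_measurable:
  assumes f: "lipschitz_with L (space N) d f"
  shows "slope k (space N) d f \<in> borel_measurable N"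
proof (rule borel_measurableI_greater)
  fix c :: ennreal
  show "{x \<in> space N. c < slope k (space N) d f x} \<in> sets N"
  proof (cases c)
    case top
    then show ?thesis by simp
  next
    case (real r)
    have "{x \<in> space N. c < slope k (space N) d f x} =
        (\<Union>y\<in>space N. {x \<in> space N. 0 < d x y} \<inter> {x \<in> space N. - (1 / Suc k) < - d x y}
            \<inter> {x \<in> space N. 0 < \<bar>f x - f y\<bar> - r * d x y})"
      (is "?A = ?B")
    proof (intro set_eqI)
      fix x
      have "x \<in> ?A \<longleftrightarrow> x \<in> space N \<and> (\<exists>y\<in>space N. 0 < d x y \<and> d x y < 1 / Suc k \<and> ennreal r < ennreal (\<bar>f x - f y\<bar> / d x y))"
        using real(2) unfolding slope_def less_SUP_iff by blast
      also have "\<dots> \<longleftrightarrow> x \<in> space N \<and> (\<exists>y\<in>space N. 0 < d x y \<and> d x y < 1 / Suc k \<and> r * d x y < \<bar>f x - f y\<bar>)"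
        using real(1) by (intro conj_cong refl bex_cong) (auto simp: ennreal_less_iff pos_less_divide_eq)
      also have "\<dots> \<longleftrightarrow> x \<in> ?B" by (simp only: UN_iff Int_iff mem_Collect_eq neg_less_iff_less diff_gt_0_iff_gt) blast
      finally show "x \<in> ?A \<longleftrightarrow> x \<in> ?B" .
    qed
    moreover have "openin metric.mtopology \<dots>"
    proof (intro openin_Union openin_Int ballI; clarify?)
      fix U y assume y: "y \<in> space N"
      have 1: "lipschitz_with 1 (space N) d (\<lambda>x. d x y)" by (rule lipschitz_dist[OF y])
      have 2: "lipschitz_with 1 (space N) d (\<lambda>x. - d x y)"
        using 1 by (auto simp: lipschitz_with_def abs_minus_commute)
      have 3: "lipschitz_with (L + r) (space N) d (\<lambda>x. \<bar>f x - f y\<bar> - r * d x y)"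
        unfolding lipschitz_with_def
      proof (intro conjI ballI)
        show "0 \<le> L + r" using f real by (auto simp: lipschitz_with_def)
        fix a b assume ab: "a \<in> space N" "b \<in> space N"
        have "\<bar>f a - f b\<bar> \<le> L * d a b" using f ab by (auto simp: lipschitz_with_def)
        moreover have "r * \<bar>d a y - d b y\<bar> \<le> r * (1 * d a b)"
          using 1 ab real by (intro mult_left_mono) (auto simp: lipschitz_with_def)
        moreover have "\<bar>r * d a y - r * d b y\<bar> = r * \<bar>d a y - d b y\<bar>"
          using real by (metis abs_mult abs_of_nonneg right_diff_distrib)
        ultimately show "\<bar>\<bar>f a - f y\<bar> - r * d a y - (\<bar>f b - f y\<bar> - r * d b y)\<bar> \<le> (L + r) * d a b"
          by (simp add: distrib_right)
      qed
      show "openin metric.mtopology ({x \<in> space N. 0 < d x y} \<inter> {x \<in> space N. - (1 / Suc k) < - d x y}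
            \<inter> {x \<in> space N. 0 < \<bar>f x - f y\<bar> - r * d x y})"
        by (intro openin_Int open_less_lipschitz[OF 1] open_less_lipschitz[OF 2] open_less_lipschitz[OF 3])
    qed
    ultimately show ?thesis by (simp add: open_sets)
  qed
qed

lemma slope_le:
  assumes "lipschitz_with L (space N) d f" "x \<in> space N"
  shows "slope k (space N) d f x \<le> ennreal L"
  unfolding slope_def using assms
  by (intro SUP_least) (auto simp: lipschitz_with_def pos_divide_le_eq intro!: ennreal_leI)

lemma grad_mod_measurable:
  assumes "lipschitz_with L (space N) d f"
  shows "grad_mod (space N) d f \<in> borel_measurable N"
  unfolding grad_mod_eq_INF_slope[abs_def]
  by (intro borel_measurable_INF slope_measurable[OF assms]) simp

lemma grad_mod_le:
  assumes "lipschitz_with L (space N) d f" "x \<in> space N"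
  shows "grad_mod (space N) d f x \<le> ennreal L"
  unfolding grad_mod_eq_INF_slope by (rule INF_lower2[of 0]) (use slope_le[OF assms] in auto)

lemma grad_mod_locally_constant:
  assumes "0 < e" "\<And>y. y \<in> space N \<Longrightarrow> d x y < e \<Longrightarrow> f y = f x"
  shows "grad_mod (space N) d f x = 0"
proof -
  have "grad_mod (space N) d f x \<le> 0" unfolding grad_mod_def
    by (rule Limsup_bounded) (use assms in \<open>auto simp: eventually_punctured intro!: exI[of _ e]\<close>)
  then show ?thesis by simp
qed

lemma nn_integral_grad_mod:
  assumes f: "lipschitz_with L (space N) d f"
  shows "(\<integral>\<^sup>+x. grad_mod (space N) d f x \<partial>N) = (INF k. \<integral>\<^sup>+x. slope k (space N) d f x \<partial>N)"
  unfolding grad_mod_eq_INF_slope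
proof (rule nn_integral_monotone_convergence_INF_decseq)
  show "decseq (\<lambda>k. slope k (space N) d f)" by (rule decseq_slope)
  show "slope k (space N) d f \<in> borel_measurable N" for k by (rule slope_measurable[OF f])
  have "(\<integral>\<^sup>+x. slope 0 (space N) d f x \<partial>N) \<le> (\<integral>\<^sup>+x. ennreal L \<partial>N)"
    by (intro nn_integral_mono slope_le[OF f])
  also have "\<dots> < \<infinity>" by (simp add: emeasure_space_1)
  finally show "(\<integral>\<^sup>+x. slope 0 (space N) d f x \<partial>N) < \<infinity>" .
qed

end

section \<open>The entropy inequality\<close>

text \<open>
  The entropy \<open>x ln(1/x)\<close>, whose logarithm is capped near \<open>ln(1/v)\<close> as \<open>x\<close> becomes smaller than \<open>v\<close>.
\<close>

definition capped_entropy :: "real \<Rightarrow> real \<Rightarrow> real" where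
  "capped_entropy v x = x * ln ((1 + v) / (x + v))"

lemma capped_entropy_0 [simp]: "capped_entropy v 0 = 0"
  by (simp add: capped_entropy_def)

lemma capped_entropy_1 [simp]: "0 < v \<Longrightarrow> capped_entropy v 1 = 0"
  by (simp add: capped_entropy_def add_ac)

lemma capped_entropy_nonneg:
  assumes "0 < v" "0 \<le> x" "x \<le> 1"
  shows "0 \<le> capped_entropy v x"
  unfolding capped_entropy_def using assms by (intro mult_nonneg_nonneg ln_ge_zero) (auto simp: field_simps)

lemma capped_entropy_le:
  assumes "0 < v" "0 \<le> x" "x \<le> 1"
  shows "capped_entropy v x \<le> ln ((1 + v) / v)"
proof -
  have "(1 + v) / (x + v) \<le> (1 + v) / v" using assms by (intro divide_left_mono) auto
  then have "ln ((1 + v) / (x + v)) \<le> ln ((1 + v) / v)" using assms by (subst ln_le_cancel_iff) auto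
  moreover have "0 \<le> ln ((1 + v) / v)" using assms by (intro ln_ge_zero) (auto simp: field_simps)
  ultimately have "x * ln ((1 + v) / (x + v)) \<le> 1 * ln ((1 + v) / v)"
    using assms by (intro order.trans[OF mult_left_mono[of _ _ x] mult_right_mono]) auto
  then show ?thesis by (simp add: capped_entropy_def)
qed

lemma capped_entropy_measurable [measurable]: "capped_entropy v \<in> borel_measurable borel"
  unfolding capped_entropy_def by measurable

lemma continuous_on_capped_entropy: "0 < v \<Longrightarrow> continuous_on {0..1} (capped_entropy v)"
  unfolding capped_entropy_def by (intro continuous_intros) auto

text \<open>
  Bound the logarithm by its tangent at \<open>c = (1 + v) / (p + v)\<close>, where \<open>p\<close> is the probability of \<open>A\<close>.
  This \<open>c\<close> is the value of \<open>(f + v) / (E f + v)\<close> on \<open>A\<close> when \<open>f\<close> is the indicator of \<open>A\<close>, the extremal case.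
\<close>

lemma (in prob_space) integral_ln_on_event_le:
  assumes v: "0 < v" and f [measurable]: "f \<in> borel_measurable M"
    and f01: "\<And>x. x \<in> space M \<Longrightarrow> 0 \<le> f x" "\<And>x. x \<in> space M \<Longrightarrow> f x \<le> 1"
    and A [measurable]: "A \<in> sets M"
  shows "(\<integral>x. indicator A x * ln ((f x + v) / (expectation f + v)) \<partial>M)
           \<le> capped_entropy v (prob A)"
proof -
  define m where "m = expectation f"
  define p where "p = prob A"
  define c where "c = (1 + v) / (p + v)"
  have p: "0 \<le> p" "p \<le> 1" by (auto simp: p_def)
  have c: "0 < c" using p v by (simp add: c_def)
  have intf: "integrable M f" using f01 by (intro integrable_const_bound[of _ 1]) auto
  then have intAf: "integrable M (\<lambda>x. indicator A x * f x)"
    using f01 by (intro integrable_const_bound[of _ 1]) (auto simp: indicator_def)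
  define q where "q = (\<integral>x. indicator A x * f x \<partial>M)"
  have m0: "0 \<le> m" unfolding m_def using f01 by (intro integral_nonneg_AE) auto
  have qm: "q \<le> m" unfolding q_def m_def using f01 intf intAf
    by (intro integral_mono) (auto simp: indicator_def)
  have q0: "0 \<le> q" unfolding q_def using f01 by (intro integral_nonneg_AE) (auto simp: indicator_def)
  have intA: "integrable M (indicator A :: _ \<Rightarrow> real)"
    by (intro integrable_real_indicator) (auto simp: emeasure_eq_measure)
  have qp: "q \<le> p"
  proof -
    have "q \<le> (\<integral>x. indicator A x \<partial>M)" unfolding q_def using f01 intA
      by (intro integral_mono intAf) (auto split: split_indicator)
    then show ?thesis by (simp add: p_def)
  qed
  have tangent: "indicator A x * ln ((f x + v) / (m + v))
      \<le> (ln c - 1 + v / (c * (m + v))) * indicator A x + 1 / (c * (m + v)) * (indicator A x * f x)"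
    if x: "x \<in> space M" for x
  proof (cases "x \<in> A")
    case True
    define y where "y = (f x + v) / (m + v)"
    have y: "0 < y" using f01[OF x] m0 v by (simp add: y_def)
    have "ln (y / c) \<le> y / c - 1" using y c by (intro ln_le_minus_one) auto
    then have "ln y \<le> ln c - 1 + y / c" using y c by (simp add: ln_div)
    also have "y / c = v / (c * (m + v)) + 1 / (c * (m + v)) * f x"
      unfolding y_def by (simp add: add_divide_distrib mult.commute)
    finally show ?thesis using True by (simp add: y_def)
  qed simp
  have bnd: "integrable M (\<lambda>x. indicator A x * ln ((f x + v) / (m + v)))"
  proof (intro integrable_const_bound[of _ "max \<bar>ln (v / (m + v))\<bar> \<bar>ln ((1 + v) / (m + v))\<bar>"])
    show "AE x in M. norm (indicator A x * ln ((f x + v) / (m + v)))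
      \<le> max \<bar>ln (v / (m + v))\<bar> \<bar>ln ((1 + v) / (m + v))\<bar>"
    proof (intro AE_I2)
      fix x assume x: "x \<in> space M"
      have "ln (v / (m + v)) \<le> ln ((f x + v) / (m + v))"
        using f01[OF x] v m0 by (subst ln_le_cancel_iff) (auto simp: divide_right_mono)
      moreover have "ln ((f x + v) / (m + v)) \<le> ln ((1 + v) / (m + v))"
        using f01[OF x] v m0 by (subst ln_le_cancel_iff) (auto simp: divide_right_mono)
      ultimately show "norm (indicator A x * ln ((f x + v) / (m + v)))
          \<le> max \<bar>ln (v / (m + v))\<bar> \<bar>ln ((1 + v) / (m + v))\<bar>"
        by (auto simp: indicator_def)
    qed
  qed measurable
  have "(\<integral>x. indicator A x * ln ((f x + v) / (m + v)) \<partial>M)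
      \<le> (\<integral>x. (ln c - 1 + v / (c * (m + v))) * indicator A x + 1 / (c * (m + v)) * (indicator A x * f x) \<partial>M)"
    by (intro integral_mono bnd tangent Bochner_Integration.integrable_add integrable_mult_right intAf intA) auto
  also have "\<dots> = (ln c - 1 + v / (c * (m + v))) * p + 1 / (c * (m + v)) * q"
    using intAf intA by (subst Bochner_Integration.integral_add) (auto simp: p_def q_def)
  also have "\<dots> = p * ln c - p + (q + p * v) / (m + v) / c"
    by (simp add: algebra_simps add_divide_distrib)
  also have "\<dots> \<le> p * ln c"
  proof -
    \<comment> \<open>\<open>(q + p v) / (q + v)\<close> increases with \<open>q\<close>, because \<open>p \<le> 1\<close>.\<close>
    have "(q + p * v) / (m + v) \<le> (q + p * v) / (q + v)"
      using qm q0 p v by (intro divide_left_mono) auto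
    also have "\<dots> \<le> p * c"
    proof -
      have "0 \<le> (p - q) * ((1 - p) * v)" using qp p v by simp
      then have "(q + p * v) * (p + v) \<le> p * (1 + v) * (q + v)" by (simp add: algebra_simps)
      then show ?thesis using q0 v p by (simp add: c_def divide_le_eq pos_le_divide_eq mult_ac)
    qed
    finally have "(q + p * v) / (m + v) / c \<le> p" using pos_divide_le_eq[OF c] by blast
    then show ?thesis by simp
  qed
  finally show ?thesis by (simp add: m_def c_def p_def capped_entropy_def)
qed

text \<open>
  The defect \<open>J(E f) - E J(f)\<close> equals \<open>E (f g)\<close> with \<open>g = ln((f + v) / (E f + v))\<close>. Writing \<open>f\<close> as the
  integral of the indicators of \<open>{f > t}\<close> makes this a mixture of expectations of \<open>g\<close> over the level sets.
\<close>

lemma (in prob_space) capped_entropy_expectation_le: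
  assumes v: "0 < v" and f [measurable]: "f \<in> borel_measurable M"
    and f01: "\<And>x. x \<in> space M \<Longrightarrow> 0 \<le> f x" "\<And>x. x \<in> space M \<Longrightarrow> f x \<le> 1"
  shows "ennreal (capped_entropy v (expectation f))
    \<le> (\<integral>\<^sup>+x. ennreal (capped_entropy v (f x)) \<partial>M)
     + (\<integral>\<^sup>+t. ennreal (capped_entropy v (prob {x \<in> space M. t < f x})) \<partial>restrict_space lborel {0..1})"
proof -
  define m where "m = expectation f"
  have m0: "0 \<le> m" unfolding m_def using f01 by (intro integral_nonneg_AE) auto
  define g where "g x = ln ((f x + v) / (m + v))" for x
  have [measurable]: "g \<in> borel_measurable M" unfolding g_def by measurable
  define R where "R = restrict_space lborel {0..1::real}"
  have sR [simp]: "space R = {0..1}" by (simp add: R_def space_restrict_space)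
  have setsR: "sets R = sets (restrict_space borel {0..1})" 
    unfolding R_def by (simp add: sets_restrict_space)
  interpret R: prob_space R
    by (rule prob_spaceI) (simp add: R_def emeasure_restrict_space space_restrict_space)
  interpret P: pair_prob_space M R ..
  have mR: "h \<in> borel_measurable R" if "h \<in> borel_measurable borel" for h :: "real \<Rightarrow> real"
    unfolding R_def using that by (intro measurable_restrict_space1) auto
  have idR [measurable]: "(\<lambda>t. t) \<in> borel_measurable R" by (rule mR) auto
  have gb: "\<bar>g x\<bar> \<le> max \<bar>ln (v / (m + v))\<bar> \<bar>ln ((1 + v) / (m + v))\<bar>" if x: "x \<in> space M" for x
  proof -
    have "ln (v / (m + v)) \<le> ln ((f x + v) / (m + v))"
      using f01[OF x] v m0 by (subst ln_le_cancel_iff) (auto simp: divide_right_mono)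
    moreover have "ln ((f x + v) / (m + v)) \<le> ln ((1 + v) / (m + v))"
      using f01[OF x] v m0 by (subst ln_le_cancel_iff) (auto simp: divide_right_mono)
    ultimately show ?thesis by (auto simp: g_def)
  qed
  let ?J = "capped_entropy v"
  have Jb: "\<bar>?J p\<bar> \<le> ln ((1 + v) / v)" if "0 \<le> p" "p \<le> 1" for p
    using capped_entropy_nonneg[OF v that] capped_entropy_le[OF v that] by simp
  have intf: "integrable M f" using f01 by (intro integrable_const_bound[of _ 1]) auto
  have intJ: "integrable M (\<lambda>x. ?J (f x))"
    using Jb f01 by (intro integrable_const_bound[of _ "ln ((1 + v) / v)"]) auto
  have fg: "f x * g x = f x * ln ((1 + v) / (m + v)) - ?J (f x)" if x: "x \<in> space M" for x
    using f01[OF x] v m0 by (simp add: g_def capped_entropy_def ln_div algebra_simps)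
  have "(\<integral>x. f x * g x \<partial>M) = (\<integral>x. f x * ln ((1 + v) / (m + v)) - ?J (f x) \<partial>M)"
    by (intro Bochner_Integration.integral_cong fg) auto
  also have "\<dots> = ?J m - (\<integral>x. ?J (f x) \<partial>M)"
    using intf intJ by (simp add: m_def capped_entropy_def)
  finally have A: "?J m = (\<integral>x. ?J (f x) \<partial>M) + (\<integral>x. f x * g x \<partial>M)" by simp
  have intP: "integrable (M \<Otimes>\<^sub>M R) (\<lambda>(x, t). indicator {t. t < f x} t * g x)"
  proof (intro P.integrable_const_bound[of _ "max \<bar>ln (v / (m + v))\<bar> \<bar>ln ((1 + v) / (m + v))\<bar>"] AE_I2)
    show "norm (case z of (x, t) \<Rightarrow> indicator {t. t < f x} t * g x)
       \<le> max \<bar>ln (v / (m + v))\<bar> \<bar>ln ((1 + v) / (m + v))\<bar>" if "z \<in> space (M \<Otimes>\<^sub>M R)" for z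
      using gb that by (auto simp: indicator_def space_pair_measure)
    show "(\<lambda>(x, t). indicator {t. t < f x} t * g x) \<in> borel_measurable (M \<Otimes>\<^sub>M R)"
      unfolding indicator_def by (simp add: case_prod_beta)
  qed
  have lay: "(\<integral>t. indicator {t. t < f x} t * g x \<partial>R) = f x * g x" if x: "x \<in> space M" for x
  proof -
    have "(\<integral>t. indicator {t. t < f x} t \<partial>R) = (\<integral>t. indicator {0..<f x} t \<partial>R)"
      using f01[OF x] by (intro Bochner_Integration.integral_cong) (auto simp: indicator_def)
    also have "\<dots> = measure R {0..<f x}"
    proof -
      have "{0..<f x} \<inter> space R = {0..<f x}" using f01[OF x] by auto
      then show ?thesis by (simp del: sR)
    qed
    also have "\<dots> = f x" unfolding R_def using f01[OF x]
      by (subst measure_restrict_space) auto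
    finally show ?thesis by simp
  qed
  have "(\<integral>x. f x * g x \<partial>M) = (\<integral>x. (\<integral>t. indicator {t. t < f x} t * g x \<partial>R) \<partial>M)"
    by (intro Bochner_Integration.integral_cong refl lay[symmetric])
  also have "\<dots> = (\<integral>t. (\<integral>x. indicator {t. t < f x} t * g x \<partial>M) \<partial>R)"
    by (rule P.Fubini_integral[OF intP, symmetric])
  also have "\<dots> \<le> (\<integral>t. ?J (prob {x \<in> space M. t < f x}) \<partial>R)"
  proof (rule integral_mono)
    show "integrable R (\<lambda>t. \<integral>x. indicator {t. t < f x} t * g x \<partial>M)"
      using P.integrable_snd[OF intP] by simp
    have "antimono (\<lambda>t. prob {x \<in> space M. t < f x})"
      by (intro antimonoI finite_measure_mono) auto
    then have "mono (\<lambda>t. - prob {x \<in> space M. t < f x})"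
      by (auto simp: mono_def antimono_def)
    then have "(\<lambda>t. - (- prob {x \<in> space M. t < f x})) \<in> borel_measurable borel"
      by (intro borel_measurable_uminus borel_measurable_mono)
    then have [measurable]: "(\<lambda>t. prob {x \<in> space M. t < f x}) \<in> borel_measurable R"
      by (intro mR) simp
    show "integrable R (\<lambda>t. ?J (prob {x \<in> space M. t < f x}))"
      using Jb by (intro R.integrable_const_bound[of _ "ln ((1 + v) / v)"]) auto
    fix t
    have "(\<integral>x. indicator {t. t < f x} t * g x \<partial>M)
        = (\<integral>x. indicator {x \<in> space M. t < f x} x * g x \<partial>M)"
      by (intro Bochner_Integration.integral_cong) (auto simp: indicator_def)
    also have "\<dots> \<le> ?J (prob {x \<in> space M. t < f x})"
      unfolding g_def m_def by (rule integral_ln_on_event_le) (use v f01 in auto)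
    finally show "(\<integral>x. indicator {t. t < f x} t * g x \<partial>M) \<le> ?J (prob {x \<in> space M. t < f x})" .
  qed
  finally have B: "?J m \<le> (\<integral>x. ?J (f x) \<partial>M) + (\<integral>t. ?J (prob {x \<in> space M. t < f x}) \<partial>R)"
    using A by simp
  have "ennreal (?J m) \<le> ennreal (\<integral>x. ?J (f x) \<partial>M) + ennreal (\<integral>t. ?J (prob {x \<in> space M. t < f x}) \<partial>R)"
    using B v f01 by (subst ennreal_plus[symmetric])
      (auto intro!: integral_nonneg_AE ennreal_leI AE_I2 capped_entropy_nonneg)
  also have "ennreal (\<integral>x. ?J (f x) \<partial>M) \<le> (\<integral>\<^sup>+x. ennreal (?J (f x)) \<partial>M)"
    using f01 v by (subst nn_integral_eq_integral[OF intJ]) (auto intro!: capped_entropy_nonneg)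
  also have "ennreal (\<integral>t. ?J (prob {x \<in> space M. t < f x}) \<partial>R) \<le> (\<integral>\<^sup>+t. ennreal (?J (prob {x \<in> space M. t < f x})) \<partial>R)"
  proof (cases "integrable R (\<lambda>t. ?J (prob {x \<in> space M. t < f x}))")
    case True
    then show ?thesis using v by (subst nn_integral_eq_integral[OF True]) (auto intro!: capped_entropy_nonneg)
  next
    case False
    then show ?thesis by (simp add: not_integrable_integral_eq)
  qed
  finally show ?thesis by (simp add: m_def R_def add_mono)
qed

text \<open>
  The arithmetic-geometric inequality \<open>4 v \<le> (1 + v)\<^sup>2\<close>, after taking logarithms.
\<close>

lemma half_entropy_le_capped_entropy:
  assumes v: "0 < v" "v \<le> 1"
  shows "v * ln (1 / v) / 2 \<le> capped_entropy v v"
proof -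
  have "0 \<le> (1 - v)\<^sup>2" by simp
  then have "4 * v \<le> (1 + v)\<^sup>2" by (simp add: power2_eq_square algebra_simps)
  then have "4 * v / (2 * v)\<^sup>2 \<le> (1 + v)\<^sup>2 / (2 * v)\<^sup>2" by (intro divide_right_mono) auto
  moreover have "4 * v / (2 * v)\<^sup>2 = 1 / v" using v by (simp add: power2_eq_square)
  ultimately have "1 / v \<le> ((1 + v) / (2 * v))\<^sup>2" by (simp add: power_divide)
  then have "ln (1 / v) \<le> ln (((1 + v) / (2 * v))\<^sup>2)" using v by (subst ln_le_cancel_iff) auto
  also have "\<dots> = 2 * ln ((1 + v) / (2 * v))" using v by (simp add: ln_realpow)
  finally have "ln (1 / v) / 2 \<le> ln ((1 + v) / (v + v))" by simp
  then have "v * (ln (1 / v) / 2) \<le> v * ln ((1 + v) / (v + v))" using v by (intro mult_left_mono) auto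
  then show ?thesis by (simp add: capped_entropy_def)
qed

text \<open>
  For \<open>v \<le> p \<le> 1/2\<close> the capped entropy is at most \<open>p ln(1/p)\<close> and the claim is the assumed
  monotonicity. For \<open>p < v\<close> it is at most \<open>2 p ln(1/v)\<close>, and the same monotonicity, read near \<open>1\<close> where
  \<open>t ln(1/t)\<close> is about \<open>1 - t\<close>, says through the symmetry of \<open>i\<close> that \<open>i(y) / y\<close> is essentially
  non-increasing on \<open>(0, 1/2]\<close>. For \<open>p > 1/2\<close> the capped entropy is at most \<open>1 - p\<close>, and both arguments apply to \<open>1 - p\<close>.
\<close>

lemma scaled_capped_entropy_le:
  fixes i :: "real \<Rightarrow> real"
  assumes D: "1 \<le> D" and nonneg: "\<And>t. 0 < t \<Longrightarrow> t < 1 \<Longrightarrow> 0 \<le> i t"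
    and sym: "\<And>t. 0 < t \<Longrightarrow> t < 1 \<Longrightarrow> i (1 - t) = i t"
    and ratio: "\<And>s t. 0 < s \<Longrightarrow> s \<le> t \<Longrightarrow> t < 1 \<Longrightarrow> i s / (s * ln (1 / s)) \<le> D * (i t / (t * ln (1 / t)))"
    and v: "0 < v" "v \<le> 1/2" and p: "0 < p" "p < 1"
  shows "i v / (v * ln (1 / v)) / (4 * D) * capped_entropy v p \<le> i p"
proof -
  define c where "c = i v / (v * ln (1 / v))"
  have lv: "ln 2 \<le> ln (1 / v)" using v by (subst ln_le_cancel_iff) (auto simp: field_simps)
  have ln2: "1/2 \<le> ln (2::real)" using ln_le_minus_one[of "1/2 :: real"] by (simp add: ln_div)
  have lv0: "1/2 \<le> ln (1 / v)" using lv ln2 by linarith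
  have c0: "0 \<le> c" unfolding c_def using nonneg[of v] v lv0 by (intro divide_nonneg_nonneg mult_nonneg_nonneg) auto
  \<comment> \<open>The monotonicity at \<open>1 - v \<le> 1 - y\<close>, where \<open>t ln(1/t)\<close> is comparable to \<open>1 - t\<close>.\<close>
  have linear: "i v / v \<le> 2 * D * (i y / y)" if y: "0 < y" "y < v" for y
  proof -
    have yv: "0 < 1 - v" "1 - v \<le> 1 - y" "1 - y < 1" using y v by auto
    have ly: "y \<le> ln (1 / (1 - y))"
      using ln_le_minus_one[of "1 - y"] y v by (simp add: ln_div)
    have lw: "(1 - v) * ln (1 / (1 - v)) \<le> v"
    proof -
      have "ln (1 / (1 - v)) \<le> 1 / (1 - v) - 1" using v by (intro ln_le_minus_one) auto
      then have "(1 - v) * ln (1 / (1 - v)) \<le> (1 - v) * (1 / (1 - v) - 1)" using v by (intro mult_left_mono) auto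
      also have "\<dots> = v" using v by (simp add: right_diff_distrib)
      finally show ?thesis .
    qed
    have lw0: "0 < (1 - v) * ln (1 / (1 - v))" using v by (intro mult_pos_pos ln_gt_zero) (auto simp: field_simps)
    have iv: "0 \<le> i v" and iy: "0 \<le> i y" using nonneg[of v] nonneg[of y] y v by auto
    have "i v / v \<le> i v / ((1 - v) * ln (1 / (1 - v)))"
      using lw lw0 iv by (intro divide_left_mono mult_pos_pos) (use v in auto)
    also have "\<dots> \<le> D * (i y / ((1 - y) * ln (1 / (1 - y))))"
      using ratio[OF yv] sym[of v] sym[of y] y v by simp
    also have "\<dots> \<le> D * (i y / ((1/2) * y))"
    proof (intro mult_left_mono divide_left_mono)
      show "1 / 2 * y \<le> (1 - y) * ln (1 / (1 - y))" using ly y v by (intro mult_mono) auto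
      show "0 < (1 - y) * ln (1 / (1 - y)) * (1 / 2 * y)" using ly y v by (intro mult_pos_pos) auto
    qed (use iy D in auto)
    also have "\<dots> = 2 * D * (i y / y)" by simp
    finally show ?thesis .
  qed
  have cy: "c * y \<le> 4 * D * i y" if y: "0 < y" "y \<le> 1/2" for y
  proof (cases "v \<le> y")
    case True
    have "ln 2 \<le> ln (1 / y)" using y by (subst ln_le_cancel_iff) (auto simp: field_simps)
    then have ly: "1/2 \<le> ln (1 / y)" using ln2 by linarith
    have iy: "0 \<le> i y" using nonneg[of y] y by auto
    have "c \<le> D * (i y / (y * ln (1 / y)))" unfolding c_def using ratio[of v y] v y True by simp
    also have "\<dots> \<le> D * (i y / (y * (1/2)))"
      using ly y iy D by (intro mult_left_mono divide_left_mono mult_pos_pos) auto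
    finally have "c * y \<le> D * (i y / (y * (1/2))) * y" using y by (intro mult_right_mono) auto
    also have "\<dots> = 2 * D * i y" using y by simp
    also have "\<dots> \<le> 4 * D * i y" using D iy by (intro mult_right_mono) auto
    finally show ?thesis .
  next
    case False
    have iv: "0 \<le> i v" using nonneg[of v] v by auto
    have "c = i v / v / ln (1 / v)" by (simp add: c_def)
    also have "\<dots> \<le> i v / v / (1/2)" using lv0 iv v by (intro divide_left_mono divide_nonneg_nonneg) auto
    also have "\<dots> \<le> 2 * D * (i y / y) / (1/2)" using linear[of y] y False by (intro divide_right_mono) auto
    finally have "c * y \<le> 2 * D * (i y / y) / (1/2) * y" using y by (intro mult_right_mono) auto
    then show ?thesis using y by simp
  qed
  have "c * capped_entropy v p \<le> 4 * D * i p"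
  proof (cases "p \<le> 1/2")
    case False
    have "ln ((1 + v) / (p + v)) \<le> (1 + v) / (p + v) - 1" using v p by (intro ln_le_minus_one) auto
    also have "\<dots> = (1 - p) / (p + v)" using v p by (simp add: field_simps)
    finally have "capped_entropy v p \<le> p * ((1 - p) / (p + v))"
      unfolding capped_entropy_def using p by (intro mult_left_mono) auto
    also have "\<dots> = (1 - p) * (p / (p + v))" by simp
    also have "\<dots> \<le> (1 - p) * 1" using p v by (intro mult_left_mono) auto
    finally have "c * capped_entropy v p \<le> c * (1 - p)" using c0 by (intro mult_left_mono) auto
    also have "\<dots> \<le> 4 * D * i (1 - p)" using cy[of "1 - p"] p False by simp
    finally show ?thesis using sym[of p] p by simp
  next
    case True
    have ip: "0 \<le> i p" using nonneg[of p] p by auto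
    show ?thesis
    proof (cases "v \<le> p")
      case le: True
      have lp: "0 < ln (1 / p)" using p by simp
      have "(1 + v) / (p + v) \<le> 1 / p"
        using v p by (simp add: field_simps)
      then have "ln ((1 + v) / (p + v)) \<le> ln (1 / p)" using v p by (subst ln_le_cancel_iff) auto
      then have "capped_entropy v p \<le> p * ln (1 / p)"
        unfolding capped_entropy_def using p by (intro mult_left_mono) auto
      then have "c * capped_entropy v p \<le> c * (p * ln (1 / p))" using c0 by (rule mult_left_mono)
      also have "\<dots> \<le> D * (i p / (p * ln (1 / p))) * (p * ln (1 / p))"
        unfolding c_def using ratio[of v p] v p le lp by (intro mult_right_mono) auto
      also have "\<dots> = D * i p" using lp p by simp
      also have "\<dots> \<le> 4 * D * i p" using D ip by (intro mult_right_mono) auto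
      finally show ?thesis .
    next
      case False
      have "(1 + v) / (p + v) \<le> (1 / v)\<^sup>2"
      proof -
        have "(1 + v) / (p + v) \<le> (1 + v) / v" using v p by (intro divide_left_mono) auto
        also have "\<dots> \<le> (1 / v) / v"
        proof (rule divide_right_mono)
          have "v * (1 + v) \<le> 1" using mult_mono[of v "1/2" "1 + v" 2] v by simp
          then show "1 + v \<le> 1 / v" using v by (simp add: pos_le_divide_eq mult.commute)
        qed (use v in simp)
        finally show ?thesis by (simp add: power2_eq_square)
      qed
      then have "ln ((1 + v) / (p + v)) \<le> ln ((1 / v)\<^sup>2)" using v p by (subst ln_le_cancel_iff) auto
      also have "\<dots> = 2 * ln (1 / v)" using v by (subst ln_realpow) auto
      finally have "capped_entropy v p \<le> p * (2 * ln (1 / v))"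
        unfolding capped_entropy_def using p by (intro mult_left_mono) auto
      then have "c * capped_entropy v p \<le> c * (p * (2 * ln (1 / v)))" using c0 by (rule mult_left_mono)
      also have "\<dots> = 2 * p * (i v / v)" using lv0 v by (simp add: c_def)
      also have "\<dots> \<le> 2 * p * (2 * D * (i p / p))" using linear[of p] p False by (intro mult_left_mono) auto
      also have "\<dots> = 4 * D * i p" using p by simp
      finally show ?thesis .
    qed
  qed
  then have "c * capped_entropy v p / (4 * D) \<le> 4 * D * i p / (4 * D)"
    using D by (intro divide_right_mono) auto
  then show ?thesis unfolding c_def[symmetric] using D by simp
qed

section \<open>Functional isoperimetry and boundary measures\<close>

lemma ereal_le_liminf_of_le_Liminf_at_right:
  fixes g :: "real \<Rightarrow> real"
  assumes "ereal c \<le> Liminf (at_right 0) (\<lambda>r. ereal (g r))"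
  shows "ennreal c \<le> liminf (\<lambda>k. ennreal (g (1 / Suc k)))"
  unfolding le_Liminf_iff
proof (intro allI impI)
  fix y assume y: "y < ennreal c"
  then obtain r where r: "y = ennreal r" "0 \<le> r" "r < c"
    by (cases y) (auto simp: ennreal_less_iff)
  then have "eventually (\<lambda>h. ereal r < ereal (g h)) (at_right 0)"
    by (intro assms[unfolded le_Liminf_iff, rule_format]) simp
  then obtain b where b: "0 < b" "\<And>h. 0 < h \<Longrightarrow> h < b \<Longrightarrow> r < g h"
    by (auto simp: eventually_at_right_field)
  obtain n where n: "1 / Suc n < b" using nat_approx_posE[OF b(1)] by blast
  show "\<forall>\<^sub>F k in sequentially. y < ennreal (g (1 / Suc k))"
    unfolding eventually_sequentially
  proof (intro exI[of _ n] allI impI)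
    fix k assume "n \<le> k"
    then have "1 / real (Suc k) \<le> 1 / Suc n" by (intro divide_left_mono) auto
    then have "r < g (1 / Suc k)" using n by (intro b) auto
    then show "y < ennreal (g (1 / Suc k))" using r by (simp add: ennreal_less_iff)
  qed
qed

context metric_prob_space
begin

text \<open>
  If \<open>x\<close> lies in the \<open>h\<close>-enlargement of \<open>{f > t}\<close> but not in \<open>{f > t}\<close>, then \<open>f x \<le> t < f x + h s(x)\<close>,
  with \<open>s\<close> the slope at scale \<open>h\<close>. So, for fixed \<open>x\<close>, these \<open>t\<close> fill an interval of length at most \<open>h s(x)\<close>;
  Tonelli and Fatou's lemma give the inequality.
\<close>

lemma coarea_inequality:
  assumes f: "lipschitz_with L (space N) d f"
    and J: "\<And>U. openin metric.mtopology U \<Longrightarrow> ereal (J (prob U)) \<le> outer_boundary N d U"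
  shows "(\<integral>\<^sup>+t. ennreal (J (prob {x \<in> space N. t < f x})) \<partial>restrict_space lborel {0..1})
           \<le> (\<integral>\<^sup>+x. grad_mod (space N) d f x \<partial>N)"
proof -
  interpret P: pair_sigma_finite N lborel ..
  define U where "U t = {x \<in> space N. t < f x}" for t
  define s where "s k x = enn2real (slope k (space N) d f x)" for k x
  have L: "0 \<le> L" using f by (simp add: lipschitz_with_def)
  have s: "ennreal (s k x) = slope k (space N) d f x" if "x \<in> space N" for k x
    unfolding s_def using slope_le[OF f that, of k] by (intro ennreal_enn2real) (auto intro: le_less_trans)
  have s0: "0 \<le> s k x" for k x by (simp add: s_def)
  have [measurable]: "f \<in> borel_measurable N" by (rule lipschitz_measurable[OF f])
  have [measurable]: "s k \<in> borel_measurable N" for k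
    unfolding s_def using slope_measurable[OF f] by measurable
  define W where "W k = {z \<in> space (N \<Otimes>\<^sub>M borel). f (fst z) \<le> snd z \<and> snd z < f (fst z) + 1 / Suc k * s k (fst z)}" for k
  have Wm [measurable]: "W k \<in> sets (N \<Otimes>\<^sub>M lborel)" for k unfolding W_def sets_pair_measure_cong[OF refl sets_lborel] by measurable
  define Q where "Q k t = of_nat (Suc k) * emeasure N ((\<lambda>x. (x, t)) -` W k)" for k t
  have Qm [measurable]: "Q k \<in> borel_measurable lborel" for k
    unfolding Q_def using Wm[of k] by (intro borel_measurable_times_ennreal P.measurable_emeasure_Pair2) auto
  have Usub: "enlargement (space N) d (U t) (1 / Suc k) - U t \<subseteq> (\<lambda>x. (x, t)) -` W k" for t k
  proof
    fix x assume x: "x \<in> enlargement (space N) d (U t) (1 / Suc k) - U t"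
    then obtain y where y: "y \<in> space N" "t < f y" "d x y < 1 / Suc k" and xs: "x \<in> space N" "f x \<le> t"
      by (auto simp: enlargement_iff U_def)
    have d0: "0 < d x y" using y xs metric.mdist_pos_less[of x y] by fastforce
    have "ennreal (\<bar>f x - f y\<bar> / d x y) \<le> slope k (space N) d f x"
      unfolding slope_def using y d0 by (intro SUP_upper) auto
    then have "\<bar>f x - f y\<bar> / d x y \<le> s k x" using s0 by (simp flip: s[OF xs(1)])
    then have "f y - f x \<le> s k x * d x y" using d0 by (simp add: pos_divide_le_eq)
    also have "\<dots> \<le> s k x * (1 / Suc k)" using y s0[of k x] by (intro mult_left_mono) auto
    finally show "x \<in> (\<lambda>x. (x, t)) -` W k"
      using xs y by (auto simp: W_def space_pair_measure mult.commute)
  qed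
  have "ennreal (J (prob (U t))) \<le> liminf (\<lambda>k. Q k t)" for t
  proof -
    have "openin metric.mtopology (U t)" unfolding U_def by (rule open_less_lipschitz[OF f])
    from J[OF this] have "ennreal (J (prob (U t))) \<le> liminf (\<lambda>k. ennreal
        ((prob (enlargement (space N) d (U t) (1 / Suc k)) - prob (U t)) / (1 / Suc k)))"
      unfolding outer_boundary_def by (rule ereal_le_liminf_of_le_Liminf_at_right)
    also have "\<dots> \<le> liminf (\<lambda>k. Q k t)"
    proof (intro Liminf_mono always_eventually allI)
      fix k
      have Ut: "U t \<subseteq> space N" "U t \<in> sets N" by (auto simp: U_def)
      have "prob (enlargement (space N) d (U t) (1 / Suc k)) - prob (U t)
          = prob (enlargement (space N) d (U t) (1 / Suc k) - U t)"
        using Ut subset_enlargement[OF Ut(1), of "1 / Suc k"]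
        by (subst finite_measure_Diff) (auto intro: enlargement_sets)
      then have "ennreal ((prob (enlargement (space N) d (U t) (1 / Suc k)) - prob (U t)) / (1 / Suc k))
          = ennreal (real (Suc k) * prob (enlargement (space N) d (U t) (1 / Suc k) - U t))"
        by (simp add: mult.commute)
      also have "\<dots> = of_nat (Suc k) * emeasure N (enlargement (space N) d (U t) (1 / Suc k) - U t)"
        by (subst ennreal_mult) (auto simp: emeasure_eq_measure ennreal_of_nat_eq_real_of_nat)
      also have "\<dots> \<le> Q k t" unfolding Q_def
        by (intro mult_left_mono emeasure_mono Usub sets_Pair2[OF Wm]) auto
      finally show "ennreal ((prob (enlargement (space N) d (U t) (1 / Suc k)) - prob (U t)) / (1 / Suc k)) \<le> Q k t" .
    qed
    finally show ?thesis .
  qed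
  then have "(\<integral>\<^sup>+t. ennreal (J (prob (U t))) \<partial>restrict_space lborel {0..1})
      \<le> (\<integral>\<^sup>+t. liminf (\<lambda>k. Q k t) \<partial>restrict_space lborel {0..1})"
    by (intro nn_integral_mono) auto
  also have "\<dots> = (\<integral>\<^sup>+t. liminf (\<lambda>k. Q k t) * indicator {0..1} t \<partial>lborel)"
    by (subst nn_integral_restrict_space) auto
  also have "\<dots> \<le> (\<integral>\<^sup>+t. liminf (\<lambda>k. Q k t) \<partial>lborel)"
    by (intro nn_integral_mono) (auto split: split_indicator)
  also have "\<dots> \<le> liminf (\<lambda>k. \<integral>\<^sup>+t. Q k t \<partial>lborel)"
    by (intro nn_integral_liminf Qm)
  also have "(\<lambda>k. \<integral>\<^sup>+t. Q k t \<partial>lborel) = (\<lambda>k. \<integral>\<^sup>+x. slope k (space N) d f x \<partial>N)"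
  proof
    fix k
    have "(\<integral>\<^sup>+t. Q k t \<partial>lborel) = of_nat (Suc k) * (\<integral>\<^sup>+t. emeasure N ((\<lambda>x. (x, t)) -` W k) \<partial>lborel)"
      unfolding Q_def by (intro nn_integral_cmult P.measurable_emeasure_Pair2 Wm)
    also have "(\<integral>\<^sup>+t. emeasure N ((\<lambda>x. (x, t)) -` W k) \<partial>lborel) = emeasure (N \<Otimes>\<^sub>M lborel) (W k)"
      by (rule P.emeasure_pair_measure_alt2[OF Wm, symmetric])
    also have "\<dots> = (\<integral>\<^sup>+x. emeasure lborel (Pair x -` W k) \<partial>N)"
      by (rule lborel.emeasure_pair_measure_alt[OF Wm])
    also have "\<dots> = (\<integral>\<^sup>+x. ennreal (1 / Suc k) * slope k (space N) d f x \<partial>N)"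
    proof (rule nn_integral_cong)
      fix x assume x: "x \<in> space N"
      then have "Pair x -` W k = {f x ..< f x + 1 / Suc k * s k x}"
        by (auto simp: W_def space_pair_measure)
      then show "emeasure lborel (Pair x -` W k) = ennreal (1 / Suc k) * slope k (space N) d f x"
        using s0[of k x] x by (simp add: s[symmetric] flip: ennreal_mult)
    qed
    also have "\<dots> = ennreal (1 / Suc k) * (\<integral>\<^sup>+x. slope k (space N) d f x \<partial>N)"
      by (intro nn_integral_cmult slope_measurable[OF f])
    also have "of_nat (Suc k) * \<dots> = (\<integral>\<^sup>+x. slope k (space N) d f x \<partial>N)"
      by (simp add: mult.assoc[symmetric] ennreal_of_nat_eq_real_of_nat flip: ennreal_mult del: of_nat_Suc)
    finally show "(\<integral>\<^sup>+t. Q k t \<partial>lborel) = (\<integral>\<^sup>+x. slope k (space N) d f x \<partial>N)" .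
  qed
  also have "liminf (\<lambda>k. \<integral>\<^sup>+x. slope k (space N) d f x \<partial>N) = (INF k. \<integral>\<^sup>+x. slope k (space N) d f x \<partial>N)"
  proof (rule lim_imp_Liminf)
    have "decseq (\<lambda>k. \<integral>\<^sup>+x. slope k (space N) d f x \<partial>N)"
      by (intro decseq_SucI nn_integral_mono le_funD[OF decseq_SucD[OF decseq_slope]])
    then show "(\<lambda>k. \<integral>\<^sup>+x. slope k (space N) d f x \<partial>N) \<longlonglongrightarrow> (INF k. \<integral>\<^sup>+x. slope k (space N) d f x \<partial>N)"
      by (rule LIMSEQ_INF)
  qed simp
  also have "\<dots> = (\<integral>\<^sup>+x. grad_mod (space N) d f x \<partial>N)" by (rule nn_integral_grad_mod[OF f, symmetric])
  finally show ?thesis by (simp add: U_def)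
qed

end

text \<open>
  The gradient term carries no constant; constants are absorbed into \<open>J\<close>, which is what lets the
  inequality pass to products without loss.
\<close>

definition functional_isoperimetry :: "'b measure \<Rightarrow> ('b \<Rightarrow> 'b \<Rightarrow> real) \<Rightarrow> (real \<Rightarrow> real) \<Rightarrow> bool" where
  "functional_isoperimetry N d J \<longleftrightarrow>
     (\<forall>f L. lipschitz_with L (space N) d f \<longrightarrow> (\<forall>x\<in>space N. 0 \<le> f x \<and> f x \<le> 1) \<longrightarrow>
        ennreal (J (\<integral>x. f x \<partial>N)) \<le> (\<integral>\<^sup>+x. ennreal (J (f x)) \<partial>N) + (\<integral>\<^sup>+x. grad_mod (space N) d f x \<partial>N))"

context metric_prob_space
begin

text \<open>
  A function and \<open>1 - f\<close> have the same gradient. The reflected inequality is used for complements,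
  since capped entropies are not symmetric about \<open>1/2\<close>.
\<close>

lemma functional_isoperimetry_reflect:
  assumes "functional_isoperimetry N d J"
  shows "functional_isoperimetry N d (\<lambda>p. J (1 - p))"
  unfolding functional_isoperimetry_def
proof (intro allI impI)
  fix f L assume f: "lipschitz_with L (space N) d f" and f01: "\<forall>x\<in>space N. 0 \<le> f x \<and> f x \<le> 1"
  have g: "lipschitz_with L (space N) d (\<lambda>x. 1 - f x)"
    using f by (auto simp: lipschitz_with_def abs_minus_commute)
  have int: "integrable N f" using lipschitz_measurable[OF f] f01
    by (intro integrable_const_bound[of _ 1]) auto
  have "grad_mod (space N) d (\<lambda>x. 1 - f x) = grad_mod (space N) d f"
    by (intro ext) (simp add: grad_mod_def abs_minus_commute)
  moreover have "(\<integral>x. 1 - f x \<partial>N) = 1 - (\<integral>x. f x \<partial>N)" using int by (simp add: prob_space)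
  ultimately show "ennreal (J (1 - (\<integral>x. f x \<partial>N)))
      \<le> (\<integral>\<^sup>+x. ennreal (J (1 - f x)) \<partial>N) + (\<integral>\<^sup>+x. grad_mod (space N) d f x \<partial>N)"
    using assms g f01 unfolding functional_isoperimetry_def
    by (elim allE[of _ "\<lambda>x. 1 - f x"] allE[of _ L]) auto
qed

lemma functional_isoperimetry_capped_entropy:
  assumes v: "0 < v" and \<kappa>: "0 \<le> \<kappa>"
    and J: "\<And>U. openin metric.mtopology U \<Longrightarrow> ereal (\<kappa> * capped_entropy v (prob U)) \<le> outer_boundary N d U"
  shows "functional_isoperimetry N d (\<lambda>p. \<kappa> * capped_entropy v p)"
  unfolding functional_isoperimetry_def
proof (intro allI impI)
  fix f L assume f: "lipschitz_with L (space N) d f" and f01: "\<forall>x\<in>space N. 0 \<le> f x \<and> f x \<le> 1"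
  have [measurable]: "f \<in> borel_measurable N" by (rule lipschitz_measurable[OF f])
  let ?J = "capped_entropy v"
  let ?R = "restrict_space lborel {0..1::real}"
  let ?p = "\<lambda>t. prob {x \<in> space N. t < f x}"
  have "ennreal (\<kappa> * ?J (expectation f)) = ennreal \<kappa> * ennreal (?J (expectation f))"
    by (rule ennreal_mult') (rule \<kappa>)
  also have "\<dots> \<le> ennreal \<kappa> * ((\<integral>\<^sup>+x. ennreal (?J (f x)) \<partial>N) + (\<integral>\<^sup>+t. ennreal (?J (?p t)) \<partial>?R))"
    using f01 by (intro mult_left_mono capped_entropy_expectation_le[OF v]) auto
  also have "\<dots> = ennreal \<kappa> * (\<integral>\<^sup>+x. ennreal (?J (f x)) \<partial>N) + ennreal \<kappa> * (\<integral>\<^sup>+t. ennreal (?J (?p t)) \<partial>?R)"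
    by (rule distrib_left)
  also have "ennreal \<kappa> * (\<integral>\<^sup>+x. ennreal (?J (f x)) \<partial>N) = (\<integral>\<^sup>+x. ennreal (\<kappa> * ?J (f x)) \<partial>N)"
    by (subst nn_integral_cmult[symmetric]) (auto simp: ennreal_mult'[OF \<kappa>])
  also have "ennreal \<kappa> * (\<integral>\<^sup>+t. ennreal (?J (?p t)) \<partial>?R) = (\<integral>\<^sup>+t. ennreal (\<kappa> * ?J (?p t)) \<partial>?R)"
  proof -
    have "mono (\<lambda>t. - ?p t)" by (auto intro!: monoI finite_measure_mono)
    then have "(\<lambda>t. - (- ?p t)) \<in> borel_measurable borel"
      by (intro borel_measurable_uminus borel_measurable_mono)
    then have [measurable]: "?p \<in> borel_measurable ?R"
      by (intro measurable_restrict_space1) simp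
    show ?thesis by (subst nn_integral_cmult[symmetric]) (auto simp: ennreal_mult'[OF \<kappa>])
  qed
  also have "\<dots> \<le> (\<integral>\<^sup>+x. grad_mod (space N) d f x \<partial>N)" by (rule coarea_inequality[OF f J])
  finally show "ennreal (\<kappa> * ?J (expectation f))
      \<le> (\<integral>\<^sup>+x. ennreal (\<kappa> * ?J (f x)) \<partial>N) + (\<integral>\<^sup>+x. grad_mod (space N) d f x \<partial>N)"
    by (simp add: add_left_mono)
qed

text \<open>
  A real-valued distance to a set; it is meaningful for nonempty sets only.
\<close>

definition dist_to :: "'b set \<Rightarrow> 'b \<Rightarrow> real" where
  "dist_to A x = Inf ((\<lambda>a. d x a) ` A)"

lemma dist_to_less_iff:
  assumes "A \<noteq> {}"
  shows "dist_to A x < r \<longleftrightarrow> (\<exists>a\<in>A. d x a < r)"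
  unfolding dist_to_def using assms
  by (subst cInf_less_iff) (auto intro!: bdd_belowI[of _ 0])

lemma dist_to_nonneg: "A \<noteq> {} \<Longrightarrow> 0 \<le> dist_to A x"
  unfolding dist_to_def by (intro cInf_greatest) auto

lemma dist_to_mem: "A \<subseteq> space N \<Longrightarrow> x \<in> A \<Longrightarrow> dist_to A x = 0"
  using dist_to_nonneg[of A x] dist_to_less_iff[of A x] metric.mdist_zero[of x]
  by (metis antisym_conv1 empty_iff order_less_irrefl subset_iff)

lemma dist_to_lipschitz:
  assumes A: "A \<noteq> {}" "A \<subseteq> space N"
  shows "lipschitz_with 1 (space N) d (dist_to A)"
proof -
  have *: "dist_to A x \<le> dist_to A y + d x y" if xy: "x \<in> space N" "y \<in> space N" for x y
  proof (rule field_le_epsilon)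
    fix e :: real assume "0 < e"
    then have "dist_to A y < dist_to A y + e" by simp
    then obtain a where a: "a \<in> A" "d y a < dist_to A y + e" using dist_to_less_iff[OF A(1)] by blast
    have "d x a \<le> d x y + d y a" using metric.triangle xy a A by blast
    then have "\<exists>a\<in>A. d x a < dist_to A y + d x y + e" using a by (intro bexI[of _ a]) auto
    then show "dist_to A x \<le> dist_to A y + d x y + e" by (meson dist_to_less_iff[OF A(1)] less_imp_le)
  qed
  show ?thesis unfolding lipschitz_with_def
  proof (intro conjI ballI)
    fix x y assume "x \<in> space N" "y \<in> space N"
    then show "\<bar>dist_to A x - dist_to A y\<bar> \<le> 1 * d x y"
      using *[of x y] *[of y x] metric.commute[of x y] by simp
  qed simp
qed

text \<open>
  Test the functional inequality on ramps that equal \<open>1\<close> near \<open>A\<close> and \<open>0\<close> near the complement of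
  \<open>A\<^sub>r\<close>, with slope \<open>1 / ((1 - 2\<delta>) r)\<close>. The margins \<open>\<delta> r\<close> make the ramp locally constant at every point
  outside \<open>A\<^sub>r - A\<close>, so the gradient term is at most the difference quotient of the measures divided by
  \<open>1 - 2\<delta>\<close>, while \<open>E J(f)\<close> tends to \<open>0\<close> because \<open>J\<close> vanishes at \<open>0\<close> and \<open>1\<close>.
\<close>

lemma outer_boundary_of_functional_isoperimetry:
  assumes F: "functional_isoperimetry N d J"
    and J: "continuous_on {0..1} J" "\<And>p. 0 \<le> p \<Longrightarrow> p \<le> 1 \<Longrightarrow> 0 \<le> J p" "J 0 = 0" "J 1 = 0"
    and A: "A \<in> sets N"
  shows "ereal (J (prob A)) \<le> outer_boundary N d A"
proof (rule ccontr)
  assume neg: "\<not> ereal (J (prob A)) \<le> outer_boundary N d A"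
  have As: "A \<subseteq> space N" using A sets.sets_into_space by blast
  define p where "p = prob A"
  have p: "0 \<le> p" "p \<le> 1" by (auto simp: p_def)
  have "outer_boundary N d A < ereal (J p)" using neg by (simp add: p_def)
  then obtain c where c: "outer_boundary N d A < ereal c" "c < J p" using ereal_dense2 by force
  have c0: "0 < c" using le_less_trans[OF outer_boundary_nonneg[OF As] c(1)] by simp
  have Ane: "A \<noteq> {}" using c c0 J(3) by (auto simp: p_def)
  have freq: "\<exists>\<^sub>F r in at_right 0. (prob (enlargement (space N) d A r) - prob A) / r < c"
  proof (rule ccontr)
    assume "\<not> ?thesis"
    then have "\<forall>\<^sub>F r in at_right 0. ereal c \<le> ereal ((prob (enlargement (space N) d A r) - prob A) / r)"
      by (simp add: frequently_def not_less)
    then have "ereal c \<le> outer_boundary N d A" unfolding outer_boundary_def by (rule Liminf_bounded)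
    with c show False by simp
  qed
  \<comment> \<open>Small enough for \<open>c / (1 - 2\<delta>)\<close> to stay below \<open>J p\<close>.\<close>
  define \<delta> where "\<delta> = (1 - c / J p) / 4"
  have Jp: "0 < J p" using c c0 by simp
  have \<delta>: "0 < \<delta>" "\<delta> < 1/2" "1 - 2 * \<delta> = (1 + c / J p) / 2" using c c0 Jp by (auto simp: \<delta>_def field_simps)
  define c' where "c' = c / (1 - 2 * \<delta>)"
  have c': "c' < J p"
  proof -
    have "c < (J p + c) / 2" using c(2) by simp
    also have "\<dots> = J p * (1 - 2 * \<delta>)" using Jp unfolding \<delta>(3) by (simp add: field_simps)
    finally have "c < J p * (1 - 2 * \<delta>)" .
    then show ?thesis unfolding c'_def using \<delta>(2) by (simp add: pos_divide_less_eq)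
  qed
  obtain B where B: "\<And>q. 0 \<le> q \<Longrightarrow> q \<le> 1 \<Longrightarrow> J q \<le> B" "0 < B"
  proof -
    have "bounded (J ` {0..1})" using compact_continuous_image[OF J(1)] compact_imp_bounded by blast
    then obtain B where "0 < B" "\<forall>y\<in>J ` {0..1}. norm y \<le> B" unfolding bounded_pos by blast
    then show thesis by (intro that[of B]) (auto simp: abs_le_iff)
  qed
  define g where "g = (J p - c') / 2"
  have g: "0 < g" using c' by (simp add: g_def)
  obtain e where e: "0 < e" "\<And>q. 0 \<le> q \<Longrightarrow> q \<le> 1 \<Longrightarrow> \<bar>q - p\<bar> < e \<Longrightarrow> \<bar>J q - J p\<bar> < g"
    using J(1)[unfolded continuous_on_iff dist_real_def, rule_format, of p g] p g by auto
  define h0 where "h0 = min (g / (B * c)) (e / c)"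
  have h0: "0 < h0" using g e B c0 by (simp add: h0_def)
  then have "eventually (\<lambda>r. 0 < r \<and> r < h0) (at_right 0)" unfolding eventually_at_right_field by blast
  from frequently_eventually_frequently[OF freq this]
  obtain r where r: "(prob (enlargement (space N) d A r) - p) / r < c" "0 < r" "r < h0"
    by (auto simp: p_def dest: frequently_ex)
  define E where "E = enlargement (space N) d A r"
  have E [measurable]: "E \<in> sets N" "A \<subseteq> E" unfolding E_def using As r by (auto intro: subset_enlargement[THEN subsetD] enlargement_sets)
  have EA: "prob (E - A) \<le> c * r"
    using r E A by (simp add: finite_measure_Diff E_def p_def pos_divide_less_eq)
  define b where "b = 1 / ((1 - 2 * \<delta>) * r)"
  have b: "0 < b" using \<delta> r by (simp add: b_def)
  define f where "f x = max 0 (min 1 (1 - b * (dist_to A x - \<delta> * r)))" for x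
  have lip: "lipschitz_with b (space N) d f"
    unfolding lipschitz_with_def
  proof (intro conjI ballI)
    fix x y assume xy: "x \<in> space N" "y \<in> space N"
    have "\<bar>f x - f y\<bar> \<le> \<bar>b * (dist_to A x - dist_to A y)\<bar>" unfolding f_def right_diff_distrib by linarith
    also have "\<dots> = b * \<bar>dist_to A x - dist_to A y\<bar>" using b by (simp add: abs_mult)
    also have "\<dots> \<le> b * (1 * d x y)" using dist_to_lipschitz[OF Ane As] xy b
      by (intro mult_left_mono) (auto simp: lipschitz_with_def)
    finally show "\<bar>f x - f y\<bar> \<le> b * d x y" by simp
  qed (use b in simp)
  have fone: "f x = 1" if "dist_to A x \<le> \<delta> * r" for x
    using that b by (auto simp: f_def mult_nonneg_nonpos)
  have fzero: "f x = 0" if "(1 - \<delta>) * r \<le> dist_to A x" for x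
  proof -
    have "1 = b * ((1 - 2 * \<delta>) * r)" using \<delta> r by (simp add: b_def)
    also have "\<dots> \<le> b * (dist_to A x - \<delta> * r)" using that b by (intro mult_left_mono) (auto simp: algebra_simps)
    finally show ?thesis by (simp add: f_def)
  qed
  have f01: "0 \<le> f x" "f x \<le> 1" for x by (auto simp: f_def)
  have fA: "f x = 1" if "x \<in> A" for x using that dist_to_mem[OF As that] \<delta> r by (intro fone) auto
  have offE: "r \<le> dist_to A x" if "x \<in> space N" "x \<notin> E" for x
    using that dist_to_less_iff[OF Ane, of x r] by (auto simp: E_def enlargement_iff)
  have fE: "f x = 0" if "x \<in> space N" "x \<notin> E" for x
    using offE[OF that] mult_right_mono[of "1 - \<delta>" 1 r] \<delta>(1) r(2) by (intro fzero) linarith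
  have grad0: "grad_mod (space N) d f x = 0" if x: "x \<in> space N" "x \<notin> E - A" for x
  proof (rule grad_mod_locally_constant[of "\<delta> * r"])
    show "0 < \<delta> * r" using \<delta> r by simp
    fix y assume y: "y \<in> space N" "d x y < \<delta> * r"
    have l: "\<bar>dist_to A x - dist_to A y\<bar> \<le> d x y" 
      using dist_to_lipschitz[OF Ane As] x y by (auto simp: lipschitz_with_def)
    show "f y = f x"
    proof (cases "x \<in> A")
      case True
      then show ?thesis using l y dist_to_mem[OF As True] fA[OF True] by (simp add: fone)
    next
      case False
      then have "x \<notin> E" using x by simp
      then show ?thesis using l y offE[OF x(1)] fE[OF x(1)] by (simp add: fzero algebra_simps)
    qed
  qed
  have [measurable]: "f \<in> borel_measurable N" by (rule lipschitz_measurable[OF lip])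
  have intf: "integrable N f" using f01 by (intro integrable_const_bound[of _ 1]) auto
  define m where "m = expectation f"
  have "m \<le> expectation (indicator E)" unfolding m_def
    using f01 fE by (intro integral_mono intf) (auto split: split_indicator simp: emeasure_eq_measure)
  then have m1: "m \<le> prob E" by simp
  have "expectation (indicator A) \<le> m" unfolding m_def
    using f01 fA A by (intro integral_mono intf) (auto split: split_indicator simp: emeasure_eq_measure)
  then have m2: "p \<le> m" using A by (simp add: p_def)
  have "prob E = p + prob (E - A)" using E A by (simp add: finite_measure_Diff p_def)
  then have mp: "\<bar>m - p\<bar> \<le> c * r" using m1 m2 EA by simp
  also have "\<dots> < e" using r c0 by (simp add: h0_def pos_less_divide_eq mult.commute)
  finally have mp: "\<bar>m - p\<bar> < e" .
  have m01: "0 \<le> m" "m \<le> 1" using m2 p m1 prob_le_1[of E] by linarith+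
  from e(2)[OF m01 mp] have Jm: "J p - g < J m" by linarith
  have "ennreal (J m) \<le> (\<integral>\<^sup>+x. ennreal (J (f x)) \<partial>N) + (\<integral>\<^sup>+x. grad_mod (space N) d f x \<partial>N)"
    using F lip f01 unfolding functional_isoperimetry_def m_def by blast
  also have "(\<integral>\<^sup>+x. ennreal (J (f x)) \<partial>N) \<le> (\<integral>\<^sup>+x. ennreal B * indicator (E - A) x \<partial>N)"
    using B f01 fA fE J by (intro nn_integral_mono) (auto split: split_indicator intro!: ennreal_leI)
  also have "(\<integral>\<^sup>+x. grad_mod (space N) d f x \<partial>N) \<le> (\<integral>\<^sup>+x. ennreal b * indicator (E - A) x \<partial>N)"
    using grad0 grad_mod_le[OF lip] by (intro nn_integral_mono) (auto split: split_indicator)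
  also have "(\<integral>\<^sup>+x. ennreal B * indicator (E - A) x \<partial>N) + (\<integral>\<^sup>+x. ennreal b * indicator (E - A) x \<partial>N)
      = ennreal ((B + b) * prob (E - A))"
    using A b B by (simp add: nn_integral_cmult_indicator emeasure_eq_measure distrib_right flip: ennreal_mult ennreal_plus)
  finally have "J m \<le> (B + b) * prob (E - A)" using b B by (simp add: ennreal_le_iff)
  also have "\<dots> \<le> (B + b) * (c * r)" using EA b B by (intro mult_left_mono) auto
  also have "b * (c * r) = c'" using r(2) by (simp add: b_def c'_def)
  then have "(B + b) * (c * r) = B * c * r + c'" by (simp add: distrib_right)
  also have "B * c * r < g" using r B c0 by (simp add: h0_def pos_less_divide_eq mult.commute)
  finally have "J m < g + c'" by simp
  with Jm show False by (simp add: g_def field_simps)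
qed

end

section \<open>Powers with the supremum distance\<close>

lemma sup_dist_less_iff: "1 \<le> n \<Longrightarrow> sup_dist n x y < r \<longleftrightarrow> (\<forall>i<n. dist (x i) (y i) < r)"
  unfolding sup_dist_def by (subst Max_less_iff) (auto simp: lessThan_empty_iff)

lemma sup_dist_le_iff: "1 \<le> n \<Longrightarrow> sup_dist n x y \<le> r \<longleftrightarrow> (\<forall>i<n. dist (x i) (y i) \<le> r)"
  unfolding sup_dist_def by (subst Max_le_iff) (auto simp: lessThan_empty_iff)

lemma dist_le_sup_dist: "i < n \<Longrightarrow> dist (x i) (y i) \<le> sup_dist n x y"
  unfolding sup_dist_def by (intro Max_ge) auto

lemma sup_dist_nonneg: "1 \<le> n \<Longrightarrow> 0 \<le> sup_dist n x y"
  using dist_le_sup_dist[of 0 n x y] zero_le_dist[of "x 0" "y 0"] by linarith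

lemma Metric_space_sup_dist:
  assumes n: "1 \<le> n"
  shows "Metric_space ({..<n} \<rightarrow>\<^sub>E UNIV) (sup_dist n :: _ \<Rightarrow> (nat \<Rightarrow> 'a::metric_space) \<Rightarrow> real)"
proof
  fix x y z :: "nat \<Rightarrow> 'a"
  show "0 \<le> sup_dist n x y" by (rule sup_dist_nonneg[OF n])
  show "sup_dist n x y = sup_dist n y x" by (simp add: sup_dist_def dist_commute)
  assume xy: "x \<in> {..<n} \<rightarrow>\<^sub>E UNIV" "y \<in> {..<n} \<rightarrow>\<^sub>E UNIV"
  show "sup_dist n x y = 0 \<longleftrightarrow> x = y"
  proof
    assume "sup_dist n x y = 0"
    then have "\<And>i. i < n \<Longrightarrow> dist (x i) (y i) \<le> 0" using dist_le_sup_dist by metis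
    then have "\<And>i. i \<in> {..<n} \<Longrightarrow> x i = y i" by simp
    then show "x = y" by (rule PiE_ext[OF xy])
  next
    assume "x = y"
    then have "sup_dist n x y \<le> 0" by (simp add: sup_dist_le_iff[OF n])
    then show "sup_dist n x y = 0" using sup_dist_nonneg[OF n, of x y] by simp
  qed
next
  fix x y z :: "nat \<Rightarrow> 'a"
  show "sup_dist n x z \<le> sup_dist n x y + sup_dist n y z"
    unfolding sup_dist_le_iff[OF n]
  proof (intro allI impI)
    fix i assume i: "i < n"
    show "dist (x i) (z i) \<le> sup_dist n x y + sup_dist n y z"
      using dist_triangle[of "x i" "z i" "y i"] dist_le_sup_dist[OF i, of x y] dist_le_sup_dist[OF i, of y z]
      by linarith
  qed
qed

lemma sup_dist_append:
  assumes "1 \<le> m" "1 \<le> n"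
  shows "sup_dist (m + n) (append_pt m n x y) (append_pt m n x' y') = max (sup_dist m x x') (sup_dist n y y')"
proof -
  have *: "(\<forall>i<m + n. dist (append_pt m n x y i) (append_pt m n x' y' i) \<le> r) \<longleftrightarrow>
     (\<forall>i<m. dist (x i) (x' i) \<le> r) \<and> (\<forall>i<n. dist (y i) (y' i) \<le> r)" for r
  proof (intro iffI conjI allI impI)
    fix i assume a: "\<forall>i<m + n. dist (append_pt m n x y i) (append_pt m n x' y' i) \<le> r"
    show "dist (x i) (x' i) \<le> r" if "i < m" using a[rule_format, of i] that by (simp add: append_pt_def)
    show "dist (y i) (y' i) \<le> r" if "i < n" using a[rule_format, of "m + i"] that by (simp add: append_pt_def)
  next
    fix i assume "(\<forall>i<m. dist (x i) (x' i) \<le> r) \<and> (\<forall>i<n. dist (y i) (y' i) \<le> r)" "i < m + n"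
    then show "dist (append_pt m n x y i) (append_pt m n x' y' i) \<le> r" by (auto simp: append_pt_def)
  qed
  have le: "sup_dist (m + n) (append_pt m n x y) (append_pt m n x' y') \<le> r \<longleftrightarrow> max (sup_dist m x x') (sup_dist n y y') \<le> r" for r
    using assms by (simp add: sup_dist_le_iff *)
  show ?thesis
  proof (rule antisym)
    show "sup_dist (m + n) (append_pt m n x y) (append_pt m n x' y') \<le> max (sup_dist m x x') (sup_dist n y y')"
      by (rule iffD2[OF le order.refl])
    show "max (sup_dist m x x') (sup_dist n y y') \<le> sup_dist (m + n) (append_pt m n x y) (append_pt m n x' y')"
      by (rule iffD1[OF le order.refl])
  qed
qed

lemma append_pt_mem: "append_pt m n x y \<in> {..<m + n} \<rightarrow>\<^sub>E UNIV"
  by (simp add: append_pt_def)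

lemma append_pt_surj:
  assumes "z \<in> {..<m + n} \<rightarrow>\<^sub>E UNIV"
  obtains x y where "x \<in> {..<m} \<rightarrow>\<^sub>E UNIV" "y \<in> {..<n} \<rightarrow>\<^sub>E UNIV" "z = append_pt m n x y"
proof (rule that[of "\<lambda>i\<in>{..<m}. z i" "\<lambda>i\<in>{..<n}. z (m + i)"])
  show "z = append_pt m n (\<lambda>i\<in>{..<m}. z i) (\<lambda>i\<in>{..<n}. z (m + i))"
    by (rule PiE_ext[OF assms append_pt_mem]) (auto simp: append_pt_def)
qed simp_all

lemma append_pt_inject:
  assumes "x \<in> {..<m} \<rightarrow>\<^sub>E UNIV" "y \<in> {..<n} \<rightarrow>\<^sub>E UNIV" "x' \<in> {..<m} \<rightarrow>\<^sub>E UNIV" "y' \<in> {..<n} \<rightarrow>\<^sub>E UNIV"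
    and eq: "append_pt m n x y = append_pt m n x' y'"
  shows "x = x'" "y = y'"
proof -
  have "x i = x' i" if "i < m" for i
    using fun_cong[OF eq, of i] that by (simp add: append_pt_def)
  then show "x = x'" by (intro PiE_ext[OF assms(1,3)]) auto
  have "y i = y' i" if "i < n" for i
    using fun_cong[OF eq, of "m + i"] that by (simp add: append_pt_def)
  then show "y = y'" by (intro PiE_ext[OF assms(2,4)]) auto
qed

locale separable_metric_prob = prob_space M
  for M :: "'a::{metric_space, second_countable_topology} measure" +
  assumes sets_borel: "sets M = sets borel"
begin

lemma space_UNIV [simp]: "space M = UNIV"
  using sets_eq_imp_space_eq[OF sets_borel] by simp

lemma space_power [simp]: "space (power_measure n M) = ({..<n} \<rightarrow>\<^sub>E UNIV)"
  by (simp add: power_measure_def space_PiM)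

lemma prob_space_power: "prob_space (power_measure n M)"
  unfolding power_measure_def by (intro prob_space_PiM prob_space_axioms)

text \<open>
  By second countability an open set is a countable union of boxes from a base.
\<close>

lemma open_in_power_measurable:
  assumes n: "1 \<le> n" and U: "openin (Metric_space.mtopology ({..<n} \<rightarrow>\<^sub>E UNIV) (sup_dist n)) U"
  shows "U \<in> sets (power_measure n M)"
proof -
  interpret Metric_space "{..<n} \<rightarrow>\<^sub>E (UNIV :: 'a set)" "sup_dist n" by (rule Metric_space_sup_dist[OF n])
  obtain B :: "'a set set" where B: "countable B" "topological_basis B" using ex_countable_basis by blast
  define V where "V = {Pi\<^sub>E {..<n} b | b. b \<in> {..<n} \<rightarrow>\<^sub>E B \<and> Pi\<^sub>E {..<n} b \<subseteq> U}"
  have "countable ({..<n} \<rightarrow>\<^sub>E B)" using B by (intro countable_PiE) auto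
  then have cV: "countable V"
    by (rule countable_subset[OF _ countable_image[of _ "Pi\<^sub>E {..<n}"], rotated]) (auto simp: V_def)
  have "\<Union>V = U"
  proof (intro equalityI subsetI)
    fix x assume x: "x \<in> U"
    then have xs: "x \<in> {..<n} \<rightarrow>\<^sub>E UNIV" using U openin_mtopology by blast
    obtain r where r: "0 < r" "mball x r \<subseteq> U" using U x openin_mtopology by blast
    have "\<exists>b\<in>B. x i \<in> b \<and> b \<subseteq> ball (x i) r" for i
    proof -
      have "x i \<in> ball (x i) r" using r by simp
      from topological_basisE[OF B(2) open_ball this] show ?thesis by metis
    qed
    then obtain b where b: "\<And>i. b i \<in> B" "\<And>i. x i \<in> b i" "\<And>i. b i \<subseteq> ball (x i) r" by metis
    let ?b = "restrict b {..<n}"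
    have sub: "Pi\<^sub>E {..<n} ?b \<subseteq> mball x r"
    proof
      fix y assume y: "y \<in> Pi\<^sub>E {..<n} ?b"
      then have "\<And>i. i < n \<Longrightarrow> dist (x i) (y i) < r" using b(3) by (fastforce simp: PiE_iff)
      then show "y \<in> mball x r" using xs y by (auto simp: sup_dist_less_iff[OF n] PiE_iff)
    qed
    have "?b \<in> {..<n} \<rightarrow>\<^sub>E B" using b(1) by simp
    with order.trans[OF sub r(2)] have "Pi\<^sub>E {..<n} ?b \<in> V"
      unfolding V_def by (intro CollectI exI[of _ ?b] conjI refl)
    moreover have "x \<in> Pi\<^sub>E {..<n} ?b" using xs b(2) by (simp add: PiE_iff)
    ultimately show "x \<in> \<Union>V" by (rule UnionI)
  qed (auto simp: V_def)
  moreover have "\<Union>V \<in> sets (power_measure n M)"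
  proof (intro sets.countable_Union cV subsetI)
    fix W assume "W \<in> V"
    then obtain b where b: "b \<in> {..<n} \<rightarrow>\<^sub>E B" "W = Pi\<^sub>E {..<n} b" unfolding V_def by blast
    have "b i \<in> sets M" if "i < n" for i
      using b(1) that B(2) unfolding sets_borel by (intro borel_open) (auto simp: topological_basis_open PiE_iff)
    then show "W \<in> sets (power_measure n M)" unfolding b power_measure_def by (intro sets_PiM_I_finite) auto
  qed
  ultimately show ?thesis by simp
qed

lemma metric_prob_space_power: "1 \<le> n \<Longrightarrow> metric_prob_space (power_measure n M) (sup_dist n)"
  by (intro metric_prob_space.intro metric_prob_space_axioms.intro prob_space_power)
    (simp_all add: Metric_space_sup_dist open_in_power_measurable)

lemma metric_prob_space_base: "metric_prob_space M dist"
proof (intro metric_prob_space.intro metric_prob_space_axioms.intro prob_space_axioms)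
  show "Metric_space (space M) dist" by (simp add: Met_TC.Metric_space_axioms)
  fix U assume "openin (Metric_space.mtopology (space M) dist) U"
  then show "U \<in> sets M" by (simp add: sets_borel)
qed

lemma prod_lessThan_add: "(\<Prod>i<m + n. g i) = (\<Prod>i<m. g i) * (\<Prod>i<n. g (m + i) :: ennreal)" for m n :: nat
  by (induction n) (simp_all add: mult.assoc)

lemma measurable_append [measurable]:
  "(\<lambda>(x, y). append_pt m n x y) \<in> measurable (power_measure m M \<Otimes>\<^sub>M power_measure n M) (power_measure (m + n) M)"
  unfolding append_pt_def power_measure_def split_beta
proof (rule measurable_restrict)
  fix i assume i: "i \<in> {..<m + n}"
  show "(\<lambda>z. if i < m then fst z i else snd z (i - m))
     \<in> measurable (Pi\<^sub>M {..<m} (\<lambda>_. M) \<Otimes>\<^sub>M Pi\<^sub>M {..<n} (\<lambda>_. M)) M"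
  proof (cases "i < m")
    case True
    then have "(\<lambda>z. fst z i) \<in> measurable (Pi\<^sub>M {..<m} (\<lambda>_. M) \<Otimes>\<^sub>M Pi\<^sub>M {..<n} (\<lambda>_. M)) M"
      by (intro measurable_compose[OF measurable_fst measurable_component_singleton]) auto
    with True show ?thesis by simp
  next
    case False
    then have "(\<lambda>z. snd z (i - m)) \<in> measurable (Pi\<^sub>M {..<m} (\<lambda>_. M) \<Otimes>\<^sub>M Pi\<^sub>M {..<n} (\<lambda>_. M)) M"
      using i by (intro measurable_compose[OF measurable_snd measurable_component_singleton]) auto
    with False show ?thesis by simp
  qed
qed

text \<open>
  Both measures agree on boxes.
\<close>

lemma distr_append:
  "distr (power_measure m M \<Otimes>\<^sub>M power_measure n M) (power_measure (m + n) M) (\<lambda>(x, y). append_pt m n x y)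
     = power_measure (m + n) M" (is "?D = _")
proof -
  interpret product_sigma_finite "\<lambda>_::nat. M" ..
  interpret A: prob_space "power_measure m M" by (rule prob_space_power)
  interpret B: prob_space "power_measure n M" by (rule prob_space_power)
  interpret P: pair_prob_space "power_measure m M" "power_measure n M" ..
  have "?D = Pi\<^sub>M {..<m + n} (\<lambda>_. M)"
  proof (rule PiM_eqI)
    fix A assume A: "\<And>i. i \<in> {..<m + n} \<Longrightarrow> A i \<in> sets M"
    have S: "Pi\<^sub>E {..<m + n} A \<in> sets (power_measure (m + n) M)"
      unfolding power_measure_def using A by (intro sets_PiM_I_finite) auto
    have "(\<lambda>(x, y). append_pt m n x y) -` Pi\<^sub>E {..<m + n} A \<inter> space (power_measure m M \<Otimes>\<^sub>M power_measure n M)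
        = Pi\<^sub>E {..<m} A \<times> Pi\<^sub>E {..<n} (\<lambda>i. A (m + i))" (is "?L = ?R")
    proof (intro set_eqI iffI)
      fix z assume z: "z \<in> ?L"
      obtain x y where xy: "z = (x, y)" by force
      with z have x: "x \<in> {..<m} \<rightarrow>\<^sub>E UNIV" "y \<in> {..<n} \<rightarrow>\<^sub>E UNIV" and a: "append_pt m n x y \<in> Pi\<^sub>E {..<m + n} A"
        by (auto simp: space_pair_measure)
      have "x i \<in> A i" if "i < m" for i using PiE_mem[OF a, of i] that by (simp add: append_pt_def)
      moreover have "y i \<in> A (m + i)" if "i < n" for i using PiE_mem[OF a, of "m + i"] that by (simp add: append_pt_def)
      ultimately show "z \<in> ?R" using x by (auto simp: xy PiE_iff)
    next
      fix z assume z: "z \<in> ?R"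
      obtain x y where xy: "z = (x, y)" by force
      have "append_pt m n x y i \<in> A i" if "i < m + n" for i
      proof (cases "i < m")
        case True then show ?thesis using z that by (auto simp: xy append_pt_def PiE_iff)
      next
        case False
        then have "y (i - m) \<in> A (m + (i - m))" using z that unfolding xy by (intro PiE_mem[of y "{..<n}"]) auto
        then show ?thesis using False that by (simp add: append_pt_def)
      qed
      then show "z \<in> ?L" using z by (auto simp: xy space_pair_measure PiE_iff append_pt_def)
    qed
    then have "emeasure ?D (Pi\<^sub>E {..<m + n} A)
       = emeasure (power_measure m M \<Otimes>\<^sub>M power_measure n M) (Pi\<^sub>E {..<m} A \<times> Pi\<^sub>E {..<n} (\<lambda>i. A (m + i)))"
      using S by (subst emeasure_distr) (auto intro: measurable_append)
    also have "\<dots> = emeasure (power_measure m M) (Pi\<^sub>E {..<m} A) * emeasure (power_measure n M) (Pi\<^sub>E {..<n} (\<lambda>i. A (m + i)))"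
      using A by (intro B.emeasure_pair_measure_Times) (auto simp: power_measure_def intro!: sets_PiM_I_finite)
    also have "\<dots> = (\<Prod>i<m + n. emeasure M (A i))"
      unfolding prod_lessThan_add power_measure_def
      using A emeasure_PiM[of "{..<m}" A] emeasure_PiM[of "{..<n}" "\<lambda>i. A (m + i)"] by simp
    finally show "emeasure ?D (Pi\<^sub>E {..<m + n} A) = (\<Prod>i\<in>{..<m + n}. emeasure M (A i))" .
  qed (simp_all add: power_measure_def)
  then show ?thesis by (simp add: power_measure_def)
qed

end

text \<open>
  Borel sets of powers are generated by the supremum distance. This lemma moves them along coordinate
  maps, which are nonexpansive.
\<close>

lemma nonexpansive_vimage_borel_sets:
  assumes "Metric_space S d" "Metric_space T e"
    and f: "\<And>x. x \<in> S \<Longrightarrow> f x \<in> T" "\<And>x y. x \<in> S \<Longrightarrow> y \<in> S \<Longrightarrow> e (f x) (f y) \<le> d x y"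
    and B: "B \<in> borel_sets T e"
  shows "{x \<in> S. f x \<in> B} \<in> borel_sets S d"
proof -
  interpret S: Metric_space S d by fact
  interpret T: Metric_space T e by fact
  show ?thesis using B unfolding borel_sets_def
  proof induction
    case (Basic U)
    then have U: "openin T.mtopology U" by simp
    have "openin S.mtopology {x \<in> S. f x \<in> U}"
      unfolding S.openin_dist_iff
    proof (intro conjI ballI)
      fix x assume x: "x \<in> {x \<in> S. f x \<in> U}"
      then obtain r where r: "0 < r" "\<And>y. y \<in> T \<Longrightarrow> e (f x) y < r \<Longrightarrow> y \<in> U"
        using U unfolding T.openin_dist_iff by blast
      show "\<exists>r>0. \<forall>y\<in>S. d x y < r \<longrightarrow> y \<in> {x \<in> S. f x \<in> U}"
      proof (intro exI[of _ r] conjI ballI impI)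
        fix y assume y: "y \<in> S" "d x y < r"
        then have "e (f x) (f y) < r" using f(2)[of x y] x by simp
        then show "y \<in> {x \<in> S. f x \<in> U}" using r(2)[of "f y"] f(1) y by simp
      qed (rule r)
    qed auto
    then show ?case by (intro sigma_sets.Basic) simp
  next
    case Empty
    then show ?case by (simp add: sigma_sets.Empty)
  next
    case (Compl B)
    have "{x \<in> S. f x \<in> T - B} = S - {x \<in> S. f x \<in> B}" using f by auto
    then show ?case using sigma_sets.Compl[OF Compl.IH] by simp
  next
    case (Union B)
    have "{x \<in> S. f x \<in> \<Union> (range B)} = (\<Union>i. {x \<in> S. f x \<in> B i})" by auto
    then show ?case using sigma_sets.Union[OF Union.IH] by simp
  qed
qed

context separable_metric_prob
begin

context notes One_nat_def [simp del]
begin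

text \<open>
  The isometry of the base space with its first power.
\<close>

definition singleton_pt :: "'a \<Rightarrow> nat \<Rightarrow> 'a" where
  "singleton_pt a = (\<lambda>i\<in>{..<1}. a)"

lemma singleton_pt_mem: "singleton_pt a \<in> {..<1} \<rightarrow>\<^sub>E UNIV"
  by (simp add: singleton_pt_def)

lemma singleton_pt_eq: "z \<in> {..<1} \<rightarrow>\<^sub>E UNIV \<Longrightarrow> singleton_pt (z 0) = z"
  by (intro PiE_ext[OF singleton_pt_mem]) (auto simp: singleton_pt_def)

lemma sup_dist_singleton [simp]: "sup_dist 1 (singleton_pt a) (singleton_pt b) = dist a b"
  by (simp add: sup_dist_def singleton_pt_def One_nat_def lessThan_Suc)

lemma measurable_singleton_pt: "singleton_pt \<in> measurable M (power_measure 1 M)"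
  unfolding power_measure_def singleton_pt_def by (rule measurable_restrict) auto

lemma distr_singleton_pt: "distr M (power_measure 1 M) singleton_pt = power_measure 1 M"
proof -
  interpret product_sigma_finite "\<lambda>_::nat. M" ..
  have "distr M (power_measure 1 M) singleton_pt = Pi\<^sub>M {..<1} (\<lambda>_. M)"
  proof (rule PiM_eqI)
    fix A assume A: "\<And>i::nat. i \<in> {..<1} \<Longrightarrow> A i \<in> sets M"
    have S: "Pi\<^sub>E {..<1} A \<in> sets (power_measure 1 M)"
      unfolding power_measure_def by (rule sets_PiM_I_finite[OF finite_lessThan A])
    have vim: "singleton_pt -` Pi\<^sub>E {..<1} A \<inter> space M = A 0"
    proof (intro set_eqI)
      fix a
      have "singleton_pt a \<in> Pi\<^sub>E {..<1} A \<longleftrightarrow> a \<in> A 0"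
        unfolding singleton_pt_def restrict_PiE_iff by (simp add: One_nat_def lessThan_Suc)
      then show "a \<in> singleton_pt -` Pi\<^sub>E {..<1} A \<inter> space M \<longleftrightarrow> a \<in> A 0" by simp
    qed
    have "emeasure (distr M (power_measure 1 M) singleton_pt) (Pi\<^sub>E {..<1} A) = emeasure M (A 0)"
      unfolding emeasure_distr[OF measurable_singleton_pt S] vim ..
    also have "\<dots> = (\<Prod>i\<in>{..<1}. emeasure M (A i))" by (simp add: One_nat_def lessThan_Suc)
    finally show "emeasure (distr M (power_measure 1 M) singleton_pt) (Pi\<^sub>E {..<1} A) = (\<Prod>i\<in>{..<1}. emeasure M (A i))" .
  qed (simp_all add: power_measure_def)
  then show ?thesis by (simp add: power_measure_def)
qed

lemma measure_power_1:
  assumes "A \<in> sets (power_measure 1 M)"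
  shows "measure (power_measure 1 M) A = measure M (singleton_pt -` A)"
  using measure_distr[OF measurable_singleton_pt assms] unfolding distr_singleton_pt by simp

lemma enlargement_power_1:
  assumes "A \<subseteq> {..<1} \<rightarrow>\<^sub>E UNIV"
  shows "singleton_pt -` enlargement ({..<1} \<rightarrow>\<^sub>E UNIV) (sup_dist 1) A r = enlargement UNIV dist (singleton_pt -` A) r"
proof (intro set_eqI iffI)
  fix a assume "a \<in> singleton_pt -` enlargement ({..<1} \<rightarrow>\<^sub>E UNIV) (sup_dist 1) A r"
  then obtain z where z: "z \<in> A" "sup_dist 1 (singleton_pt a) z < r" by (auto simp: enlargement_iff)
  then have "singleton_pt (z 0) = z" using assms by (intro singleton_pt_eq) auto
  then have "z 0 \<in> singleton_pt -` A" "dist a (z 0) < r" using z sup_dist_singleton[of a "z 0"] by auto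
  then show "a \<in> enlargement UNIV dist (singleton_pt -` A) r" by (auto simp: enlargement_iff)
next
  fix a assume "a \<in> enlargement UNIV dist (singleton_pt -` A) r"
  then obtain b where b: "singleton_pt b \<in> A" "dist a b < r" by (auto simp: enlargement_iff)
  then have "sup_dist 1 (singleton_pt a) (singleton_pt b) < r" by simp
  then show "a \<in> singleton_pt -` enlargement ({..<1} \<rightarrow>\<^sub>E UNIV) (sup_dist 1) A r"
    unfolding vimage_eq enlargement_iff using b(1) singleton_pt_mem by blast
qed

lemma outer_boundary_power_1:
  assumes A: "A \<in> sets (power_measure 1 M)"
  shows "outer_boundary (power_measure 1 M) (sup_dist 1) A = outer_boundary M dist (singleton_pt -` A)"
proof -
  interpret X: metric_prob_space "power_measure 1 M" "sup_dist 1" by (rule metric_prob_space_power) simp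
  have As: "A \<subseteq> {..<1} \<rightarrow>\<^sub>E UNIV" using sets.sets_into_space[OF A] by simp
  have "measure (power_measure 1 M) (enlargement ({..<1} \<rightarrow>\<^sub>E UNIV) (sup_dist 1) A r)
      = measure M (enlargement UNIV dist (singleton_pt -` A) r)" for r
    using X.enlargement_sets[of A r] As by (simp add: measure_power_1 enlargement_power_1)
  then show ?thesis unfolding outer_boundary_def by (simp add: measure_power_1[OF A])
qed

lemma borel_sets_UNIV: "borel_sets UNIV (dist :: 'a \<Rightarrow> _) = sets borel"
  by (simp add: borel_sets_def borel_def)

lemma singleton_pt_vimage_borel:
  assumes "A \<in> borel_sets ({..<1} \<rightarrow>\<^sub>E UNIV) (sup_dist 1)"
  shows "singleton_pt -` A \<in> borel_sets UNIV dist"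
proof -
  have "{x \<in> UNIV. singleton_pt x \<in> A} \<in> borel_sets UNIV dist"
    by (rule nonexpansive_vimage_borel_sets[OF Met_TC.Metric_space_axioms Metric_space_sup_dist _ _ assms])
      (simp_all add: singleton_pt_mem)
  then show ?thesis by (simp add: vimage_def)
qed

lemma iso_profile_pow_1: "iso_profile_pow 1 M p = iso_profile M dist p"
proof -
  interpret X: metric_prob_space "power_measure 1 M" "sup_dist 1" by (rule metric_prob_space_power) simp
  let ?E = "{..<1::nat} \<rightarrow>\<^sub>E (UNIV :: 'a set)"
  have bd: "min (outer_boundary (power_measure 1 M) (sup_dist 1) A) (inner_boundary (power_measure 1 M) (sup_dist 1) A)
      = min (outer_boundary M dist (singleton_pt -` A)) (inner_boundary M dist (singleton_pt -` A))"
    if A: "A \<in> borel_sets ?E (sup_dist 1)" for A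
  proof -
    have A': "A \<in> sets (power_measure 1 M)" using X.borel_sets_sets A by simp
    have "singleton_pt -` (?E - A) = UNIV - singleton_pt -` A" using singleton_pt_mem by auto
    moreover have "?E - A \<in> sets (power_measure 1 M)" using sets.compl_sets[OF A'] by simp
    ultimately show ?thesis using A' by (simp add: inner_boundary_def outer_boundary_power_1)
  qed
  show ?thesis unfolding iso_profile_pow_def
  proof (rule antisym)
    show "iso_profile (power_measure 1 M) (sup_dist 1) p \<le> iso_profile M dist p"
      unfolding iso_profile_def
    proof (rule INF_mono)
      fix B assume B: "B \<in> {A \<in> borel_sets (space M) dist. prob A = p}"
      define A where "A = {z \<in> ?E. z 0 \<in> B}"
      have vA: "singleton_pt -` A = B" unfolding A_def using singleton_pt_mem by (auto simp: singleton_pt_def)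
      have A: "A \<in> borel_sets ?E (sup_dist 1)" unfolding A_def
      proof (rule nonexpansive_vimage_borel_sets[of _ _ UNIV dist])
        show "dist (x 0) (y 0) \<le> sup_dist 1 x y" for x y :: "nat \<Rightarrow> 'a" by (rule dist_le_sup_dist) simp
      qed (use B Met_TC.Metric_space_axioms Metric_space_sup_dist[of 1] in auto)
      then have "measure (power_measure 1 M) A = p"
        using X.borel_sets_sets[of A] B by (simp add: measure_power_1 vA)
      then show "\<exists>A\<in>{A \<in> borel_sets (space (power_measure 1 M)) (sup_dist 1). measure (power_measure 1 M) A = p}.
          min (outer_boundary (power_measure 1 M) (sup_dist 1) A) (inner_boundary (power_measure 1 M) (sup_dist 1) A)
          \<le> min (outer_boundary M dist B) (inner_boundary M dist B)"
        using A bd[OF A] unfolding vA by (intro bexI[of _ A]) auto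
    qed
    show "iso_profile M dist p \<le> iso_profile (power_measure 1 M) (sup_dist 1) p"
      unfolding iso_profile_def
    proof (rule INF_mono)
      fix A assume A: "A \<in> {A \<in> borel_sets (space (power_measure 1 M)) (sup_dist 1). measure (power_measure 1 M) A = p}"
      then have A1: "A \<in> borel_sets ?E (sup_dist 1)" by simp
      have "prob (singleton_pt -` A) = p"
        using X.borel_sets_sets[of A] A by (simp add: measure_power_1)
      then show "\<exists>B\<in>{A \<in> borel_sets (space M) dist. prob A = p}.
          min (outer_boundary M dist B) (inner_boundary M dist B)
          \<le> min (outer_boundary (power_measure 1 M) (sup_dist 1) A) (inner_boundary (power_measure 1 M) (sup_dist 1) A)"
        using bd[OF A1] singleton_pt_vimage_borel[OF A1] by (intro bexI[of _ "singleton_pt -` A"]) auto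
    qed
  qed
qed

end

definition product_set :: "nat \<Rightarrow> nat \<Rightarrow> (nat \<Rightarrow> 'a) set \<Rightarrow> (nat \<Rightarrow> 'a) set \<Rightarrow> (nat \<Rightarrow> 'a) set" where
  "product_set m n A B = (\<lambda>(x, y). append_pt m n x y) ` (A \<times> B)"

lemma product_set_borel:
  assumes mn: "1 \<le> m" "1 \<le> n"
    and A: "A \<in> borel_sets ({..<m} \<rightarrow>\<^sub>E UNIV) (sup_dist m)" and B: "B \<in> borel_sets ({..<n} \<rightarrow>\<^sub>E UNIV) (sup_dist n)"
  shows "product_set m n A B \<in> borel_sets ({..<m + n} \<rightarrow>\<^sub>E UNIV) (sup_dist (m + n))"
proof -
  let ?E = "{..<m + n} \<rightarrow>\<^sub>E (UNIV :: 'a set)"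
  interpret A: metric_prob_space "power_measure m M" "sup_dist m" by (rule metric_prob_space_power[OF mn(1)])
  interpret B: metric_prob_space "power_measure n M" "sup_dist n" by (rule metric_prob_space_power[OF mn(2)])
  have MS: "Metric_space ?E (sup_dist (m + n))" using mn by (intro Metric_space_sup_dist) simp
  interpret S: sigma_algebra ?E "borel_sets ?E (sup_dist (m + n))"
    unfolding borel_sets_def
    by (rule sigma_algebra_sigma_sets) (simp add: Metric_space.openin_dist_iff[OF MS] subset_iff)
  let ?f = "\<lambda>z::nat \<Rightarrow> 'a. \<lambda>i\<in>{..<m}. z i" and ?g = "\<lambda>z::nat \<Rightarrow> 'a. \<lambda>i\<in>{..<n}. z (m + i)"
  have "{z \<in> ?E. ?f z \<in> A} \<in> borel_sets ?E (sup_dist (m + n))"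
  proof (rule nonexpansive_vimage_borel_sets[OF MS _ _ _ A])
    show "sup_dist m (?f x) (?f y) \<le> sup_dist (m + n) x y" for x y
      by (auto simp: sup_dist_le_iff[OF mn(1)] intro: dist_le_sup_dist)
  qed (use Metric_space_sup_dist[OF mn(1)] in auto)
  moreover have "{z \<in> ?E. ?g z \<in> B} \<in> borel_sets ?E (sup_dist (m + n))"
  proof (rule nonexpansive_vimage_borel_sets[OF MS _ _ _ B])
    show "sup_dist n (?g x) (?g y) \<le> sup_dist (m + n) x y" for x y
      by (auto simp: sup_dist_le_iff[OF mn(2)] intro: dist_le_sup_dist)
  qed (use Metric_space_sup_dist[OF mn(2)] in auto)
  ultimately have "{z \<in> ?E. ?f z \<in> A} \<inter> {z \<in> ?E. ?g z \<in> B} \<in> borel_sets ?E (sup_dist (m + n))" by (rule S.Int)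
  also have "{z \<in> ?E. ?f z \<in> A} \<inter> {z \<in> ?E. ?g z \<in> B} = product_set m n A B"
  proof (intro set_eqI iffI)
    fix z assume z: "z \<in> {z \<in> ?E. ?f z \<in> A} \<inter> {z \<in> ?E. ?g z \<in> B}"
    then have zE: "z \<in> ?E" and fg: "(?f z, ?g z) \<in> A \<times> B" by blast+
    have "z = append_pt m n (?f z) (?g z)"
      by (rule PiE_ext[OF zE append_pt_mem]) (auto simp: append_pt_def)
    then have "z = (case (?f z, ?g z) of (x, y) \<Rightarrow> append_pt m n x y)" by (simp only: prod.case)
    then show "z \<in> product_set m n A B" unfolding product_set_def using fg by (rule image_eqI)
  next
    fix z assume "z \<in> product_set m n A B"
    then obtain x y where xy: "x \<in> A" "y \<in> B" "z = append_pt m n x y" by (auto simp: product_set_def)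
    have mem: "x \<in> {..<m} \<rightarrow>\<^sub>E UNIV" "y \<in> {..<n} \<rightarrow>\<^sub>E UNIV"
      using A.borel_sets_space[of A] B.borel_sets_space[of B] A B xy(1,2) unfolding space_power by blast+
    have "?f z = x" unfolding xy(3)
      by (rule PiE_ext[OF restrict_PiE_iff[THEN iffD2] mem(1)]) (simp_all add: append_pt_def)
    moreover have "?g z = y" unfolding xy(3)
      by (rule PiE_ext[OF restrict_PiE_iff[THEN iffD2] mem(2)]) (simp_all add: append_pt_def)
    moreover have "z \<in> ?E" unfolding xy(3) by (rule append_pt_mem)
    ultimately show "z \<in> {z \<in> ?E. ?f z \<in> A} \<inter> {z \<in> ?E. ?g z \<in> B}" using xy(1,2) by blast
  qed
  finally show ?thesis .
qed

text \<open>
  The preimage of a product set under concatenation is a rectangle, as concatenation is injective.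
\<close>

lemma measure_product_set:
  assumes A: "A \<in> sets (power_measure m M)" and B: "B \<in> sets (power_measure n M)"
    and P: "product_set m n A B \<in> sets (power_measure (m + n) M)"
  shows "measure (power_measure (m + n) M) (product_set m n A B)
     = measure (power_measure m M) A * measure (power_measure n M) B"
proof -
  interpret A: prob_space "power_measure m M" by (rule prob_space_power)
  interpret B: prob_space "power_measure n M" by (rule prob_space_power)
  have sub: "A \<subseteq> {..<m} \<rightarrow>\<^sub>E UNIV" "B \<subseteq> {..<n} \<rightarrow>\<^sub>E UNIV"
    using sets.sets_into_space[OF A] sets.sets_into_space[OF B] by auto
  have vim: "(\<lambda>(x, y). append_pt m n x y) -` product_set m n A B \<inter> space (power_measure m M \<Otimes>\<^sub>M power_measure n M) = A \<times> B"
    (is "?L = _")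
  proof (intro equalityI subsetI)
    fix z assume z: "z \<in> ?L"
    obtain x y where xy: "z = (x, y)" by force
    from z obtain x' y' where x'y': "x' \<in> A" "y' \<in> B" "append_pt m n x y = append_pt m n x' y'"
      unfolding xy by (auto simp: product_set_def)
    have mem: "x \<in> {..<m} \<rightarrow>\<^sub>E UNIV" "y \<in> {..<n} \<rightarrow>\<^sub>E UNIV" "x' \<in> {..<m} \<rightarrow>\<^sub>E UNIV" "y' \<in> {..<n} \<rightarrow>\<^sub>E UNIV"
      using z x'y'(1,2) sub unfolding xy by (simp_all add: space_pair_measure subset_iff)
    have "x = x'" "y = y'" by (rule append_pt_inject[OF mem x'y'(3)])+
    then show "z \<in> A \<times> B" using x'y' xy by simp
  next
    fix z assume "z \<in> A \<times> B"
    then show "z \<in> ?L" using sub by (auto simp: space_pair_measure product_set_def)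
  qed
  have "measure (power_measure (m + n) M) (product_set m n A B)
      = measure (power_measure m M \<Otimes>\<^sub>M power_measure n M) (A \<times> B)"
    using measure_distr[OF measurable_append P] unfolding distr_append vim .
  also have "\<dots> = measure (power_measure m M) A * measure (power_measure n M) B"
    using B.emeasure_pair_measure_Times[OF A B] by (simp add: measure_def enn2real_mult)
  finally show ?thesis .
qed

lemma enlargement_product_set:
  assumes mn: "1 \<le> m" "1 \<le> n" and sub: "A \<subseteq> {..<m} \<rightarrow>\<^sub>E UNIV" "B \<subseteq> {..<n} \<rightarrow>\<^sub>E UNIV"
  shows "enlargement ({..<m + n} \<rightarrow>\<^sub>E UNIV) (sup_dist (m + n)) (product_set m n A B) r
     = product_set m n (enlargement ({..<m} \<rightarrow>\<^sub>E UNIV) (sup_dist m) A r) (enlargement ({..<n} \<rightarrow>\<^sub>E UNIV) (sup_dist n) B r)"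
proof (intro set_eqI iffI)
  fix z assume "z \<in> enlargement ({..<m + n} \<rightarrow>\<^sub>E UNIV) (sup_dist (m + n)) (product_set m n A B) r"
  then obtain a b where ab: "z \<in> {..<m + n} \<rightarrow>\<^sub>E UNIV" "a \<in> A" "b \<in> B" "sup_dist (m + n) z (append_pt m n a b) < r"
    by (auto simp: enlargement_iff product_set_def)
  obtain x y where xy: "x \<in> {..<m} \<rightarrow>\<^sub>E UNIV" "y \<in> {..<n} \<rightarrow>\<^sub>E UNIV" "z = append_pt m n x y"
    using append_pt_surj[OF ab(1)] by blast
  have "sup_dist m x a < r" "sup_dist n y b < r" using ab(4) unfolding xy(3) sup_dist_append[OF mn] by simp_all
  then show "z \<in> product_set m n (enlargement ({..<m} \<rightarrow>\<^sub>E UNIV) (sup_dist m) A r) (enlargement ({..<n} \<rightarrow>\<^sub>E UNIV) (sup_dist n) B r)"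
    using xy ab unfolding product_set_def by (intro image_eqI[of _ _ "(x, y)"]) (auto simp: enlargement_iff)
next
  fix z assume "z \<in> product_set m n (enlargement ({..<m} \<rightarrow>\<^sub>E UNIV) (sup_dist m) A r) (enlargement ({..<n} \<rightarrow>\<^sub>E UNIV) (sup_dist n) B r)"
  then obtain x y a b where xy: "z = append_pt m n x y" "a \<in> A" "b \<in> B" "sup_dist m x a < r" "sup_dist n y b < r"
    by (auto simp: enlargement_iff product_set_def)
  from xy(4,5) have "sup_dist (m + n) z (append_pt m n a b) < r" unfolding xy(1) sup_dist_append[OF mn] by simp
  moreover have "append_pt m n a b \<in> product_set m n A B" using xy(2,3) by (auto simp: product_set_def)
  moreover have "z \<in> {..<m + n} \<rightarrow>\<^sub>E UNIV" unfolding xy(1) by (rule append_pt_mem)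
  ultimately show "z \<in> enlargement ({..<m + n} \<rightarrow>\<^sub>E UNIV) (sup_dist (m + n)) (product_set m n A B) r"
    unfolding enlargement_iff by blast
qed

text \<open>
  The bound on all small enlargements, and not merely along a sequence, is the point: the upper
  boundary contents of two sets can be added, their lower ones cannot.
\<close>

lemma regular_near_minimizer:
  assumes R: "hypothesis_R M" and n: "1 \<le> n" and t: "0 < t" "t < 1" and c: "iso_profile_pow n M t < ereal c"
  obtains A where "A \<in> borel_sets ({..<n} \<rightarrow>\<^sub>E UNIV) (sup_dist n)" "measure (power_measure n M) A = t"
    "eventually (\<lambda>h. measure (power_measure n M) (enlargement ({..<n} \<rightarrow>\<^sub>E UNIV) (sup_dist n) A h) \<le> t + c * h) (at_right 0)"
proof -
  let ?E = "{..<n} \<rightarrow>\<^sub>E (UNIV :: 'a set)"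
  interpret X: metric_prob_space "power_measure n M" "sup_dist n" by (rule metric_prob_space_power[OF n])
  have "0 \<le> iso_profile_pow n M t" unfolding iso_profile_pow_def by (rule X.iso_profile_nonneg)
  then obtain i where i: "iso_profile_pow n M t = ereal i" "i < c"
    using c by (cases "iso_profile_pow n M t") auto
  define \<epsilon> where "\<epsilon> = (c - i) / 2"
  have \<epsilon>: "0 < \<epsilon>" using i by (simp add: \<epsilon>_def)
  have t': "t \<in> {0<..<1}" using t by simp
  from R[unfolded hypothesis_R_def, THEN conjunct2, rule_format, OF n t' \<epsilon>]
  obtain A where A: "A \<in> borel_sets ?E (sup_dist n)" "X.prob A = t"
    and ob: "outer_boundary (power_measure n M) (sup_dist n) A \<le> iso_profile_pow n M t + ereal \<epsilon>"
    and lim: "((\<lambda>h. ereal (X.prob (enlargement ?E (sup_dist n) A h - A) / h))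
             \<longlongrightarrow> outer_boundary (power_measure n M) (sup_dist n) A) (at_right 0)"
    by blast
  have As: "A \<subseteq> ?E" "A \<in> X.events" using X.borel_sets_space[of A] X.borel_sets_sets[of A] A by auto
  note ob
  also have "iso_profile_pow n M t + ereal \<epsilon> < ereal c" using i by (simp add: \<epsilon>_def field_simps)
  finally have "outer_boundary (power_measure n M) (sup_dist n) A < ereal c" .
  from order_tendstoD(2)[OF lim this]
  have ev: "eventually (\<lambda>h. ereal (X.prob (enlargement ?E (sup_dist n) A h - A) / h) < ereal c) (at_right 0)" .
  have pos: "eventually (\<lambda>h::real. 0 < h) (at_right 0)" by (simp add: eventually_at_right_less)
  have "eventually (\<lambda>h. X.prob (enlargement ?E (sup_dist n) A h) \<le> t + c * h) (at_right 0)"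
    using ev pos
  proof eventually_elim
    case (elim h)
    have s: "A \<subseteq> enlargement ?E (sup_dist n) A h" "enlargement ?E (sup_dist n) A h \<in> X.events"
      using X.subset_enlargement[of A h] X.enlargement_sets[of A h] As elim by auto
    have "X.prob (enlargement ?E (sup_dist n) A h - A) < c * h"
      using elim by (simp add: pos_divide_less_eq)
    then show ?case using s As A(2) by (simp add: X.finite_measure_Diff)
  qed
  with A show thesis by (rule that)
qed

text \<open>
  For the supremum distance the enlargement of \<open>A \<times> B\<close> is the product of the enlargements, so the measure
  of the enlargement is at most \<open>(a + c h) (b + c' h)\<close>, with derivative \<open>a c' + b c\<close> at \<open>0\<close>.
\<close>

lemma iso_profile_pow_mult:
  assumes R: "hypothesis_R M" and mn: "1 \<le> m" "1 \<le> n" and ab: "0 < a" "a < 1" "0 < b" "b < 1"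
    and c: "iso_profile_pow m M a < ereal c" "iso_profile_pow n M b < ereal c'"
  shows "iso_profile_pow (m + n) M (a * b) \<le> ereal (a * c' + b * c)"
proof -
  let ?Em = "{..<m} \<rightarrow>\<^sub>E (UNIV :: 'a set)" and ?En = "{..<n} \<rightarrow>\<^sub>E (UNIV :: 'a set)"
  let ?E = "{..<m + n} \<rightarrow>\<^sub>E (UNIV :: 'a set)"
  interpret X: metric_prob_space "power_measure m M" "sup_dist m" by (rule metric_prob_space_power[OF mn(1)])
  interpret Y: metric_prob_space "power_measure n M" "sup_dist n" by (rule metric_prob_space_power[OF mn(2)])
  interpret Z: metric_prob_space "power_measure (m + n) M" "sup_dist (m + n)"
    by (rule metric_prob_space_power) (use mn in simp)
  obtain A where A: "A \<in> borel_sets ?Em (sup_dist m)" "X.prob A = a"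
    "eventually (\<lambda>h. X.prob (enlargement ?Em (sup_dist m) A h) \<le> a + c * h) (at_right 0)"
    by (rule regular_near_minimizer[OF R mn(1) ab(1,2) c(1)])
  obtain B where B: "B \<in> borel_sets ?En (sup_dist n)" "Y.prob B = b"
    "eventually (\<lambda>h. Y.prob (enlargement ?En (sup_dist n) B h) \<le> b + c' * h) (at_right 0)"
    by (rule regular_near_minimizer[OF R mn(2) ab(3,4) c(2)])
  have As: "A \<subseteq> ?Em" "A \<in> X.events" using X.borel_sets_space[of A] X.borel_sets_sets[of A] A by auto
  have Bs: "B \<subseteq> ?En" "B \<in> Y.events" using Y.borel_sets_space[of B] Y.borel_sets_sets[of B] B by auto
  let ?C = "product_set m n A B"
  have C: "?C \<in> borel_sets ?E (sup_dist (m + n))" by (rule product_set_borel[OF mn A(1) B(1)])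
  have Cs: "?C \<in> Z.events" "?C \<subseteq> ?E" using Z.borel_sets_sets[of ?C] Z.borel_sets_space[of ?C] C by auto
  have pC: "Z.prob ?C = a * b" using measure_product_set[OF As(2) Bs(2) Cs(1)] A(2) B(2) by simp
  have pos: "eventually (\<lambda>h::real. 0 < h) (at_right 0)" by (simp add: eventually_at_right_less)
  have "eventually (\<lambda>h. ereal ((Z.prob (enlargement ?E (sup_dist (m + n)) ?C h) - a * b) / h)
      \<le> ereal (a * c' + b * c + c * c' * h)) (at_right 0)"
    using A(3) B(3) pos
  proof eventually_elim
    case (elim h)
    have eA: "enlargement ?Em (sup_dist m) A h \<in> X.events" using X.enlargement_sets[of A h] As by simp
    have eB: "enlargement ?En (sup_dist n) B h \<in> Y.events" using Y.enlargement_sets[of B h] Bs by simp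
    have eC: "enlargement ?E (sup_dist (m + n)) ?C h \<in> Z.events" using Z.enlargement_sets[of ?C h] Cs by simp
    have "Z.prob (enlargement ?E (sup_dist (m + n)) ?C h)
        = X.prob (enlargement ?Em (sup_dist m) A h) * Y.prob (enlargement ?En (sup_dist n) B h)"
      using measure_product_set[OF eA eB] eC enlargement_product_set[OF mn As(1) Bs(1), of h] by simp
    also have "\<dots> \<le> (a + c * h) * (b + c' * h)"
      using elim order.trans[OF measure_nonneg elim(1)] by (intro mult_mono) auto
    also have "\<dots> = a * b + (a * c' + b * c + c * c' * h) * h" by (simp add: algebra_simps)
    finally show ?case using elim by (simp add: pos_divide_le_eq)
  qed
  then have "outer_boundary (power_measure (m + n) M) (sup_dist (m + n)) ?C
      \<le> Liminf (at_right 0) (\<lambda>h. ereal (a * c' + b * c + c * c' * h))"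
    unfolding outer_boundary_def pC space_power by (rule Liminf_mono)
  also have "\<dots> = ereal (a * c' + b * c)"
  proof (rule lim_imp_Liminf)
    have "((\<lambda>h. a * c' + b * c + c * c' * h) \<longlongrightarrow> a * c' + b * c + c * c' * 0) (at_right 0)"
      by (intro tendsto_intros)
    then show "((\<lambda>h. ereal (a * c' + b * c + c * c' * h)) \<longlongrightarrow> ereal (a * c' + b * c)) (at_right 0)" by simp
  qed simp
  finally have "outer_boundary (power_measure (m + n) M) (sup_dist (m + n)) ?C \<le> ereal (a * c' + b * c)" .
  moreover have "iso_profile_pow (m + n) M (a * b) \<le> outer_boundary (power_measure (m + n) M) (sup_dist (m + n)) ?C"
    unfolding iso_profile_pow_def using Z.iso_profile_le_outer[of ?C] C pC by simp
  ultimately show ?thesis by (rule order.trans[rotated])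
qed

end

section \<open>Tensorization\<close>

context metric_prob_space
begin

text \<open>
  Used to integrate partial gradients over the other variable; the uncountable supremum is again over
  functions with open superlevel sets.
\<close>

lemma measurable_slope_param:
  assumes phi: "\<And>x. x \<in> S \<Longrightarrow> lipschitz_with L (space N) d (\<phi> x)" and x: "x \<in> S"
  shows "(\<lambda>y. slope k S e (\<lambda>x'. \<phi> x' y) x) \<in> borel_measurable N"
proof (rule borel_measurableI_greater)
  fix c :: ennreal
  show "{y \<in> space N. c < slope k S e (\<lambda>x'. \<phi> x' y) x} \<in> sets N"
  proof (cases c)
    case top
    then show ?thesis by simp
  next
    case (real r)
    let ?I = "{x' \<in> S. 0 < e x x' \<and> e x x' < 1 / Suc k}"
    have "{y \<in> space N. c < slope k S e (\<lambda>x'. \<phi> x' y) x}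
        = (\<Union>x'\<in>?I. {y \<in> space N. r < \<bar>\<phi> x y - \<phi> x' y\<bar> / e x x'})" (is "?A = ?B")
    proof (intro set_eqI)
      fix y
      have "y \<in> ?A \<longleftrightarrow> y \<in> space N \<and> (\<exists>x'\<in>?I. ennreal r < ennreal (\<bar>\<phi> x y - \<phi> x' y\<bar> / e x x'))"
        using real(2) unfolding slope_def less_SUP_iff by blast
      also have "\<dots> \<longleftrightarrow> y \<in> space N \<and> (\<exists>x'\<in>?I. r < \<bar>\<phi> x y - \<phi> x' y\<bar> / e x x')"
        using real(1) by (intro conj_cong refl bex_cong) (auto simp: ennreal_less_iff)
      also have "\<dots> \<longleftrightarrow> y \<in> ?B" by (simp only: UN_iff mem_Collect_eq) blast
      finally show "y \<in> ?A \<longleftrightarrow> y \<in> ?B" .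
    qed
    moreover have "openin metric.mtopology ?B"
    proof (intro openin_Union; clarify)
      fix U x' assume x': "x' \<in> S" "0 < e x x'"
      have "lipschitz_with (2 * L / e x x') (space N) d (\<lambda>y. \<bar>\<phi> x y - \<phi> x' y\<bar> / e x x')"
        unfolding lipschitz_with_def
      proof (intro conjI ballI)
        show "0 \<le> 2 * L / e x x'" using phi[OF x] x' by (auto simp: lipschitz_with_def)
        fix y z assume yz: "y \<in> space N" "z \<in> space N"
        have "\<bar>\<phi> x y - \<phi> x z\<bar> \<le> L * d y z" "\<bar>\<phi> x' y - \<phi> x' z\<bar> \<le> L * d y z"
          using phi[OF x] phi[OF x'(1)] yz by (auto simp: lipschitz_with_def)
        then have "\<bar>\<bar>\<phi> x y - \<phi> x' y\<bar> - \<bar>\<phi> x z - \<phi> x' z\<bar>\<bar> \<le> 2 * (L * d y z)" by linarith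
        then have "\<bar>\<bar>\<phi> x y - \<phi> x' y\<bar> - \<bar>\<phi> x z - \<phi> x' z\<bar>\<bar> / e x x' \<le> 2 * (L * d y z) / e x x'"
          using x' by (intro divide_right_mono) auto
        then show "\<bar>\<bar>\<phi> x y - \<phi> x' y\<bar> / e x x' - \<bar>\<phi> x z - \<phi> x' z\<bar> / e x x'\<bar> \<le> 2 * L / e x x' * d y z"
          using x' by (simp flip: diff_divide_distrib)
      qed
      then show "openin metric.mtopology {y \<in> space N. r < \<bar>\<phi> x y - \<phi> x' y\<bar> / e x x'}"
        by (rule open_less_lipschitz)
    qed
    ultimately show ?thesis by (simp add: open_sets)
  qed
qed

lemma measurable_grad_mod_param:
  assumes "\<And>x. x \<in> S \<Longrightarrow> lipschitz_with L (space N) d (\<phi> x)" "x \<in> S"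
  shows "(\<lambda>y. grad_mod S e (\<lambda>x'. \<phi> x' y) x) \<in> borel_measurable N"
  unfolding grad_mod_eq_INF_slope
  by (intro borel_measurable_INF measurable_slope_param[OF assms]) auto

text \<open>
  Averaging at a fixed scale is the triangle inequality, and scales decrease to \<open>0\<close> by monotone
  convergence, slopes being bounded by the Lipschitz constant.
\<close>

lemma grad_mod_integral_le:
  assumes phi1: "\<And>x. x \<in> S \<Longrightarrow> lipschitz_with L (space N) d (\<phi> x)"
    and phi2: "\<And>y. y \<in> space N \<Longrightarrow> lipschitz_with L S e (\<lambda>x. \<phi> x y)"
    and phi01: "\<And>x y. x \<in> S \<Longrightarrow> y \<in> space N \<Longrightarrow> 0 \<le> \<phi> x y \<and> \<phi> x y \<le> 1"
    and x: "x \<in> S"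
  shows "grad_mod S e (\<lambda>x. \<integral>y. \<phi> x y \<partial>N) x \<le> (\<integral>\<^sup>+y. grad_mod S e (\<lambda>x'. \<phi> x' y) x \<partial>N)"
proof -
  have int: "integrable N (\<phi> z)" if "z \<in> S" for z
    using phi01[OF that] lipschitz_measurable[OF phi1[OF that]]
    by (intro integrable_const_bound[of _ 1]) auto
  have le: "slope k S e (\<lambda>x. \<integral>y. \<phi> x y \<partial>N) x \<le> (\<integral>\<^sup>+y. slope k S e (\<lambda>x'. \<phi> x' y) x \<partial>N)" for k
    unfolding slope_def[of k S e "\<lambda>x. \<integral>y. \<phi> x y \<partial>N"]
  proof (rule SUP_least)
    fix x' assume x': "x' \<in> {y \<in> S. 0 < e x y \<and> e x y < 1 / real (Suc k)}"
    have i: "integrable N (\<lambda>y. \<bar>\<phi> x y - \<phi> x' y\<bar> / e x x')"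
      using int[OF x] int[of x'] x' by auto
    have "\<bar>(\<integral>y. \<phi> x y \<partial>N) - (\<integral>y. \<phi> x' y \<partial>N)\<bar> = \<bar>\<integral>y. \<phi> x y - \<phi> x' y \<partial>N\<bar>"
      using int[OF x] int[of x'] x' by simp
    also have "\<dots> \<le> (\<integral>y. \<bar>\<phi> x y - \<phi> x' y\<bar> \<partial>N)" by (rule integral_abs_bound)
    finally have "\<bar>(\<integral>y. \<phi> x y \<partial>N) - (\<integral>y. \<phi> x' y \<partial>N)\<bar> / e x x' \<le> (\<integral>y. \<bar>\<phi> x y - \<phi> x' y\<bar> / e x x' \<partial>N)"
      using x' by (simp add: divide_right_mono)
    then have "ennreal (\<bar>(\<integral>y. \<phi> x y \<partial>N) - (\<integral>y. \<phi> x' y \<partial>N)\<bar> / e x x') \<le> (\<integral>\<^sup>+y. ennreal (\<bar>\<phi> x y - \<phi> x' y\<bar> / e x x') \<partial>N)"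
      using x' by (subst nn_integral_eq_integral[OF i]) (auto intro: ennreal_leI)
    also have "\<dots> \<le> (\<integral>\<^sup>+y. slope k S e (\<lambda>x'. \<phi> x' y) x \<partial>N)"
      unfolding slope_def using x' by (intro nn_integral_mono SUP_upper)
    finally show "ennreal (\<bar>(\<integral>y. \<phi> x y \<partial>N) - (\<integral>y. \<phi> x' y \<partial>N)\<bar> / e x x') \<le> (\<integral>\<^sup>+y. slope k S e (\<lambda>x'. \<phi> x' y) x \<partial>N)" .
  qed
  have fin: "(\<integral>\<^sup>+y. slope 0 S e (\<lambda>x'. \<phi> x' y) x \<partial>N) < \<infinity>"
  proof -
    have "(\<integral>\<^sup>+y. slope 0 S e (\<lambda>x'. \<phi> x' y) x \<partial>N) \<le> (\<integral>\<^sup>+y. ennreal L \<partial>N)"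
    proof (rule nn_integral_mono)
      fix y assume y: "y \<in> space N"
      show "slope 0 S e (\<lambda>x'. \<phi> x' y) x \<le> ennreal L"
        unfolding slope_def using phi2[OF y] x
        by (intro SUP_least ennreal_leI) (auto simp: lipschitz_with_def pos_divide_le_eq)
    qed
    also have "\<dots> < \<infinity>" by (simp add: emeasure_space_1)
    finally show ?thesis .
  qed
  have dec: "decseq (\<lambda>k y. slope k S e (\<lambda>x'. \<phi> x' y) x)"
  proof (intro decseq_SucI le_funI)
    fix k y
    show "slope (Suc k) S e (\<lambda>x'. \<phi> x' y) x \<le> slope k S e (\<lambda>x'. \<phi> x' y) x"
      by (rule le_funD[OF decseq_SucD[OF decseq_slope]])
  qed
  have "grad_mod S e (\<lambda>x. \<integral>y. \<phi> x y \<partial>N) x \<le> (INF k. \<integral>\<^sup>+y. slope k S e (\<lambda>x'. \<phi> x' y) x \<partial>N)"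
    unfolding grad_mod_eq_INF_slope by (intro INF_mono) (use le in auto)
  also have "\<dots> = (\<integral>\<^sup>+y. grad_mod S e (\<lambda>x'. \<phi> x' y) x \<partial>N)"
    unfolding grad_mod_eq_INF_slope
    by (rule nn_integral_monotone_convergence_INF_decseq[OF dec measurable_slope_param[OF phi1 x] fin, symmetric])
  finally show ?thesis .
qed

end

lemma lipschitz_with_imp_locally_lipschitz:
  "lipschitz_with L S d f \<Longrightarrow> locally_lipschitz S d f"
  unfolding lipschitz_with_def locally_lipschitz_def
  by (intro ballI exI[of _ 1] exI[of _ L] conjI) auto

context separable_metric_prob
begin

text \<open>
  Let \<open>g(x)\<close> be the mean of \<open>f(x, y)\<close> in \<open>y\<close>. The inequality for the first factor, applied to \<open>g\<close>, bounds
  \<open>J(E f)\<close> by \<open>E J(g) + E |grad g|\<close>; the inequality for the second factor bounds \<open>J(g(x))\<close>, and the gradient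
  of \<open>g\<close> is at most the mean of the partial gradient in \<open>x\<close>. The two partial gradients add up to the
  gradient of \<open>f\<close> by hypothesis.
\<close>

lemma functional_isoperimetry_append:
  assumes H: "hypothesis_H M" and mn: "1 \<le> m" "1 \<le> n" and J [measurable]: "J \<in> borel_measurable borel"
    and Fm: "functional_isoperimetry (power_measure m M) (sup_dist m) J"
    and Fn: "functional_isoperimetry (power_measure n M) (sup_dist n) J"
  shows "functional_isoperimetry (power_measure (m + n) M) (sup_dist (m + n)) J"
  unfolding functional_isoperimetry_def
proof (intro allI impI)
  let ?A = "power_measure m M" and ?B = "power_measure n M" and ?P = "power_measure (m + n) M"
  let ?SA = "{..<m} \<rightarrow>\<^sub>E (UNIV :: 'a set)" and ?SB = "{..<n} \<rightarrow>\<^sub>E (UNIV :: 'a set)"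
  interpret A: metric_prob_space ?A "sup_dist m" by (rule metric_prob_space_power[OF mn(1)])
  interpret B: metric_prob_space ?B "sup_dist n" by (rule metric_prob_space_power[OF mn(2)])
  interpret P: metric_prob_space ?P "sup_dist (m + n)" by (rule metric_prob_space_power) (use mn in simp)
  interpret AB: pair_prob_space ?A ?B ..
  fix f L assume f: "lipschitz_with L (space ?P) (sup_dist (m + n)) f"
    and f01: "\<forall>x\<in>space ?P. 0 \<le> f x \<and> f x \<le> 1"
  have L: "0 \<le> L" using f by (simp add: lipschitz_with_def)
  define \<phi> where "\<phi> x y = f (append_pt m n x y)" for x y
  have phi01: "0 \<le> \<phi> x y \<and> \<phi> x y \<le> 1" for x y
    using f01 append_pt_mem[of m n x y] by (simp add: \<phi>_def)
  have phi: "\<bar>\<phi> x y - \<phi> x' y'\<bar> \<le> L * max (sup_dist m x x') (sup_dist n y y')" for x y x' y'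
    using f append_pt_mem[of m n x y] append_pt_mem[of m n x' y'] sup_dist_append[OF mn, of x y x' y']
    unfolding lipschitz_with_def \<phi>_def space_power by metis
  have zero: "sup_dist m x x \<le> 0" "sup_dist n y y \<le> 0" for x y :: "nat \<Rightarrow> 'a"
    using mn by (simp_all add: sup_dist_le_iff)
  have phi1: "lipschitz_with L (space ?B) (sup_dist n) (\<phi> x)" for x
    unfolding lipschitz_with_def
  proof (intro conjI ballI L)
    fix y y' :: "nat \<Rightarrow> 'a"
    have "max (sup_dist m x x) (sup_dist n y y') = sup_dist n y y'"
      using zero(1)[of x] B.metric.nonneg[of y y'] by linarith
    then show "\<bar>\<phi> x y - \<phi> x y'\<bar> \<le> L * sup_dist n y y'" using phi[of x y x y'] by simp
  qed
  have phi2: "lipschitz_with L (space ?A) (sup_dist m) (\<lambda>x. \<phi> x y)" for y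
    unfolding lipschitz_with_def
  proof (intro conjI ballI L)
    fix x x' :: "nat \<Rightarrow> 'a"
    have "max (sup_dist m x x') (sup_dist n y y) = sup_dist m x x'"
      using zero(2)[of y] A.metric.nonneg[of x x'] by linarith
    then show "\<bar>\<phi> x y - \<phi> x' y\<bar> \<le> L * sup_dist m x x'" using phi[of x y x' y] by simp
  qed
  have fm [measurable]: "f \<in> borel_measurable ?P" by (rule P.lipschitz_measurable[OF f])
  have gm [measurable]: "grad_mod (space ?P) (sup_dist (m + n)) f \<in> borel_measurable ?P"
    by (rule P.grad_mod_measurable[OF f])
  have phim [measurable]: "(\<lambda>(x, y). \<phi> x y) \<in> borel_measurable (?A \<Otimes>\<^sub>M ?B)"
    unfolding \<phi>_def using measurable_compose[OF measurable_append fm] by (simp add: split_beta)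
  have phiy [measurable]: "\<phi> x \<in> borel_measurable ?B" for x by (rule B.lipschitz_measurable[OF phi1])
  have intphi: "integrable ?B (\<phi> x)" for x
    using phi01 by (intro B.integrable_const_bound[of _ 1]) auto
  have intphi2: "integrable (?A \<Otimes>\<^sub>M ?B) (\<lambda>(x, y). \<phi> x y)"
    using phi01 by (intro AB.integrable_const_bound[of _ 1]) auto
  define g where "g x = (\<integral>y. \<phi> x y \<partial>?B)" for x
  have gl: "lipschitz_with L (space ?A) (sup_dist m) g"
    unfolding lipschitz_with_def
  proof (intro conjI ballI L)
    fix x x' assume x: "x \<in> space ?A" "x' \<in> space ?A"
    have "\<bar>g x - g x'\<bar> = \<bar>\<integral>y. \<phi> x y - \<phi> x' y \<partial>?B\<bar>" unfolding g_def using intphi by simp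
    also have "\<dots> \<le> (\<integral>y. \<bar>\<phi> x y - \<phi> x' y\<bar> \<partial>?B)" by (rule integral_abs_bound)
    also have "\<dots> \<le> (\<integral>y. L * sup_dist m x x' \<partial>?B)"
      using intphi phi2 x by (intro integral_mono) (auto simp: lipschitz_with_def)
    also have "\<dots> = L * sup_dist m x x'" using B.prob_space by simp
    finally show "\<bar>g x - g x'\<bar> \<le> L * sup_dist m x x'" .
  qed
  have [measurable]: "g \<in> borel_measurable ?A" by (rule A.lipschitz_measurable[OF gl])
  have g01: "0 \<le> g x \<and> g x \<le> 1" for x
  proof
    show "0 \<le> g x" unfolding g_def using phi01 by (intro integral_nonneg_AE) auto
    have "g x \<le> (\<integral>y. 1 \<partial>?B)" unfolding g_def using phi01 intphi by (intro integral_mono) auto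
    then show "g x \<le> 1" using B.prob_space by simp
  qed
  have int_f: "(\<integral>z. f z \<partial>?P) = (\<integral>x. g x \<partial>?A)"
  proof -
    have "(\<integral>z. f z \<partial>?P) = (\<integral>z. f (case z of (x, y) \<Rightarrow> append_pt m n x y) \<partial>(?A \<Otimes>\<^sub>M ?B))"
      by (subst distr_append[symmetric]) (simp add: integral_distr)
    also have "\<dots> = (\<integral>z. (case z of (x, y) \<Rightarrow> \<phi> x y) \<partial>(?A \<Otimes>\<^sub>M ?B))" by (simp add: \<phi>_def split_beta)
    also have "\<dots> = (\<integral>x. g x \<partial>?A)" using AB.integral_fst'[OF intphi2] by (simp add: g_def)
    finally show ?thesis .
  qed
  let ?G = "\<lambda>z. ennreal (J (f z)) + grad_mod (space ?P) (sup_dist (m + n)) f z"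
  have Gm: "?G \<in> borel_measurable ?P" by (intro borel_measurable_add gm) measurable
  define Q where "Q z \<longleftrightarrow> (\<forall>x\<in>?SA. \<forall>y\<in>?SB. z = append_pt m n x y \<longrightarrow>
       grad_mod_pow (m + n) f z = grad_mod_pow m (\<lambda>x'. \<phi> x' y) x + grad_mod_pow n (\<phi> x) y)" for z
  have "AE z in distr (?A \<Otimes>\<^sub>M ?B) ?P (\<lambda>(x, y). append_pt m n x y). Q z"
    using H mn lipschitz_with_imp_locally_lipschitz[OF f]
    unfolding distr_append hypothesis_H_def Q_def \<phi>_def[abs_def] by simp
  from AB.AE_pair[OF AE_distrD[OF measurable_append this]]
  have AE2: "AE x in ?A. AE y in ?B. Q (append_pt m n x y)" by simp
  have AE: "AE x in ?A. AE y in ?B.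
       grad_mod_pow (m + n) f (append_pt m n x y) = grad_mod_pow m (\<lambda>x'. \<phi> x' y) x + grad_mod_pow n (\<phi> x) y"
    (is "AE x in ?A. ?Q x")
  proof (rule AE_mp[OF AE2], rule AE_I2, rule impI)
    fix x assume x: "x \<in> space ?A" and AEy: "AE y in ?B. Q (append_pt m n x y)"
    show "?Q x"
    proof (rule AE_mp[OF AEy], rule AE_I2, rule impI)
      fix y assume y: "y \<in> space ?B" and q: "Q (append_pt m n x y)"
      show "grad_mod_pow (m + n) f (append_pt m n x y) = grad_mod_pow m (\<lambda>x'. \<phi> x' y) x + grad_mod_pow n (\<phi> x) y"
        using q[unfolded Q_def] x y by simp
    qed
  qed
  have "ennreal (J (\<integral>z. f z \<partial>?P)) = ennreal (J (\<integral>x. g x \<partial>?A))" unfolding int_f ..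
  also have "\<dots> \<le> (\<integral>\<^sup>+x. ennreal (J (g x)) \<partial>?A) + (\<integral>\<^sup>+x. grad_mod (space ?A) (sup_dist m) g x \<partial>?A)"
    using Fm gl g01 unfolding functional_isoperimetry_def by blast
  also have "\<dots> = (\<integral>\<^sup>+x. ennreal (J (g x)) + grad_mod (space ?A) (sup_dist m) g x \<partial>?A)"
    by (intro nn_integral_add[symmetric] A.grad_mod_measurable[OF gl]) measurable
  also have "\<dots> \<le> (\<integral>\<^sup>+x. (\<integral>\<^sup>+y. ?G (append_pt m n x y) \<partial>?B) \<partial>?A)"
  proof (rule nn_integral_mono_AE, rule AE_mp[OF AE], intro AE_I2 impI)
    fix x assume x: "x \<in> space ?A" and ae: "?Q x"
    have "ennreal (J (g x)) \<le> (\<integral>\<^sup>+y. ennreal (J (\<phi> x y)) \<partial>?B) + (\<integral>\<^sup>+y. grad_mod (space ?B) (sup_dist n) (\<phi> x) y \<partial>?B)"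
      using Fn phi1 phi01 unfolding functional_isoperimetry_def g_def by blast
    moreover have "grad_mod (space ?A) (sup_dist m) g x \<le> (\<integral>\<^sup>+y. grad_mod (space ?A) (sup_dist m) (\<lambda>x'. \<phi> x' y) x \<partial>?B)"
      unfolding g_def by (rule B.grad_mod_integral_le[where L = L]) (use phi1 phi2 phi01 x in auto)
    ultimately have "ennreal (J (g x)) + grad_mod (space ?A) (sup_dist m) g x
       \<le> ((\<integral>\<^sup>+y. ennreal (J (\<phi> x y)) \<partial>?B) + (\<integral>\<^sup>+y. grad_mod (space ?B) (sup_dist n) (\<phi> x) y \<partial>?B))
         + (\<integral>\<^sup>+y. grad_mod (space ?A) (sup_dist m) (\<lambda>x'. \<phi> x' y) x \<partial>?B)"
      by (rule add_mono)
    also have "\<dots> = (\<integral>\<^sup>+y. ennreal (J (\<phi> x y)) + grad_mod (space ?B) (sup_dist n) (\<phi> x) y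
         + grad_mod (space ?A) (sup_dist m) (\<lambda>x'. \<phi> x' y) x \<partial>?B)"
    proof -
      have 1: "(\<lambda>y. ennreal (J (\<phi> x y))) \<in> borel_measurable ?B" by measurable
      note 2 = B.grad_mod_measurable[OF phi1, of x]
      note 3 = B.measurable_grad_mod_param[OF phi1 x, where e = "sup_dist m"]
      show ?thesis
        unfolding nn_integral_add[OF borel_measurable_add[OF 1 2] 3] nn_integral_add[OF 1 2] ..
    qed
    also have "\<dots> = (\<integral>\<^sup>+y. ?G (append_pt m n x y) \<partial>?B)"
      by (rule nn_integral_cong_AE, rule AE_mp[OF ae]) (simp add: grad_mod_pow_def \<phi>_def add_ac)
    finally show "ennreal (J (g x)) + grad_mod (space ?A) (sup_dist m) g x \<le> (\<integral>\<^sup>+y. ?G (append_pt m n x y) \<partial>?B)" .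
  qed
  also have "\<dots> = (\<integral>\<^sup>+z. ?G (case z of (x, y) \<Rightarrow> append_pt m n x y) \<partial>(?A \<Otimes>\<^sub>M ?B))"
    using B.nn_integral_fst[OF measurable_compose[OF measurable_append Gm]] by simp
  also have "\<dots> = (\<integral>\<^sup>+z. ?G z \<partial>?P)"
    using nn_integral_distr[OF measurable_append[of m n], of ?G] Gm unfolding distr_append by simp
  also have "\<dots> = (\<integral>\<^sup>+z. ennreal (J (f z)) \<partial>?P) + (\<integral>\<^sup>+z. grad_mod (space ?P) (sup_dist (m + n)) f z \<partial>?P)"
    by (rule nn_integral_add[OF _ gm]) measurable
  finally show "ennreal (J (\<integral>z. f z \<partial>?P))
      \<le> (\<integral>\<^sup>+z. ennreal (J (f z)) \<partial>?P) + (\<integral>\<^sup>+z. grad_mod (space ?P) (sup_dist (m + n)) f z \<partial>?P)" .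
qed

lemma functional_isoperimetry_power:
  assumes "hypothesis_H M" "J \<in> borel_measurable borel"
    and "functional_isoperimetry (power_measure 1 M) (sup_dist 1) J" and "1 \<le> n"
  shows "functional_isoperimetry (power_measure n M) (sup_dist n) J"
  using assms(4)
proof (induction n rule: dec_induct)
  case base
  then show ?case using assms(3) by simp
next
  case (step n)
  then show ?case using functional_isoperimetry_append[of n 1 J] assms by simp
qed

end

context separable_metric_prob
begin

lemma capped_entropy_le_outer_boundary_power:
  assumes H: "hypothesis_H M" and v: "0 < v" and k: "0 \<le> k"
    and base: "\<And>p. 0 < p \<Longrightarrow> p < 1 \<Longrightarrow> ereal (k * capped_entropy v p) \<le> iso_profile M dist p"
    and n: "1 \<le> n" and A: "A \<in> borel_sets ({..<n} \<rightarrow>\<^sub>E UNIV) (sup_dist n)"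
  shows "ereal (k * capped_entropy v (measure (power_measure n M) A)) \<le> outer_boundary (power_measure n M) (sup_dist n) A"
    and "ereal (k * capped_entropy v (1 - measure (power_measure n M) A)) \<le> outer_boundary (power_measure n M) (sup_dist n) A"
proof -
  interpret X: metric_prob_space "power_measure 1 M" "sup_dist 1" by (rule metric_prob_space_power) simp
  interpret Y: metric_prob_space "power_measure n M" "sup_dist n" by (rule metric_prob_space_power[OF n])
  let ?J = "\<lambda>p. k * capped_entropy v p"
  have "functional_isoperimetry (power_measure 1 M) (sup_dist 1) ?J"
  proof (rule X.functional_isoperimetry_capped_entropy[OF v k])
    fix U assume U: "openin X.metric.mtopology U"
    have Us: "U \<subseteq> space (power_measure 1 M)" using U unfolding X.metric.openin_dist_iff by blast
    show "ereal (k * capped_entropy v (X.prob U)) \<le> outer_boundary (power_measure 1 M) (sup_dist 1) U"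
    proof (cases "X.prob U = 0 \<or> X.prob U = 1")
      case True
      then have "capped_entropy v (X.prob U) = 0" using v by auto
      then show ?thesis using X.outer_boundary_nonneg[OF Us] by (simp add: zero_ereal_def[symmetric])
    next
      case False
      then have p: "0 < X.prob U" "X.prob U < 1" using X.prob_le_1[of U] measure_nonneg[of "power_measure 1 M" U] by linarith+
      have "iso_profile M dist (X.prob U) \<le> outer_boundary (power_measure 1 M) (sup_dist 1) U"
        unfolding iso_profile_pow_1[symmetric] iso_profile_pow_def
        by (rule X.iso_profile_le_outer[OF X.open_borel_sets[OF U]])
      with base[OF p] show ?thesis by (rule order.trans)
    qed
  qed
  then have F: "functional_isoperimetry (power_measure n M) (sup_dist n) ?J"
    by (rule functional_isoperimetry_power[OF H _ _ n, rotated]) measurable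
  have c1: "continuous_on {0..1} ?J" by (intro continuous_intros continuous_on_capped_entropy v)
  have "continuous_on {0..1} (\<lambda>p::real. 1 - p)" by (intro continuous_intros)
  from continuous_on_compose2[OF c1 this] have c2: "continuous_on {0..1} (\<lambda>p. ?J (1 - p))" by auto
  have J0: "0 \<le> ?J p" if "0 \<le> p" "p \<le> 1" for p using capped_entropy_nonneg[OF v that] k by simp
  have Ae: "A \<in> Y.events" using Y.borel_sets_sets[of A] A by simp
  show "ereal (?J (Y.prob A)) \<le> outer_boundary (power_measure n M) (sup_dist n) A"
    by (rule Y.outer_boundary_of_functional_isoperimetry[OF F c1 J0 _ _ Ae]) (use v in auto)
  show "ereal (?J (1 - Y.prob A)) \<le> outer_boundary (power_measure n M) (sup_dist n) A"
    by (rule Y.outer_boundary_of_functional_isoperimetry[OF Y.functional_isoperimetry_reflect[OF F] c2 J0 _ _ Ae]) (use v in auto)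
qed

text \<open>
  The parameter \<open>v = min t (1 - t)\<close> is adapted to \<open>t\<close>: the scaling \<open>k\<close> is the largest that
  \<open>scaled_capped_entropy_le\<close> allows, up to constants, and at \<open>v\<close> the scaled capped entropy is comparable to
  the profile.
\<close>

lemma dimension_free_of_ess_nondecreasing:
  assumes R: "hypothesis_R M" and H: "hypothesis_H M"
    and C: "ess_nondecreasing_on {0<..<1} D (\<lambda>t. real_of_ereal (iso_profile M dist t) / (t * ln (1 / t)))"
    and t: "0 < t" "t < 1"
  shows "ereal (1 / (8 * D)) * iso_profile M dist t \<le> iso_profile_inf M t"
proof -
  interpret B: metric_prob_space M dist by (rule metric_prob_space_base)
  define i where "i t = real_of_ereal (iso_profile M dist t)" for t
  have iI: "ereal (i s) = iso_profile M dist s" if s: "0 < s" "s < 1" for s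
  proof -
    have "iso_profile M dist s < \<infinity>" using R s unfolding hypothesis_R_def by simp
    then show ?thesis unfolding i_def using B.iso_profile_nonneg[of s] by (intro ereal_real') auto
  qed
  have i0: "0 \<le> i s" for s unfolding i_def using B.iso_profile_nonneg[of s] by (rule real_of_ereal_pos)
  have isym: "i (1 - s) = i s" for s unfolding i_def B.iso_profile_sym ..
  obtain g a where g: "mono_on {0<..<1} g" and D: "1 \<le> D" and a: "0 < a"
    "\<And>x. x \<in> {0<..<1} \<Longrightarrow> a * g x \<le> i x / (x * ln (1 / x))"
    "\<And>x. x \<in> {0<..<1} \<Longrightarrow> i x / (x * ln (1 / x)) \<le> D * a * g x"
    using C unfolding ess_nondecreasing_on_def approx_const_def i_def by blast
  have ratio: "i s / (s * ln (1 / s)) \<le> D * (i u / (u * ln (1 / u)))" if "0 < s" "s \<le> u" "u < 1" for s u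
  proof -
    have su: "s \<in> {0<..<1}" "u \<in> {0<..<1}" using that by auto
    have "i s / (s * ln (1 / s)) \<le> D * a * g s" by (rule a(3)[OF su(1)])
    also have "\<dots> \<le> D * a * g u" using mono_onD[OF g su that(2)] D a(1) by (intro mult_left_mono) auto
    also have "\<dots> = D * (a * g u)" by simp
    also have "\<dots> \<le> D * (i u / (u * ln (1 / u)))" using a(2)[OF su(2)] D by (intro mult_left_mono) auto
    finally show ?thesis .
  qed
  define v where "v = min t (1 - t)"
  have v: "0 < v" "v \<le> 1/2" "v < 1" using t unfolding v_def by linarith+
  have iv: "i v = i t" using isym[of t] by (auto simp: v_def min_def)
  define k where "k = i v / (v * ln (1 / v)) / (4 * D)"
  have k: "0 \<le> k" unfolding k_def using i0[of v] v D by (intro divide_nonneg_nonneg mult_nonneg_nonneg) auto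
  have base: "ereal (k * capped_entropy v p) \<le> iso_profile M dist p" if p: "0 < p" "p < 1" for p
    unfolding iI[OF p, symmetric] k_def ereal_less_eq
    by (rule scaled_capped_entropy_le[OF D i0 isym ratio v(1,2) p])
  have lv: "0 < v * ln (1 / v)" using v by simp
  have kv: "1 / (8 * D) * i t \<le> k * capped_entropy v v"
  proof -
    have "1 / (8 * D) * i t = k * (v * ln (1 / v) / 2)" 
    proof -
      have *: "1 / (8 * D) * x = x / w / (4 * D) * (w / 2)" if "w \<noteq> 0" for x w :: real
        using that by simp
      show ?thesis unfolding k_def iv[symmetric] by (rule *[OF less_imp_neq[OF lv, symmetric]])
    qed
    also have "\<dots> \<le> k * capped_entropy v v"
      using half_entropy_le_capped_entropy[of v] v k by (intro mult_left_mono) auto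
    finally show ?thesis .
  qed
  show ?thesis unfolding iso_profile_inf_def
  proof (rule INF_greatest)
    fix n :: nat assume "n \<in> {1..}"
    then have n: "1 \<le> n" by simp
    interpret Y: metric_prob_space "power_measure n M" "sup_dist n" by (rule metric_prob_space_power[OF n])
    have outer: "ereal (k * capped_entropy v v) \<le> outer_boundary (power_measure n M) (sup_dist n) A"
      if A: "A \<in> borel_sets ({..<n} \<rightarrow>\<^sub>E UNIV) (sup_dist n)" "Y.prob A = t \<or> Y.prob A = 1 - t" for A
      using capped_entropy_le_outer_boundary_power[OF H v(1) k base n A(1)] A(2)
      unfolding v_def min_def by (auto split: if_splits)
    have "ereal (1 / (8 * D)) * iso_profile M dist t = ereal (1 / (8 * D) * i t)"
      unfolding iI[OF t, symmetric] by simp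
    also have "\<dots> \<le> ereal (k * capped_entropy v v)" using kv by simp
    also have "\<dots> \<le> iso_profile_pow n M t"
      unfolding iso_profile_pow_def iso_profile_def inner_boundary_def
    proof (rule INF_greatest)
      fix A assume A: "A \<in> {A \<in> borel_sets (space (power_measure n M)) (sup_dist n). Y.prob A = t}"
      then have A1: "A \<in> borel_sets ({..<n} \<rightarrow>\<^sub>E UNIV) (sup_dist n)" "Y.prob A = t" by auto
      have "space (power_measure n M) - A \<in> borel_sets ({..<n} \<rightarrow>\<^sub>E UNIV) (sup_dist n)"
        using Y.borel_sets_compl[of A] A by simp
      moreover have "Y.prob (space (power_measure n M) - A) = 1 - t"
        using Y.prob_compl[of A] Y.borel_sets_sets[of A] A by simp
      ultimately show "ereal (k * capped_entropy v v) \<le> min (outer_boundary (power_measure n M) (sup_dist n) A)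
          (outer_boundary (power_measure n M) (sup_dist n) (space (power_measure n M) - A))"
        using outer[of A] outer[of "space (power_measure n M) - A"] A1 by simp
    qed
    finally show "ereal (1 / (8 * D)) * iso_profile M dist t \<le> iso_profile_pow n M t" .
  qed
qed

end

section \<open>Bounded symmetric product-subadditive functions\<close>

text \<open>
  The interval from \<open>L / b\<close> to \<open>L / a\<close> has length at least \<open>1\<close>, hence contains an integer \<open>k\<close>.
\<close>

lemma ex_quotient_in_interval:
  fixes L a b :: real
  assumes "0 < a" "a < b" "0 < L" "a * b \<le> L * (b - a)"
  obtains k :: nat where "1 \<le> k" "a \<le> L / k" "L / k \<le> b"
proof -
  define k where "k = nat \<lceil>L / b\<rceil>"
  have pos: "0 < L / b" using assms by simp
  have k1: "1 \<le> k" unfolding k_def using pos by linarith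
  have lo: "L / b \<le> k" unfolding k_def using pos by linarith
  have hi: "k < L / b + 1" unfolding k_def using pos by linarith
  have "L / b + 1 \<le> L / a"
    using assms by (simp add: field_simps)
  with hi have "real k \<le> L / a" by linarith
  with lo k1 assms show thesis
    by (intro that[of k]) (auto simp: field_simps)
qed

lemma mult_ln_inverse_le: 
  fixes x :: real assumes "0 < x" shows "x * ln (1 / x) \<le> 1 - x"
proof -
  have "ln (1 / x) \<le> 1 / x - 1" using assms by (intro ln_le_minus_one) auto
  then have "x * ln (1 / x) \<le> x * (1 / x - 1)" using assms by (intro mult_left_mono) auto
  then show ?thesis using assms by (simp add: algebra_simps)
qed

lemma geometric_bracket:
  fixes t s :: real
  assumes "0 < t" "t < 1" "0 < s" "s \<le> 1"
  obtains m :: nat where "s \<le> t ^ m" "t ^ Suc m < s"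
proof -
  obtain n where n: "t ^ n < s" using real_arch_pow_inv[OF assms(3,2)] by auto
  define l where "l = (LEAST n. t ^ n < s)"
  have l: "t ^ l < s" unfolding l_def by (rule LeastI) (rule n)
  obtain m where m: "l = Suc m" using l assms by (cases l) auto
  have "\<not> t ^ m < s" using not_less_Least[of m "\<lambda>n. t ^ n < s"] m by (simp add: l_def)
  with l m show thesis by (intro that[of m]) auto
qed

text \<open>
  The name recalls that \<open>\<bar>\<delta>\<bar>\<close> is of this kind for every derivation \<open>\<delta>\<close> of the field of real numbers.
\<close>

locale product_subderivation =
  fixes F :: "real \<Rightarrow> real"
  assumes nonneg: "\<And>t. 0 < t \<Longrightarrow> t < 1 \<Longrightarrow> 0 \<le> F t"
    and sym: "\<And>t. 0 < t \<Longrightarrow> t < 1 \<Longrightarrow> F (1 - t) = F t"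
    and prod: "\<And>a b. 0 < a \<Longrightarrow> a < 1 \<Longrightarrow> 0 < b \<Longrightarrow> b < 1 \<Longrightarrow> F (a * b) \<le> a * F b + b * F a"
begin

lemma power_mult_le:
  assumes "0 < t" "t < 1" "0 < r" "r < 1"
  shows "F (t ^ k * r) \<le> t ^ k * F r + r * (real k * t ^ (k - 1) * F t)"
proof (induction k)
  case 0 then show ?case by simp
next
  case (Suc k)
  have 1: "0 < t ^ k * r" using assms by simp
  have 2: "t ^ k * r < 1"
    using mult_right_mono[of "t ^ k" 1 r] power_le_one[of t k] assms by linarith
  have "F (t ^ Suc k * r) = F (t * (t ^ k * r))" by (simp add: mult_ac)
  also have "\<dots> \<le> t * F (t ^ k * r) + (t ^ k * r) * F t"
    using prod[of t "t^k * r"] assms 1 2 by simp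
  also have "\<dots> \<le> t * (t ^ k * F r + r * (real k * t ^ (k - 1) * F t)) + (t ^ k * r) * F t"
    using Suc.IH assms by (intro add_right_mono mult_left_mono) auto
  also have "\<dots> = t ^ Suc k * F r + r * (real (Suc k) * t ^ (Suc k - 1) * F t)"
    by (cases k) (simp_all add: algebra_simps)
  finally show ?case .
qed

lemma power_le:
  assumes "0 < t" "t < 1" "1 \<le> k"
  shows "F (t ^ k) \<le> real k * t ^ (k - 1) * F t"
proof -
  obtain j where k: "k = Suc j" using assms by (cases k) auto
  have "F (t ^ j * t) \<le> t ^ j * F t + t * (real j * t ^ (j - 1) * F t)"
    using power_mult_le[of t t j] assms by simp
  also have "\<dots> = real k * t ^ (k - 1) * F t"
    unfolding k by (cases j) (simp_all add: algebra_simps)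
  finally show ?thesis unfolding k by (simp add: mult.commute)
qed

text \<open>
  Powers of \<open>[\<alpha>, \<beta>]\<close> cover a neighbourhood of \<open>0\<close>, and there \<open>F(x^k) \<le> k x^(k-1) F(x)\<close> stays bounded
  in \<open>k\<close>. Symmetry carries the bound to a neighbourhood of \<open>1\<close>, and one fixed power maps that
  neighbourhood over the middle part of \<open>(0,1)\<close>.
\<close>

lemma bounded_of_bounded_on_interval:
  assumes "0 < \<alpha>" "\<alpha> < \<beta>" "\<beta> < 1" and M: "\<And>t. \<alpha> \<le> t \<Longrightarrow> t \<le> \<beta> \<Longrightarrow> F t \<le> M"
  obtains B where "\<And>t. 0 < t \<Longrightarrow> t < 1 \<Longrightarrow> F t \<le> B"
proof -
  have M0: "0 \<le> M" using M[of \<alpha>] nonneg[of \<alpha>] assms(1-3) by linarith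
  define a where "a = - ln \<beta>"
  define b where "b = - ln \<alpha>"
  have ab: "0 < a" "a < b" using assms by (auto simp: a_def b_def)
  have \<beta>a: "\<beta> = exp (- a)" "\<alpha> = exp (- b)" using assms by (auto simp: a_def b_def)
  \<comment> \<open>The multiples \<open>[k a, k b]\<close> cover the half-line from \<open>L0\<close> on, so every \<open>s \<le> exp (- L0)\<close>
    is the \<open>k\<close>-th power of a point of \<open>[\<alpha>, \<beta>]\<close> for some \<open>k\<close>.\<close>
  define L0 where "L0 = max 1 (a * b / (b - a))"
  define \<eta> where "\<eta> = min (1/2) (exp (- L0))"
  have \<eta>: "0 < \<eta>" "\<eta> \<le> 1/2" by (auto simp: \<eta>_def)
  have "(\<lambda>k. real k * \<beta> ^ k) \<longlonglongrightarrow> 0"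
    using powser_times_n_limit_0[of \<beta>] assms by simp
  then have "Bseq (\<lambda>k. real k * \<beta> ^ k)" using convergentI convergent_imp_Bseq by blast
  then obtain S where S: "0 < S" "\<And>k. norm (real k * \<beta> ^ k) \<le> S" unfolding Bseq_def by blast
  define M2 where "M2 = S / \<beta> * M"
  have M2: "0 \<le> M2" using S M0 assms by (simp add: M2_def)
  have small: "F s \<le> M2" if s: "0 < s" "s \<le> \<eta>" for s
  proof -
    define L where "L = - ln s"
    have s1: "s < 1" using s \<eta> by simp
    have "ln s \<le> ln (exp (- L0))" using s by (subst ln_le_cancel_iff) (auto simp: \<eta>_def)
    then have "L0 \<le> L" by (simp add: L_def)
    then have L: "0 < L" "a * b / (b - a) \<le> L" by (auto simp: L0_def)
    then have "a * b \<le> L * (b - a)" using ab by (simp add: field_simps)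
    from ex_quotient_in_interval[OF ab \<open>0 < L\<close> this]
    obtain k :: nat where k: "1 \<le> k" "a \<le> L / k" "L / k \<le> b" by blast
    define x where "x = exp (- (L / k))"
    have x: "\<alpha> \<le> x" "x \<le> \<beta>" using k by (auto simp: x_def \<beta>a)
    have "x ^ k = exp (- L)" using k by (simp add: x_def flip: exp_of_nat_mult)
    then have xs: "x ^ k = s" using s by (simp add: L_def)
    have "F s \<le> real k * x ^ (k - 1) * F x"
      using power_le[of x k] x k assms xs by simp
    also have "\<dots> \<le> real k * \<beta> ^ (k - 1) * M"
      using x assms M[of x] M0 nonneg[of x] by (intro mult_mono power_mono) auto
    also have "\<dots> = (real k * \<beta> ^ k) / \<beta> * M"
      using k assms by (cases k) auto
    also have "\<dots> \<le> M2"
      unfolding M2_def using S(2)[of k] assms M0 by (intro mult_right_mono divide_right_mono) auto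
    finally show ?thesis .
  qed
  have large: "F s \<le> M2" if s: "1 - \<eta> \<le> s" "s < 1" for s
    using small[of "1 - s"] sym[of s] s \<eta> by simp
  obtain k :: nat where k: "(1 - \<eta>) ^ k < \<eta>" using real_arch_pow_inv[of \<eta> "1 - \<eta>"] \<eta> by auto
  have k1: "1 \<le> k" using k \<eta> by (cases k) auto
  have mid: "F s \<le> real k * M2" if s: "\<eta> \<le> s" "s < 1" for s
  proof -
    define u where "u = root k s"
    have u: "0 < u" "u < 1" "u ^ k = s" using k1 s \<eta> by (auto simp: u_def)
    have "1 - \<eta> \<le> u"
    proof (rule ccontr)
      assume "\<not> 1 - \<eta> \<le> u"
      then have "u ^ k \<le> (1 - \<eta>) ^ k" using u by (intro power_mono) auto
      with k s u show False by simp
    qed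
    then have *: "F u \<le> M2" using large u by simp
    have "F s \<le> real k * u ^ (k - 1) * F u" using power_le[of u k] u k1 by simp
    also have "\<dots> \<le> real k * 1 * M2"
      using u * nonneg[of u] by (intro mult_mono power_le_one) auto
    finally show ?thesis by simp
  qed
  show thesis
  proof (rule that[of "max M2 (real k * M2)"])
    fix t :: real assume "0 < t" "t < 1"
    then show "F t \<le> max M2 (real k * M2)" using small[of t] mid[of t] by linarith
  qed
qed

end

locale bounded_product_subderivation = product_subderivation +
  assumes bounded: "\<exists>B. \<forall>t. 0 < t \<longrightarrow> t < 1 \<longrightarrow> F t \<le> B"
begin

text \<open>
  The product inequality for complements: \<open>t + (1 - t) x\<close> is the probability of a union of independent
  events of probabilities \<open>t\<close> and \<open>x\<close>.
\<close>

lemma complement_prod: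
  assumes "0 < t" "t < 1" "0 < x" "x < 1"
  shows "F (t + (1 - t) * x) \<le> (1 - t) * F x + (1 - x) * F t"
proof -
  have *: "1 - (t + (1 - t) * x) = (1 - t) * (1 - x)" by (simp add: algebra_simps)
  have p: "0 < (1 - t) * (1 - x)" using assms by simp
  have q: "(1 - t) * (1 - x) < 1" 
    using assms mult_pos_pos[of "1 - t" x] unfolding * [symmetric] by linarith
  have "F (t + (1 - t) * x) = F ((1 - t) * (1 - x))"
    using sym[of "t + (1 - t) * x"] p q unfolding * [symmetric] by simp
  also have "\<dots> \<le> (1 - t) * F (1 - x) + (1 - x) * F (1 - t)"
    using assms by (intro prod) auto
  also have "\<dots> = (1 - t) * F x + (1 - x) * F t" using sym[of x] sym[of t] assms by simp
  finally show ?thesis .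
qed

text \<open>
  The maps \<open>x \<mapsto> t x\<close> and \<open>x \<mapsto> t + (1 - t) x\<close> contract and together cover \<open>(0,1)\<close> except for \<open>t\<close>. Hence the
  supremum \<open>V\<close> of \<open>F\<close> satisfies \<open>V \<le> max t (1 - t) V + F(t)\<close>, which can be solved for \<open>V\<close> because \<open>V\<close> is finite.
\<close>

lemma le_div_min:
  assumes t: "0 < t" "t < 1" and s: "0 < s" "s < 1"
  shows "F s \<le> F t / min t (1 - t)"
proof -
  define V where "V = F ` {0<..<1}"
  obtain B where "\<And>x. 0 < x \<Longrightarrow> x < 1 \<Longrightarrow> F x \<le> B" using bounded by blast
  then have bdd: "bdd_above V" unfolding V_def by (intro bdd_aboveI2[of _ _ B]) simp
  have le: "F x \<le> Sup V" if "0 < x" "x < 1" for x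
    using that by (intro cSup_upper[OF _ bdd]) (auto simp: V_def)
  have V0: "0 \<le> Sup V" using le[OF t] nonneg[OF t] by simp
  define m where "m = max t (1 - t)"
  have step: "F x \<le> m * Sup V + F t" if x: "0 < x" "x < 1" for x
  proof (cases x t rule: linorder_cases)
    case less
    have y: "0 < x / t" "x / t < 1" using less x t by auto
    have "F (t * (x / t)) \<le> t * F (x / t) + (x / t) * F t" by (rule prod) (use t y in auto)
    also have "\<dots> \<le> m * Sup V + 1 * F t"
      using le[OF y] y t nonneg[OF y] nonneg[OF t] by (intro add_mono mult_mono) (auto simp: m_def)
    finally show ?thesis using t by simp
  next
    case equal
    then show ?thesis using V0 t by (simp add: m_def)
  next
    case greater
    define y where "y = (x - t) / (1 - t)"
    have y: "0 < y" "y < 1" using greater x t by (auto simp: y_def)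
    have "F (t + (1 - t) * y) \<le> (1 - t) * F y + (1 - y) * F t" by (rule complement_prod) (use t y in auto)
    also have "\<dots> \<le> m * Sup V + 1 * F t"
      using le[OF y] y t nonneg[OF y] nonneg[OF t] by (intro add_mono mult_mono) (auto simp: m_def)
    finally show ?thesis using t by (simp add: y_def)
  qed
  have "Sup V \<le> m * Sup V + F t"
    using step t by (intro cSup_least) (auto simp: V_def)
  moreover have m: "min t (1 - t) = 1 - m" by (simp add: m_def)
  ultimately have "Sup V * min t (1 - t) \<le> F t" unfolding m by (simp add: algebra_simps)
  then have "Sup V \<le> F t / min t (1 - t)" using t by (simp add: pos_le_divide_eq)
  with le[OF s] show ?thesis by simp
qed

lemma le_of_less_small:
  assumes t: "0 < t" "t \<le> 1/2" and y: "0 < y" "y < t"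
  shows "F y \<le> 2 * F t"
proof -
  have q: "0 < y / t" "y / t < 1" using t y by auto
  have "F (t * (y / t)) \<le> t * F (y / t) + (y / t) * F t" by (rule prod) (use t q in auto)
  also have "\<dots> \<le> t * (F t / t) + 1 * F t"
    using le_div_min[of t "y / t"] t q nonneg[of t] nonneg[of "y / t"] by (intro add_mono mult_mono) (auto simp: min_def)
  finally show ?thesis using t by simp
qed

text \<open>
  Write \<open>1 - r = (1 - t)^l z\<close> with \<open>1 - t < z\<close>. Then \<open>F(t)\<close> enters with weight \<open>l (1 - r) / (1 - t)\<close>, and
  \<open>l t \<le> ln(1 / (1 - r))\<close> makes this at most \<open>2 r / t\<close>; the remainder \<open>1 - z < t\<close> costs \<open>2 F(t)\<close> at most.
\<close>

lemma le_of_greater_small: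
  assumes t: "0 < t" "t \<le> 1/2" and r: "t < r" "r < 1"
  shows "F r \<le> 4 * (r / t) * F t"
proof -
  obtain l where l: "1 - r \<le> (1 - t) ^ l" "(1 - t) ^ Suc l < 1 - r"
    using geometric_bracket[of "1 - t" "1 - r"] t r by auto
  have l1: "1 \<le> l" using l r by (cases l) auto
  define z where "z = (1 - r) / (1 - t) ^ l"
  have pw: "0 < (1 - t) ^ l" using t by simp
  have "(1 - t) * (1 - t) ^ l < 1 - r" using l(2) by simp
  then have z: "1 - t < z" "z \<le> 1"
    unfolding z_def using l(1) pw by (simp_all only: pos_less_divide_eq pos_divide_le_eq mult_1)
  have zr: "(1 - t) ^ l * z = 1 - r" using t by (simp add: z_def)
  have "real l * ln (1 - t) = ln ((1 - t) ^ l)" using t by (simp add: ln_realpow)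
  also have "\<dots> \<ge> ln (1 - r)" using l r t by (subst ln_le_cancel_iff) auto
  finally have "real l * (- ln (1 - t)) \<le> ln (1 / (1 - r))" using r t by (simp add: ln_div)
  moreover have "t \<le> - ln (1 - t)" using ln_le_minus_one[of "1 - t"] t by simp
  then have "real l * t \<le> real l * (- ln (1 - t))" by (intro mult_left_mono) auto
  ultimately have "real l * t \<le> ln (1 / (1 - r))" by simp
  then have "(1 - r) * (real l * t) \<le> (1 - r) * ln (1 / (1 - r))" using r by (intro mult_left_mono) auto
  also have "\<dots> \<le> r" using mult_ln_inverse_le[of "1 - r"] r by simp
  finally have lr: "(1 - r) * real l \<le> r / t" using t by (simp add: field_simps)
  have c: "z * (real l * (1 - t) ^ (l - 1)) \<le> 2 * (r / t)"
  proof -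
    have "z * (real l * (1 - t) ^ (l - 1)) = ((1 - r) * real l) / (1 - t)"
    proof -
      obtain j where j: "l = Suc j" using l1 by (cases l) auto
      then have "(1 - r) = (1 - t) * ((1 - t) ^ j * z)" using zr by simp
      then show ?thesis using t j by simp
    qed
    also have "\<dots> \<le> ((1 - r) * real l) / (1 / 2)" using t r by (intro divide_left_mono) auto
    also have "\<dots> \<le> 2 * (r / t)" using lr by simp
    finally show ?thesis .
  qed
  have rt: "1 \<le> r / t" using r t by simp
  have Ft: "0 \<le> F t" using nonneg t by auto
  have "F r = F (1 - r)" using sym[of r] r t by simp
  also have "\<dots> \<le> 2 * F t + 2 * (r / t) * F t"
  proof (cases "z = 1")
    case True
    then have "F (1 - r) \<le> real l * (1 - t) ^ (l - 1) * F (1 - t)"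
      using power_le[of "1 - t" l] t l1 zr by simp
    also have "\<dots> \<le> (2 * (r / t)) * F t"
      using c True sym[of t] t Ft by (simp add: mult_right_mono del: times_divide_eq_left times_divide_eq_right)
    finally show ?thesis using Ft by simp
  next
    case False
    have z1: "0 < z" "z < 1" using z False t by auto
    have "F (1 - r) \<le> (1 - t) ^ l * F z + z * (real l * (1 - t) ^ (l - 1) * F (1 - t))"
      using power_mult_le[of "1 - t" z l] t z1 zr by simp
    also have "\<dots> \<le> 1 * (2 * F t) + (2 * (r / t)) * F t"
    proof (intro add_mono)
      have "F z = F (1 - z)" using sym[of z] z1 by simp
      also have "\<dots> \<le> 2 * F t" using le_of_less_small[of t "1 - z"] t z z1 by simp
      finally show "(1 - t) ^ l * F z \<le> 1 * (2 * F t)"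
        using t nonneg[of z] z1 by (intro mult_mono power_le_one) auto
      show "z * (real l * (1 - t) ^ (l - 1) * F (1 - t)) \<le> 2 * (r / t) * F t"
        using mult_right_mono[OF c Ft] sym[of t] t by (simp add: mult_ac)
    qed
    finally show ?thesis by simp
  qed
  also have "\<dots> \<le> 2 * (r / t) * F t + 2 * (r / t) * F t"
    using mult_right_mono[OF rt Ft] by (simp only: mult.assoc mult_1 add_le_cancel_right mult_le_cancel_left_pos zero_less_numeral)
  finally show ?thesis by simp
qed

lemma le_of_greater:
  assumes t: "0 < t" and r: "t < r" "r < 1"
  shows "F r \<le> 4 * (r / t) * F t"
proof (cases "t \<le> 1/2")
  case True then show ?thesis using le_of_greater_small assms by simp
next
  case False
  define y where "y = (r - t) / (1 - t)"
  have y: "0 < y" "y < 1" using r t by (auto simp: y_def)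
  have Ft: "0 \<le> F t" using nonneg[of t] assms by simp
  have "F (t + (1 - t) * y) \<le> (1 - t) * F y + (1 - y) * F t" by (rule complement_prod) (use t r y in auto)
  also have "\<dots> \<le> (1 - t) * (F t / (1 - t)) + 1 * F t"
    using le_div_min[of t y] nonneg[of y] False y t r Ft by (intro add_mono mult_mono) (auto simp: min_def)
  also have "\<dots> = 2 * F t" using r t by simp
  also have "\<dots> \<le> 4 * (r / t) * F t" using r t Ft by (intro mult_right_mono) (auto simp: field_simps)
  finally show ?thesis using r t by (simp add: y_def)
qed

text \<open>
  For \<open>s = t^m\<close> the product inequality gives the constant \<open>1\<close>. In general \<open>s = t^m r\<close> with \<open>t < r \<le> 1\<close>, and
  \<open>le_of_greater\<close> bounds the contribution of \<open>r\<close> by \<open>4\<close> times that of one power of \<open>t\<close>.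
\<close>

proposition entropy_ratio_le:
  assumes s: "0 < s" "s \<le> t" and t: "t < 1"
  shows "F s / (s * ln (1 / s)) \<le> 5 * (F t / (t * ln (1 / t)))"
proof -
  have t0: "0 < t" using s by simp
  have Ft: "0 \<le> F t" using nonneg t t0 by auto
  obtain m where m: "s \<le> t ^ m" "t ^ Suc m < s"
    using geometric_bracket[of t s] t t0 s by auto
  have m1: "1 \<le> m" using m s by (cases m) auto
  define r where "r = s / t ^ m"
  have r: "t < r" "r \<le> 1" "t ^ m * r = s" using m t0 by (auto simp: r_def field_simps)
  have st: "s / t = r * t ^ (m - 1)" using r t0 m1 by (cases m) auto
  have main: "F s \<le> 5 * (real m * (s / t) * F t)"
  proof (cases "r = 1")
    case True
    then have "F s \<le> real m * (s / t) * F t" using power_le[of t m] t t0 m1 r st by simp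
    moreover have "0 \<le> real m * (s / t) * F t" using s t0 Ft by auto
    moreover have "A \<le> 5 * A" if "0 \<le> A" for A :: real using that by simp
    ultimately show ?thesis by (meson order.trans)
  next
    case False
    then have r1: "r < 1" using r by simp
    have "F s \<le> t ^ m * F r + r * (real m * t ^ (m - 1) * F t)"
      using power_mult_le[of t r m] t0 t r r1 by simp
    also have "r * (real m * t ^ (m - 1) * F t) = real m * (s / t) * F t" by (simp add: st)
    also have "t ^ m * F r \<le> t ^ m * (4 * (r / t) * F t)"
      using le_of_greater[of t r] t0 r r1 by (intro mult_left_mono) auto
    also have "\<dots> = 4 * (1 * (s / t) * F t)" using r t0 by (simp flip: r(3))
    also have "\<dots> \<le> 4 * (real m * (s / t) * F t)"
      using m1 s t0 Ft by (intro mult_left_mono mult_right_mono) auto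
    finally show ?thesis by (simp add: mult_ac)
  qed
  have lt: "0 < ln (1 / t)" using t t0 by simp
  have ls: "0 < ln (1 / s)" using s t by simp
  have "ln s \<le> ln (t ^ m)" using m s t0 by (subst ln_le_cancel_iff) auto
  then have "real m * ln (1 / t) \<le> ln (1 / s)" using s t0 by (simp add: ln_realpow ln_div)
  then have mm: "real m \<le> ln (1 / s) / ln (1 / t)" using lt by (simp add: pos_le_divide_eq)
  have "real m * (s / t) * F t \<le> ln (1 / s) / ln (1 / t) * (s / t) * F t"
    using s t0 by (intro mult_right_mono mm Ft) auto
  with main have "F s \<le> 5 * (ln (1 / s) / ln (1 / t) * (s / t) * F t)"
    by (rule order.trans[OF _ mult_left_mono]) simp
  also have "\<dots> = 5 * (F t / (t * ln (1 / t))) * (s * ln (1 / s))" by (simp add: mult_ac)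
  finally show ?thesis using ls s by (subst pos_divide_le_eq) auto
qed

end

section \<open>Boundedness of the infinite dimensional profile\<close>

text \<open>
  Diagonal extraction on a countable dense set; equicontinuity extends convergence to all points.
\<close>

lemma pointwise_convergent_subsequence_lipschitz:
  fixes f :: "nat \<Rightarrow> 'a::{metric_space, second_countable_topology} \<Rightarrow> real"
  assumes bnd: "\<And>i x. \<bar>f i x\<bar> \<le> 1" and lip: "\<And>i x y. \<bar>f i x - f i y\<bar> \<le> dist x y"
  obtains k u where "strict_mono (k :: nat \<Rightarrow> nat)" "\<And>x. (\<lambda>i. f (k i) x) \<longlonglongrightarrow> u x"
proof -
  obtain D :: "'a set" where D: "countable D" "\<And>X. open X \<Longrightarrow> X \<noteq> {} \<Longrightarrow> \<exists>q\<in>D. q \<in> X"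
    by (rule countable_dense_setE) blast
  obtain k where k: "strict_mono (k :: nat \<Rightarrow> nat)" "\<And>x. x \<in> D \<Longrightarrow> \<exists>l. (\<lambda>i. f (k i) x) \<longlonglongrightarrow> l"
    using function_convergent_subsequence[OF D(1), of f 1] bnd by auto
  have "convergent (\<lambda>i. f (k i) x)" for x
  proof (rule Cauchy_convergent, rule metric_CauchyI)
    fix e :: real assume e: "0 < e"
    obtain q where q: "q \<in> D" "dist x q < e / 3"
      using D(2)[of "ball x (e / 3)"] e by auto
    have "Cauchy (\<lambda>i. f (k i) q)" using k(2)[OF q(1)] by (intro convergent_Cauchy) (auto simp: convergent_def)
    then obtain n where n: "\<And>i j. n \<le> i \<Longrightarrow> n \<le> j \<Longrightarrow> dist (f (k i) q) (f (k j) q) < e / 3"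
      using metric_CauchyD[of _ "e / 3"] e by (metis divide_pos_pos zero_less_numeral)
    show "\<exists>n. \<forall>i\<ge>n. \<forall>j\<ge>n. dist (f (k i) x) (f (k j) x) < e"
    proof (intro exI[of _ n] allI impI)
      fix i j assume ij: "n \<le> i" "n \<le> j"
      show "dist (f (k i) x) (f (k j) x) < e"
        using n[OF ij] lip[of "k i" x q] lip[of "k j" x q] q(2) unfolding dist_real_def by linarith
    qed
  qed
  then have "\<And>x. (\<lambda>i. f (k i) x) \<longlonglongrightarrow> lim (\<lambda>i. f (k i) x)" by (simp add: convergent_LIMSEQ_iff)
  with k(1) show thesis by (rule that)
qed

context separable_metric_prob
begin

text \<open>
  One parameter bounds both the content and, through its inverse, the range of scales, so that these sets
  increase with \<open>n\<close> and each of them is closed.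
\<close>

definition measures_with_controlled_content :: "nat \<Rightarrow> real set" where
  "measures_with_controlled_content n = {p. \<exists>A\<in>events. prob A = p \<and>
     (\<forall>h. 0 < h \<longrightarrow> h < 1 / Suc n \<longrightarrow> prob (enlargement UNIV dist A h) \<le> p + real n * h)}"

text \<open>
  Let \<open>p i\<close> converge to \<open>l\<close>, with sets \<open>A i\<close>. Along a subsequence the truncated distances to \<open>A i\<close> converge
  pointwise to some \<open>u\<close>, which need not be the distance to a set. Still \<open>{u < h}\<close> has measure at most
  \<open>l + n h\<close>, and \<open>C = {u \<le> 0}\<close> contains the points lying in infinitely many \<open>A i\<close>, so \<open>C\<close> has measure
  exactly \<open>l\<close>. As \<open>u\<close> is 1-Lipschitz, the \<open>h\<close>-enlargement of \<open>C\<close> is contained in \<open>{u < h}\<close>.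
\<close>

lemma closed_measures_with_controlled_content: "closed (measures_with_controlled_content n)"
  unfolding closed_sequential_limits
proof (intro allI impI, elim conjE)
  fix p l assume "\<forall>i. p i \<in> measures_with_controlled_content n" and pl: "p \<longlonglongrightarrow> l"
  then have "\<forall>i. \<exists>A. A \<in> events \<and> prob A = p i \<and>
     (\<forall>h. 0 < h \<longrightarrow> h < 1 / Suc n \<longrightarrow> prob (enlargement UNIV dist A h) \<le> p i + real n * h)"
    unfolding measures_with_controlled_content_def by blast
  then obtain A where A: "\<And>i. A i \<in> events" "\<And>i. prob (A i) = p i"
    "\<And>i h. 0 < h \<Longrightarrow> h < 1 / Suc n \<Longrightarrow> prob (enlargement UNIV dist (A i) h) \<le> p i + real n * h"
    by (metis (no_types, lifting))
  interpret B: metric_prob_space M dist by (rule metric_prob_space_base)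
  define f where "f i x = (if A i = {} then 1 else min 1 (B.dist_to (A i) x))" for i x
  have f_less: "f i x < h \<longleftrightarrow> x \<in> enlargement UNIV dist (A i) h" if "h \<le> 1" for i x h
  proof (cases "A i = {}")
    case True
    then show ?thesis using that by (simp add: f_def enlargement_iff)
  next
    case False
    then have "f i x < h \<longleftrightarrow> B.dist_to (A i) x < h"
      unfolding f_def if_not_P[OF False] using that by linarith
    also have "\<dots> \<longleftrightarrow> (\<exists>a\<in>A i. dist x a < h)" by (rule B.dist_to_less_iff[OF False])
    finally show ?thesis by (simp add: enlargement_iff)
  qed
  have f_bnd: "0 \<le> f i x" "f i x \<le> 1" for i x using B.dist_to_nonneg[of "A i" x] by (auto simp: f_def)
  have f_lip: "\<bar>f i x - f i y\<bar> \<le> dist x y" for i x y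
  proof (cases "A i = {}")
    case False
    then have "\<bar>B.dist_to (A i) x - B.dist_to (A i) y\<bar> \<le> 1 * dist x y"
      using B.dist_to_lipschitz[of "A i"] unfolding lipschitz_with_def by simp
    with False show ?thesis unfolding f_def by simp
  qed (simp add: f_def)
  have f0: "f i x = 0" if "x \<in> A i" for i x
    using that B.dist_to_mem[of "A i" x] by (auto simp: f_def)
  obtain k u where k: "strict_mono (k :: nat \<Rightarrow> nat)" and u: "\<And>x. (\<lambda>i. f (k i) x) \<longlonglongrightarrow> u x"
    using pointwise_convergent_subsequence_lipschitz[of f] f_bnd f_lip by (metis abs_of_nonneg)
  have u_lip: "\<bar>u x - u y\<bar> \<le> dist x y" for x y
    using f_lip by (intro LIMSEQ_le_const2[OF tendsto_rabs[OF tendsto_diff[OF u u]]]) auto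
  have "lipschitz_with 1 (space M) dist u" using u_lip by (simp add: lipschitz_with_def)
  then have um [measurable]: "u \<in> borel_measurable M" by (rule B.lipschitz_measurable)
  have less_set: "{x \<in> space M. u x < h} \<in> events" for h by measurable
  have fm [measurable]: "f i \<in> borel_measurable M" for i
    using f_lip by (intro B.lipschitz_measurable[of 1]) (simp add: lipschitz_with_def)
  have pk: "(\<lambda>i. p (k i)) \<longlonglongrightarrow> l" using LIMSEQ_subseq_LIMSEQ[OF pl k] by (simp add: o_def)
  have upper: "prob {x \<in> space M. u x < h} \<le> l + real n * h" if h: "0 < h" "h < 1 / Suc n" for h
  proof -
    have h1: "h \<le> 1" using h(2) by (rule order.trans[OF less_imp_le]) simp
    define S where "S i = {x \<in> space M. \<forall>j\<ge>i. f (k j) x < h}" for i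
    have Sm: "S i \<in> events" for i unfolding S_def by measurable
    have inc: "incseq S" by (auto simp: incseq_def S_def)
    have "prob (S i) \<le> l + real n * h" for i
    proof (rule LIMSEQ_le_const[OF tendsto_add[OF pk tendsto_const]])
      have "prob (S i) \<le> p (k j) + real n * h" if "i \<le> j" for j
      proof -
        have "prob (S i) \<le> prob (enlargement UNIV dist (A (k j)) h)"
          using that f_less[OF h1] B.enlargement_sets[of "A (k j)" h]
          by (intro finite_measure_mono) (auto simp: S_def)
        also have "\<dots> \<le> p (k j) + real n * h" by (rule A(3)[OF h])
        finally show ?thesis .
      qed
      then show "\<exists>N. \<forall>j\<ge>N. prob (S i) \<le> p (k j) + real n * h" by blast
    qed
    moreover have "(\<lambda>i. prob (S i)) \<longlonglongrightarrow> prob (\<Union>i. S i)"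
      by (rule finite_Lim_measure_incseq[OF _ inc]) (use Sm in auto)
    ultimately have "prob (\<Union>i. S i) \<le> l + real n * h" by (intro LIMSEQ_le_const2) auto
    moreover have "{x \<in> space M. u x < h} \<subseteq> (\<Union>i. S i)"
    proof
      fix x assume "x \<in> {x \<in> space M. u x < h}"
      then have "eventually (\<lambda>i. f (k i) x < h) sequentially" using order_tendstoD(2)[OF u] by blast
      then show "x \<in> (\<Union>i. S i)" by (auto simp: eventually_sequentially S_def)
    qed
    then have "prob {x \<in> space M. u x < h} \<le> prob (\<Union>i. S i)"
      using Sm by (intro finite_measure_mono) auto
    ultimately show ?thesis by linarith
  qed
  define C where "C = {x \<in> space M. u x \<le> 0}"
  have Cm: "C \<in> events" unfolding C_def by measurable
  have "l \<le> prob C"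
  proof -
    define R where "R i = (\<Union>j\<in>{i..}. A (k j))" for i
    have Rm: "R i \<in> events" for i unfolding R_def using A(1) by (intro sets.countable_UN'') auto
    have dec: "decseq R" unfolding decseq_def R_def by (intro allI impI UN_mono) auto
    have "l \<le> prob (R i)" for i
    proof (rule LIMSEQ_le_const2[OF pk])
      have "p (k j) \<le> prob (R i)" if "i \<le> j" for j
        unfolding A(2)[symmetric] using that Rm by (intro finite_measure_mono) (auto simp: R_def)
      then show "\<exists>N. \<forall>j\<ge>N. p (k j) \<le> prob (R i)" by blast
    qed
    moreover have "(\<lambda>i. prob (R i)) \<longlonglongrightarrow> prob (\<Inter>i. R i)"
      by (rule finite_Lim_measure_decseq[OF _ dec]) (use Rm in auto)
    ultimately have "l \<le> prob (\<Inter>i. R i)" by (intro LIMSEQ_le_const) auto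
    moreover have "(\<Inter>i. R i) \<subseteq> C"
    proof
      fix x assume x: "x \<in> (\<Inter>i. R i)"
      have "u x \<le> 0"
      proof (rule ccontr)
        assume "\<not> u x \<le> 0"
        then have "eventually (\<lambda>i. 0 < f (k i) x) sequentially" by (intro order_tendstoD(1)[OF u]) simp
        then obtain i where i: "\<And>j. i \<le> j \<Longrightarrow> 0 < f (k j) x" by (auto simp: eventually_sequentially)
        from x obtain j where "i \<le> j" "x \<in> A (k j)" unfolding R_def by auto
        with i f0 show False by fastforce
      qed
      then show "x \<in> C" by (simp add: C_def)
    qed
    then have "prob (\<Inter>i. R i) \<le> prob C" by (intro finite_measure_mono Cm)
    ultimately show ?thesis by linarith
  qed
  moreover have "prob C \<le> l"
  proof (rule field_le_epsilon)
    fix e :: real assume e: "0 < e"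
    \<comment> \<open>Small enough for \<open>upper\<close> to apply and for \<open>n h \<le> e\<close>.\<close>
  define h where "h = min (1 / (2 * Suc n)) (e / (real n + 1))"
    have "1 / (2 * real (Suc n)) < 1 / real (Suc n)" by (simp add: divide_strict_left_mono)
    then have h: "0 < h" "h < 1 / Suc n" using e unfolding h_def by (auto simp: min_less_iff_disj)
    have "h \<le> e / (real n + 1)" unfolding h_def by simp
    then have "(real n + 1) * h \<le> e" by (simp add: pos_le_divide_eq mult.commute)
    then have "real n * h \<le> e" using h(1) by (simp add: distrib_right)
    moreover have "prob C \<le> prob {x \<in> space M. u x < h}"
      using h(1) by (intro finite_measure_mono less_set) (auto simp: C_def)
    ultimately show "prob C \<le> l + e" using upper[OF h] by linarith
  qed
  moreover have "prob (enlargement UNIV dist C h) \<le> l + real n * h" if h: "0 < h" "h < 1 / Suc n" for h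
  proof -
    have "enlargement UNIV dist C h \<subseteq> {x \<in> space M. u x < h}"
    proof
      fix x assume "x \<in> enlargement UNIV dist C h"
      then obtain a where "u a \<le> 0" "dist x a < h" by (auto simp: enlargement_iff C_def)
      then show "x \<in> {x \<in> space M. u x < h}" using u_lip[of x a] by simp
    qed
    then have "prob (enlargement UNIV dist C h) \<le> prob {x \<in> space M. u x < h}"
      by (rule finite_measure_mono[OF _ less_set])
    with upper[OF h] show ?thesis by linarith
  qed
  ultimately show "l \<in> measures_with_controlled_content n"
    unfolding measures_with_controlled_content_def using Cm by (intro CollectI bexI[of _ C]) auto
qed

lemma iso_profile_le_of_controlled_content:
  assumes "p \<in> measures_with_controlled_content n"
  shows "iso_profile M dist p \<le> ereal (real n)"
proof -
  interpret B: metric_prob_space M dist by (rule metric_prob_space_base)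
  obtain A where A: "A \<in> events" "prob A = p"
    "\<And>h. 0 < h \<Longrightarrow> h < 1 / Suc n \<Longrightarrow> prob (enlargement UNIV dist A h) \<le> p + real n * h"
    using assms unfolding measures_with_controlled_content_def by blast
  have "eventually (\<lambda>h::real. 0 < h \<and> h < 1 / Suc n) (at_right 0)"
    unfolding eventually_at_right_field by (intro exI[of _ "1 / Suc n"]) auto
  then have ev: "eventually (\<lambda>h. ereal ((prob (enlargement UNIV dist A h) - prob A) / h) \<le> ereal (real n)) (at_right 0)"
  proof eventually_elim
    case (elim h)
    then show ?case using A(3)[of h] A(2) by (simp add: pos_divide_le_eq)
  qed
  have "outer_boundary M dist A \<le> Limsup (at_right 0) (\<lambda>h. ereal ((prob (enlargement UNIV dist A h) - prob A) / h))"
    unfolding outer_boundary_def space_UNIV by (rule Liminf_le_Limsup) simp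
  also have "\<dots> \<le> ereal (real n)" by (rule Limsup_bounded[OF ev])
  finally have "outer_boundary M dist A \<le> ereal (real n)" .
  moreover have "A \<in> borel_sets (space M) dist" using A(1) by (simp add: borel_sets_UNIV sets_borel)
  ultimately show ?thesis using B.iso_profile_le_outer[of A] A(2) by (auto intro: order.trans)
qed

text \<open>
  The regularity hypothesis in the first power, transported to the base space.
\<close>

lemma controlled_content_covers:
  assumes R: "hypothesis_R M" and t: "0 < t" "t < 1"
  shows "\<exists>n. t \<in> measures_with_controlled_content n"
proof -
  interpret X: metric_prob_space "power_measure 1 M" "sup_dist 1" by (rule metric_prob_space_power) simp
  have "iso_profile M dist t < \<infinity>" using R t unfolding hypothesis_R_def by simp
  then obtain c where c: "iso_profile_pow 1 M t < ereal c"
    unfolding iso_profile_pow_1 using less_PInf_Ex_of_nat[of "iso_profile M dist t"] by auto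
  obtain A where A: "A \<in> borel_sets ({..<1} \<rightarrow>\<^sub>E UNIV) (sup_dist 1)" "measure (power_measure 1 M) A = t"
    "eventually (\<lambda>h. measure (power_measure 1 M) (enlargement ({..<1} \<rightarrow>\<^sub>E UNIV) (sup_dist 1) A h) \<le> t + c * h) (at_right 0)"
    by (rule regular_near_minimizer[OF R _ t c]) simp
  from A(3) obtain b where b: "0 < b" "\<And>h. 0 < h \<Longrightarrow> h < b \<Longrightarrow>
      measure (power_measure 1 M) (enlargement ({..<1} \<rightarrow>\<^sub>E UNIV) (sup_dist 1) A h) \<le> t + c * h"
    unfolding eventually_at_right_field by blast
  obtain n0 where n0: "1 / Suc n0 < b" using nat_approx_posE[OF b(1)] by blast
  define n where "n = max n0 (nat \<lceil>c\<rceil>)"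
  have "c \<le> real n" unfolding n_def by linarith
  have "1 / real (Suc n) \<le> 1 / real (Suc n0)" unfolding n_def by (intro divide_left_mono) auto
  then have nb: "1 / Suc n < b" using n0 by linarith
  have As: "A \<in> sets (power_measure 1 M)" "A \<subseteq> {..<1} \<rightarrow>\<^sub>E UNIV"
    using X.borel_sets_sets[of A] X.borel_sets_space[of A] A(1) by (simp_all del: One_nat_def)
  let ?B = "singleton_pt -` A"
  have "?B \<in> events" using singleton_pt_vimage_borel[OF A(1)] by (simp add: borel_sets_UNIV sets_borel)
  moreover have "prob ?B = t" using A(2) measure_power_1[OF As(1)] by simp
  moreover have "prob (enlargement UNIV dist ?B h) \<le> t + real n * h" if h: "0 < h" "h < 1 / Suc n" for h
  proof -
    have "enlargement ({..<1} \<rightarrow>\<^sub>E UNIV) (sup_dist 1) A h \<in> sets (power_measure 1 M)"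
      using X.enlargement_sets[of A h] As(2) by (simp del: One_nat_def)
    from measure_power_1[OF this]
    have "prob (enlargement UNIV dist ?B h) = measure (power_measure 1 M) (enlargement ({..<1} \<rightarrow>\<^sub>E UNIV) (sup_dist 1) A h)"
      unfolding enlargement_power_1[OF As(2)] ..
    also have "\<dots> \<le> t + c * h" using b(2) h nb by simp
    also have "\<dots> \<le> t + real n * h" using \<open>c \<le> real n\<close> h by (simp add: mult_right_mono)
    finally show ?thesis .
  qed
  ultimately show ?thesis unfolding measures_with_controlled_content_def by blast
qed

text \<open>
  Baire's theorem on a compact interval: countably many closed sets cover it, so one has interior.
\<close>

lemma iso_profile_bounded_on_interval:
  assumes R: "hypothesis_R M"
  obtains \<alpha> \<beta> K :: real where "0 < \<alpha>" "\<alpha> < \<beta>" "\<beta> < 1"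
    "\<And>t. \<alpha> \<le> t \<Longrightarrow> t \<le> \<beta> \<Longrightarrow> iso_profile M dist t \<le> ereal K"
proof -
  let ?S = "{1/4..3/4::real}" and ?T = "measures_with_controlled_content"
  have "\<exists>n. \<not> ?S \<subseteq> closure (?S - ?T n)"
  proof (rule ccontr)
    assume "\<not> ?thesis"
    then have dense: "?S \<subseteq> closure (?S - ?T n)" for n by blast
    have "?S \<subseteq> closure (\<Inter>(range (\<lambda>n. ?S - ?T n)))"
    proof (rule Baire)
      fix U assume "U \<in> range (\<lambda>n. ?S - ?T n)"
      then obtain n where U: "U = ?S - ?T n" by blast
      have "U = ?S \<inter> - ?T n" unfolding U by blast
      then have "openin (top_of_set ?S) U"
        using openin_open_Int[of "- ?T n" ?S] closed_measures_with_controlled_content by (simp add: open_Compl)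
      then show "openin (top_of_set ?S) U \<and> ?S \<subseteq> closure U" using dense U by simp
    qed auto
    moreover have "\<Inter>(range (\<lambda>n. ?S - ?T n)) = {}"
    proof (rule ccontr)
      assume "\<Inter>(range (\<lambda>n. ?S - ?T n)) \<noteq> {}"
      then obtain t where t: "\<And>n. t \<in> ?S - ?T n" by blast
      then have "t \<in> ?S" by blast
      then have "0 < t" "t < 1" by auto
      with controlled_content_covers[OF R] t show False by blast
    qed
    ultimately have "?S \<subseteq> {}" by (simp only: closure_empty)
    then show False by simp
  qed
  then obtain n x where x: "x \<in> ?S" "x \<notin> closure (?S - ?T n)" by blast
  then obtain e where e: "0 < e" "\<And>y. dist y x < e \<Longrightarrow> y \<notin> ?S - ?T n"
    unfolding closure_approachable by (metis dist_commute)
  define \<alpha> where "\<alpha> = max (1/4) (x - e / 2)"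
  define \<beta> where "\<beta> = min (3/4) (x + e / 2)"
  have x': "1/4 \<le> x" "x \<le> 3/4" using x(1) by auto
  have "0 < \<alpha>" "\<alpha> < \<beta>" "\<beta> < 1" unfolding \<alpha>_def \<beta>_def using x' e(1) by linarith+
  moreover have "iso_profile M dist t \<le> ereal (real n)" if "\<alpha> \<le> t" "t \<le> \<beta>" for t
  proof (rule iso_profile_le_of_controlled_content)
    have "dist t x < e" "t \<in> ?S" using that e(1) unfolding \<alpha>_def \<beta>_def dist_real_def abs_less_iff by auto
    then show "t \<in> ?T n" using e(2) by blast
  qed
  ultimately show thesis by (rule that)
qed

definition inf_profile :: "real \<Rightarrow> real" where
  "inf_profile t = real_of_ereal (iso_profile_inf M t)"

lemma iso_profile_pow_nonneg: "1 \<le> n \<Longrightarrow> 0 \<le> iso_profile_pow n M t"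
  unfolding iso_profile_pow_def by (rule metric_prob_space.iso_profile_nonneg[OF metric_prob_space_power])

lemma iso_profile_inf_nonneg: "0 \<le> iso_profile_inf M t"
  unfolding iso_profile_inf_def by (rule INF_greatest) (simp add: iso_profile_pow_nonneg)

lemma iso_profile_inf_le: "iso_profile_inf M t \<le> iso_profile M dist t"
  unfolding iso_profile_inf_def iso_profile_pow_1[symmetric] by (rule INF_lower) simp

lemma ereal_iso_profile:
  assumes "hypothesis_R M" "0 < t" "t < 1"
  shows "ereal (real_of_ereal (iso_profile M dist t)) = iso_profile M dist t"
  using assms metric_prob_space.iso_profile_nonneg[OF metric_prob_space_base, of t]
  unfolding hypothesis_R_def by (intro ereal_real') (metis abs_ereal_ge0 greaterThanLessThan_iff less_irrefl)

lemma ereal_inf_profile: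
  assumes "hypothesis_R M" "0 < t" "t < 1"
  shows "ereal (inf_profile t) = iso_profile_inf M t"
proof -
  have "iso_profile M dist t < \<infinity>" using assms unfolding hypothesis_R_def by simp
  then have "iso_profile_inf M t < \<infinity>" using iso_profile_inf_le[of t] by (rule le_less_trans[rotated])
  then show ?thesis unfolding inf_profile_def using iso_profile_inf_nonneg[of t]
    by (intro ereal_real') auto
qed

lemma inf_profile_approx:
  assumes R: "hypothesis_R M" and t: "0 < t" "t < 1" and e: "0 < e"
  obtains n where "1 \<le> n" "iso_profile_pow n M t < ereal (inf_profile t + e)"
proof -
  have "iso_profile_inf M t < ereal (inf_profile t + e)" using e by (simp flip: ereal_inf_profile[OF R t])
  then show thesis using that unfolding iso_profile_inf_def INF_less_iff by auto
qed

text \<open>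
  Near-minimizers in two powers of the space combine to a product set in the sum of the two dimensions.
\<close>

lemma inf_profile_product_subderivation:
  assumes R: "hypothesis_R M"
  shows "bounded_product_subderivation inf_profile"
proof -
  interpret P: product_subderivation inf_profile
  proof
    show "0 \<le> inf_profile t" for t
      unfolding inf_profile_def using iso_profile_inf_nonneg[of t] by (rule real_of_ereal_pos)
    show "inf_profile (1 - t) = inf_profile t" for t
    proof -
      have "iso_profile_pow n M (1 - t) = iso_profile_pow n M t" if "1 \<le> n" for n
        unfolding iso_profile_pow_def by (rule metric_prob_space.iso_profile_sym[OF metric_prob_space_power[OF that]])
      then have "iso_profile_inf M (1 - t) = iso_profile_inf M t"
        unfolding iso_profile_inf_def by (intro INF_cong refl) simp
      then show ?thesis by (simp add: inf_profile_def)
    qed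
    fix a b :: real assume ab: "0 < a" "a < 1" "0 < b" "b < 1"
    show "inf_profile (a * b) \<le> a * inf_profile b + b * inf_profile a"
    proof (rule field_le_epsilon)
      fix e :: real assume e: "0 < e"
      then have e2: "0 < e / 2" by simp
      obtain m where m: "1 \<le> m" "iso_profile_pow m M a < ereal (inf_profile a + e / 2)"
        by (rule inf_profile_approx[OF R ab(1,2) e2])
      obtain n where n: "1 \<le> n" "iso_profile_pow n M b < ereal (inf_profile b + e / 2)"
        by (rule inf_profile_approx[OF R ab(3,4) e2])
      have ab1: "0 < a * b" "a * b < 1" using ab mult_strict_mono[of a 1 b 1] by auto
      have "iso_profile_inf M (a * b) \<le> iso_profile_pow (m + n) M (a * b)"
        unfolding iso_profile_inf_def using m by (intro INF_lower) simp
      also have "\<dots> \<le> ereal (a * (inf_profile b + e / 2) + b * (inf_profile a + e / 2))"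
        by (rule iso_profile_pow_mult[OF R m(1) n(1) ab m(2) n(2)])
      finally have "inf_profile (a * b) \<le> a * (inf_profile b + e / 2) + b * (inf_profile a + e / 2)"
        by (simp flip: ereal_inf_profile[OF R ab1])
      also have "\<dots> = a * inf_profile b + b * inf_profile a + (a * (e / 2) + b * (e / 2))"
        by (simp add: algebra_simps)
      also have "a * (e / 2) + b * (e / 2) \<le> 1 * (e / 2) + 1 * (e / 2)"
        using ab e2 by (intro add_mono mult_right_mono) auto
      finally show "inf_profile (a * b) \<le> a * inf_profile b + b * inf_profile a + e" by simp
    qed
  qed
  obtain \<alpha> \<beta> K where ab: "0 < \<alpha>" "\<alpha> < \<beta>" "\<beta> < 1"
    and K: "\<And>t. \<alpha> \<le> t \<Longrightarrow> t \<le> \<beta> \<Longrightarrow> iso_profile M dist t \<le> ereal K"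
    using iso_profile_bounded_on_interval[OF R] by metis
  have "inf_profile t \<le> K" if t: "\<alpha> \<le> t" "t \<le> \<beta>" for t
  proof -
    have "ereal (inf_profile t) \<le> ereal K"
      using order.trans[OF iso_profile_inf_le K[OF t]] ereal_inf_profile[OF R, of t] t ab by simp
    then show ?thesis by simp
  qed
  from P.bounded_of_bounded_on_interval[OF ab this]
  show ?thesis by unfold_locales metis
qed

text \<open>
  The running supremum of \<open>F(s) / (s ln(1/s))\<close> is a non-decreasing comparison function.
\<close>

lemma ess_nondecreasing_of_dimension_free:
  assumes R: "hypothesis_R M" and K: "1 \<le> K"
    and le: "\<And>t. 0 < t \<Longrightarrow> t < 1 \<Longrightarrow> ereal (1 / K) * iso_profile M dist t \<le> iso_profile_inf M t"
  shows "ess_nondecreasing_on {0<..<1} (5 * K)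
    (\<lambda>t. real_of_ereal (iso_profile M dist t) / (t * ln (1 / t)))"
proof -
  interpret P: bounded_product_subderivation inf_profile by (rule inf_profile_product_subderivation[OF R])
  define q where "q t = inf_profile t / (t * ln (1 / t))" for t
  define f where "f t = real_of_ereal (iso_profile M dist t) / (t * ln (1 / t))" for t
  have den: "0 < t * ln (1 / t)" if "0 < t" "t < 1" for t :: real using that by simp
  have qf: "q t \<le> f t" "f t \<le> K * q t" if t: "0 < t" "t < 1" for t
  proof -
    have "ereal (inf_profile t) \<le> ereal (real_of_ereal (iso_profile M dist t))"
      unfolding ereal_inf_profile[OF R t] ereal_iso_profile[OF R t] by (rule iso_profile_inf_le)
    then have "inf_profile t \<le> real_of_ereal (iso_profile M dist t)" by simp
    then show "q t \<le> f t" unfolding q_def f_def using den[OF t] by (intro divide_right_mono) auto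
    have "ereal (1 / K) * ereal (real_of_ereal (iso_profile M dist t)) \<le> ereal (inf_profile t)"
      unfolding ereal_inf_profile[OF R t] ereal_iso_profile[OF R t] by (rule le[OF t])
    then have "1 / K * real_of_ereal (iso_profile M dist t) \<le> inf_profile t" by simp
    then have "real_of_ereal (iso_profile M dist t) \<le> K * inf_profile t"
      using K by (simp add: pos_divide_le_eq mult.commute)
    then have "f t \<le> (K * inf_profile t) / (t * ln (1 / t))"
      unfolding f_def using den[OF t] by (intro divide_right_mono) auto
    then show "f t \<le> K * q t" by (simp add: q_def)
  qed
  have q0: "0 \<le> q t" if "0 < t" "t < 1" for t
    unfolding q_def using P.nonneg[OF that] den[OF that] by simp
  have q_le: "q s \<le> 5 * q t" if "0 < s" "s \<le> t" "t < 1" for s t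
    unfolding q_def by (rule P.entropy_ratio_le[OF that])
  define g where "g t = (SUP s\<in>{0<..t}. q s)" for t
  have bdd: "bdd_above (q ` {0<..t})" if "t < 1" for t
    using q_le that by (intro bdd_aboveI[of _ "5 * q t"]) auto
  have gq: "q t \<le> g t" if "0 < t" "t < 1" for t
    unfolding g_def using that bdd by (intro cSUP_upper) auto
  have gle: "g t \<le> 5 * q t" if "0 < t" "t < 1" for t
    unfolding g_def using that q_le by (intro cSUP_least) auto
  show ?thesis unfolding ess_nondecreasing_on_def f_def[symmetric]
  proof (intro exI[of _ g] conjI)
    show "mono_on {0<..<1} g"
    proof (rule mono_onI)
      fix s t :: real assume st: "s \<in> {0<..<1}" "t \<in> {0<..<1}" "s \<le> t"
      show "g s \<le> g t" unfolding g_def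
        by (rule cSUP_subset_mono) (use st bdd in auto)
    qed
    show "approx_const {0<..<1} (5 * K) f g"
      unfolding approx_const_def
    proof (intro conjI ballI exI[of _ "1 / 5"])
      fix t :: real assume "t \<in> {0<..<1}"
      then have t: "0 < t" "t < 1" by auto
      show "0 \<le> f t" "0 \<le> g t" using q0[OF t] qf(1)[OF t] gq[OF t] by linarith+
      show "1 / 5 * g t \<le> f t" using gle[OF t] qf(1)[OF t] by linarith
      have "f t \<le> K * g t" using qf(2)[OF t] mult_left_mono[OF gq[OF t], of K] K by linarith
      then show "f t \<le> 5 * K * (1 / 5) * g t" by simp
    qed (use K in auto)
  qed
qed

end

section \<open>The equivalence\<close>

(* Under hypothesis_R the profile is finite on (0,1), so real_of_ereal loses nothing there. *)
theorem corollary2: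
  fixes M :: "'a::{metric_space, second_countable_topology} measure"
  assumes "prob_space M" and "sets M = sets borel"
    and "hypothesis_R M" and "hypothesis_H M"
  shows "(\<exists>C. ess_nondecreasing_on {0<..<1} C
               (\<lambda>t. real_of_ereal (iso_profile M dist t) / (t * ln (1 / t))))
     \<longleftrightarrow> (\<exists>K::real. 1 \<le> K \<and>
            (\<forall>t\<in>{0..1}. ereal (1 / K) * iso_profile M dist t \<le> iso_profile_inf M t \<and>
                        iso_profile_inf M t \<le> iso_profile M dist t))"
proof -
  interpret separable_metric_prob M
    by (intro separable_metric_prob.intro separable_metric_prob_axioms.intro assms)
  interpret B: metric_prob_space M dist by (rule metric_prob_space_base)
  have ends: "iso_profile M dist 0 = 0" "iso_profile M dist 1 = 0"
    using B.iso_profile_0 B.iso_profile_sym[of 0] by simp_all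
  show ?thesis
  proof
    assume "\<exists>C. ess_nondecreasing_on {0<..<1} C
               (\<lambda>t. real_of_ereal (iso_profile M dist t) / (t * ln (1 / t)))"
    then obtain C where C: "ess_nondecreasing_on {0<..<1} C
               (\<lambda>t. real_of_ereal (iso_profile M dist t) / (t * ln (1 / t)))" ..
    then have C1: "1 \<le> C" by (auto simp: ess_nondecreasing_on_def approx_const_def)
    show "\<exists>K::real. 1 \<le> K \<and>
            (\<forall>t\<in>{0..1}. ereal (1 / K) * iso_profile M dist t \<le> iso_profile_inf M t \<and>
                        iso_profile_inf M t \<le> iso_profile M dist t)"
    proof (intro exI[of _ "8 * C"] conjI ballI)
      fix t :: real assume t: "t \<in> {0..1}"
      show "iso_profile_inf M t \<le> iso_profile M dist t" by (rule iso_profile_inf_le)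
      show "ereal (1 / (8 * C)) * iso_profile M dist t \<le> iso_profile_inf M t"
      proof (cases "0 < t \<and> t < 1")
        case True
        then show ?thesis
          using dimension_free_of_ess_nondecreasing[OF assms(3,4) C] by blast
      next
        case False
        with t have "t = 0 \<or> t = 1" by auto
        then have "iso_profile M dist t = 0" using ends by blast
        then show ?thesis using iso_profile_inf_nonneg[of t] by simp
      qed
    qed (use C1 in simp)
  next
    assume "\<exists>K::real. 1 \<le> K \<and>
            (\<forall>t\<in>{0..1}. ereal (1 / K) * iso_profile M dist t \<le> iso_profile_inf M t \<and>
                        iso_profile_inf M t \<le> iso_profile M dist t)"
    then obtain K :: real where K: "1 \<le> K"
      "\<And>t. t \<in> {0..1} \<Longrightarrow> ereal (1 / K) * iso_profile M dist t \<le> iso_profile_inf M t"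
      by blast
    have "ess_nondecreasing_on {0<..<1} (5 * K)
        (\<lambda>t. real_of_ereal (iso_profile M dist t) / (t * ln (1 / t)))"
      by (rule ess_nondecreasing_of_dimension_free[OF assms(3) K(1)]) (simp add: K(2))
    then show "\<exists>C. ess_nondecreasing_on {0<..<1} C
        (\<lambda>t. real_of_ereal (iso_profile M dist t) / (t * ln (1 / t)))" ..
  qed
qed

end
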